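(* Fix $d\ge2$, $i\ge1$ and a partition $\nu$, and for $n\ge|\nu|+\nu_1$ let $f_{i,\nu}(n)=\langle\chi^{(n-|\nu|,\nu)},H^{i(d-1)}(\mathrm{Conf}(n,\mathbb R^d);\mathbb Q)\rangle_{S_n}$. Then $f_{i,\nu}(n)=0$ for all $n$ unless $|\nu|\le2i$, and $f_{i,\nu}(n)$ is constant as a function of $n$ for $n\ge|\nu|+i$ when $d$ is odd, and for $n\ge|\nu|+i+1$ when $d$ is even.
   Context: $\mathrm{Conf}(n,\mathbb R^d)$ is the space of ordered $n$-tuples of distinct points of $\mathbb R^d$, with $S_n$ permuting coordinates. $(n-|\nu|,\nu)$ denotes the partition $(n-|\nu|,\nu_1,\nu_2,\dots)$, $\chi^\lambda$ the irreducible $S_n$-character, and $\langle\cdot,\cdot\rangle_{S_n}$ the multiplicity pairing. *)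

theory Defs
  imports "HOL-Analysis.Analysis" "HOL-Combinatorics.Permutations"
begin

definition std_simplex :: "nat \<Rightarrow> (nat \<Rightarrow> real) set" where
  "std_simplex k = {t. (\<forall>i. 0 \<le> t i) \<and> (\<forall>i>k. t i = 0) \<and> (\<Sum>i\<le>k. t i) = 1}"

definition std_simplex_top :: "nat \<Rightarrow> (nat \<Rightarrow> real) topology" where
  "std_simplex_top k = subtopology (powertop_real UNIV) (std_simplex k)"

definition sing_simplex :: "'a topology \<Rightarrow> nat \<Rightarrow> ((nat \<Rightarrow> real) \<Rightarrow> 'a) \<Rightarrow> bool" where
  "sing_simplex X k f \<longleftrightarrow> continuous_map (std_simplex_top k) X f \<and> f \<in> extensional (std_simplex k)"

definition face_incl :: "nat \<Rightarrow> (nat \<Rightarrow> real) \<Rightarrow> (nat \<Rightarrow> real)" where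
  "face_incl j t = (\<lambda>i. if i < j then t i else if i = j then 0 else t (i - 1))"

definition face :: "nat \<Rightarrow> nat \<Rightarrow> ((nat \<Rightarrow> real) \<Rightarrow> 'a) \<Rightarrow> ((nat \<Rightarrow> real) \<Rightarrow> 'a)" where
  "face k j f = restrict (f \<circ> face_incl j) (std_simplex (k - 1))"

definition cochains :: "'a topology \<Rightarrow> nat \<Rightarrow> (((nat \<Rightarrow> real) \<Rightarrow> 'a) \<Rightarrow> rat) set" where
  "cochains X k = {\<phi>. \<forall>f. \<not> sing_simplex X k f \<longrightarrow> \<phi> f = 0}"

definition coboundary :: "'a topology \<Rightarrow> nat \<Rightarrow> (((nat \<Rightarrow> real) \<Rightarrow> 'a) \<Rightarrow> rat)
    \<Rightarrow> (((nat \<Rightarrow> real) \<Rightarrow> 'a) \<Rightarrow> rat)" where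
  "coboundary X k \<phi> = (\<lambda>f. if sing_simplex X (Suc k) f
      then (\<Sum>j\<le>Suc k. (-1) ^ j * \<phi> (face (Suc k) j f)) else 0)"

definition cocycles :: "'a topology \<Rightarrow> nat \<Rightarrow> (((nat \<Rightarrow> real) \<Rightarrow> 'a) \<Rightarrow> rat) set" where
  "cocycles X k = {\<phi> \<in> cochains X k. coboundary X k \<phi> = (\<lambda>_. 0)}"

definition coboundaries :: "'a topology \<Rightarrow> nat \<Rightarrow> (((nat \<Rightarrow> real) \<Rightarrow> 'a) \<Rightarrow> rat) set" where
  "coboundaries X k = (if k = 0 then {\<lambda>_. 0}
      else coboundary X (k - 1) ` cochains X (k - 1))"

definition pullback :: "'a topology \<Rightarrow> nat \<Rightarrow> ('a \<Rightarrow> 'b)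
    \<Rightarrow> (((nat \<Rightarrow> real) \<Rightarrow> 'b) \<Rightarrow> rat) \<Rightarrow> (((nat \<Rightarrow> real) \<Rightarrow> 'a) \<Rightarrow> rat)" where
  "pullback X k g \<phi> = (\<lambda>f. if sing_simplex X k f
      then \<phi> (restrict (g \<circ> f) (std_simplex k)) else 0)"

text \<open>Trace of the endomorphism induced by T on the finite-dimensional
  rational vector space Z/B (Z, B spaces of rational-valued functions).\<close>
definition lin_comb :: "nat \<Rightarrow> (nat \<Rightarrow> rat) \<Rightarrow> (nat \<Rightarrow> 'b \<Rightarrow> rat) \<Rightarrow> 'b \<Rightarrow> rat" where
  "lin_comb r a z = (\<lambda>s. \<Sum>i<r. a i * z i s)"

definition quot_trace :: "('b \<Rightarrow> rat) set \<Rightarrow> ('b \<Rightarrow> rat) set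
    \<Rightarrow> (('b \<Rightarrow> rat) \<Rightarrow> ('b \<Rightarrow> rat)) \<Rightarrow> rat" where
  "quot_trace Z B T = (THE t. \<exists>r z c.
      (\<forall>i<r. z i \<in> Z)
    \<and> (\<forall>a. lin_comb r a z \<in> B \<longrightarrow> (\<forall>i<r. a i = 0))
    \<and> (\<forall>y\<in>Z. \<exists>a. (\<lambda>s. y s - lin_comb r a z s) \<in> B)
    \<and> (\<forall>j<r. (\<lambda>s. T (z j) s - lin_comb r (c j) z s) \<in> B)
    \<and> t = (\<Sum>j<r. c j j))"

definition cohom_trace :: "'a topology \<Rightarrow> nat \<Rightarrow> ('a \<Rightarrow> 'a) \<Rightarrow> rat" where
  "cohom_trace X k g = quot_trace (cocycles X k) (coboundaries X k) (pullback X k g)"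

definition conf_top :: "nat \<Rightarrow> (nat \<Rightarrow> 'a::topological_space) topology" where
  "conf_top n = subtopology (product_topology (\<lambda>_. euclidean) {..<n}) {x. inj_on x {..<n}}"

text \<open>sigma acts on points by (sigma . x) = x o inv sigma; the induced representation on
  cohomology is rho(sigma) = (action of inv sigma)^* = pullback along (x |-> x o sigma).\<close>
definition conf_char :: "'a::topological_space itself \<Rightarrow> nat \<Rightarrow> nat \<Rightarrow> (nat \<Rightarrow> nat) \<Rightarrow> rat" where
  "conf_char _ n k \<sigma> = cohom_trace (conf_top n :: (nat \<Rightarrow> 'a) topology) k (\<lambda>x. x \<circ> \<sigma>)"

definition is_partition :: "nat list \<Rightarrow> bool" where
  "is_partition \<nu> \<longleftrightarrow> sorted_wrt (\<ge>) \<nu> \<and> (\<forall>x\<in>set \<nu>. 0 < x)"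

definition first_part :: "nat list \<Rightarrow> nat" where
  "first_part \<nu> = (case \<nu> of [] \<Rightarrow> 0 | a # _ \<Rightarrow> a)"

text \<open>Permutation character of S_n on tabloids (ordered set partitions) of
  composition mu; zero if some entry of mu is negative.\<close>
definition tabloid_fix :: "nat \<Rightarrow> int list \<Rightarrow> (nat \<Rightarrow> nat) \<Rightarrow> nat" where
  "tabloid_fix n \<mu> \<sigma> = (if (\<exists>j<length \<mu>. \<mu> ! j < 0) then 0 else
     card {t \<in> {..<n} \<rightarrow>\<^sub>E {..<length \<mu>}.
        (\<forall>j<length \<mu>. card {x\<in>{..<n}. t x = j} = nat (\<mu> ! j)) \<and> (\<forall>x<n. t (\<sigma> x) = t x)})"

text \<open>Irreducible character chi^lam of S_n, via the Jacobi-Trudi / determinantal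
  formula chi^lam = det(h_{lam_i - i + j}), h_mu = permutation character on tabloids.\<close>
definition irr_char :: "nat list \<Rightarrow> nat \<Rightarrow> (nat \<Rightarrow> nat) \<Rightarrow> int" where
  "irr_char lam n \<sigma> = (\<Sum>w | w permutes {..<length lam}.
     sign w * int (tabloid_fix n (map (\<lambda>i. int (lam ! i) - int i + int (w i)) [0..<length lam]) \<sigma>))"

definition mult_pair :: "nat \<Rightarrow> ((nat \<Rightarrow> nat) \<Rightarrow> int) \<Rightarrow> ((nat \<Rightarrow> nat) \<Rightarrow> rat) \<Rightarrow> rat" where
  "mult_pair n ch \<psi> = (\<Sum>\<sigma> | \<sigma> permutes {..<n}. of_int (ch \<sigma>) * \<psi> \<sigma>) / fact n"

definition f_mult :: "'d::finite itself \<Rightarrow> nat \<Rightarrow> nat list \<Rightarrow> nat \<Rightarrow> rat" where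
  "f_mult D i \<nu> n = mult_pair n (irr_char ((n - sum_list \<nu>) # \<nu>) n)
      (conf_char (TYPE(real^'d)) n (i * (CARD('d) - 1)))"

end

theory Submission
  imports Defs "HOL-Homology.Homology" "HOL-Library.Function_Algebras"
begin

text \<open>For two points a, b of a configuration let \<open>omega_ab\<close> be the class of the direction from b to a. Products
  of i such classes are evaluated on homology classes of degree i(d-1) by iterated residues along
  \<open>x_a = x_b\<close>. Adding points one at a time (a new point is either far away or circles around an old
  one) shows that the homology is free with a basis dual to the monomials \<open>omega_{x1,a1} omega_{x2,a2} ...\<close>
  with \<open>x1 > x2 > ...\<close> and \<open>x_k > a_k\<close>. Hence the character of the symmetric group on cohomology is a sum,
  over such monomials, of entries of an explicit matrix built from contractions of edges.

  A monomial of degree i involves at most 2i points. By Young's rule and the Jacobi--Trudi formula the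
  multiplicity is therefore a sum, over maps t from at most 2i points to the rows of the partition, of
  a coefficient independent of n times a determinant with entries 0 and 1 that records whether the
  fibres of t fit into the rows. The coefficient vanishes when the fibre K over the first row is
  too large: averaging a monomial of degree i over the permutations of K gives 0 if K has more than i
  points (d odd) or more than i + 1 points (d even). Indeed the collision of two points of K is killed by
  antisymmetry if d is odd, and two successive collisions inside K are killed by anticommutativity or by
  the Arnold relation if d is even. So the first row imposes no condition
  once it is long enough. The determinant is nonzero only if t has at least as many points as the
  partition below the first row, and this is impossible if its size exceeds 2i.\<close>


subsection \<open>Deleting an edge from a list of edges\<close>

text \<open>All topology is done with integral singular cycles; rational cochains enter only at the
  end, when additive functions on cycles are extended to all chains. Cup products do not occur: a
  monomial is evaluated on a cycle by sending a configuration to the tuple of its difference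
  vectors, a point of a power of the punctured space, and taking the degree there. Residues are
  relations between chains, since the connecting maps behind them depend on choices. Two signs
  govern the combinatorics. \<open>dl\<close>, the effect of reversing an edge, is (-1)^d, found by
  reflecting one coordinate after the other. \<open>eps\<close>, the effect of interchanging two
  factors, is never computed geometrically: the homology of three points forces
  \<open>eps = - dl\<close>. The constants of the stable range come from the first row of the
  determinant. With k points in the fibre K its condition reads k \<le> n - |\<nu>| + w(0), which
  holds for every permutation w once k \<le> n - |\<nu>|. The bounds k \<le> i and k \<le> i + 1
  give the two ranges. One more point is allowed for even d because a single collision inside K may
  survive the averaging there.\<close>

type_synonym edge = "nat \<times> nat"

text \<open>A signed derivation on monomials: one factor is removed with weight \<open>om\<close>,
  and \<open>eps\<close> is the Koszul sign for moving it past each earlier factor.\<close>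

fun del_op :: "int \<Rightarrow> (edge \<Rightarrow> int) \<Rightarrow> (edge list \<Rightarrow> int) \<Rightarrow> edge list \<Rightarrow> int" where
  "del_op eps om g [] = 0"
| "del_op eps om g (f # F) = om f * g F + eps * del_op eps om (\<lambda>G. g (f # G)) F"

definition sbv :: "nat \<Rightarrow> nat \<Rightarrow> nat \<Rightarrow> nat" where "sbv x a v = (if v = x then a else v)"

abbreviation rl :: "(nat \<Rightarrow> nat) \<Rightarrow> edge list \<Rightarrow> edge list" where
  "rl f \<equiv> map (map_prod f f)"

text \<open>Reversing an edge composes its direction with the antipode, whose degree is
  \<open>dl\<close>.\<close>

definition wt :: "int \<Rightarrow> nat \<Rightarrow> nat \<Rightarrow> edge \<Rightarrow> int" where
  "wt dl x a f = (if f = (x, a) then 1 else if f = (a, x) then dl else 0)"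

text \<open>Contracting the edge between x and a: the combinatorial form of taking the residue along the
  diagonal where the points x and a collide; x is then renamed to a.\<close>
definition contr :: "int \<Rightarrow> int \<Rightarrow> nat \<Rightarrow> nat \<Rightarrow> (edge list \<Rightarrow> int) \<Rightarrow> edge list \<Rightarrow> int" where
  "contr dl eps x a e F = del_op eps (wt dl x a) (\<lambda>G. e (rl (sbv x a) G)) F"

definition verts :: "edge list \<Rightarrow> nat set" where
  "verts F = fst ` set F \<union> snd ` set F"

text \<open>Evaluation after x has been placed far away: the class of an edge at x then contributes
  nothing.\<close>

definition avoid :: "nat \<Rightarrow> (edge list \<Rightarrow> int) \<Rightarrow> edge list \<Rightarrow> int" where
  "avoid x e F = (if x \<in> verts F then 0 else e F)"

definition valid :: "nat set \<Rightarrow> edge list \<Rightarrow> bool" where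
  "valid S F \<longleftrightarrow> (\<forall>(a, b)\<in>set F. a \<noteq> b \<and> a \<in> S \<and> b \<in> S)"

lemma verts_simps [simp]: "verts [] = {}" "verts (f # F) = {fst f, snd f} \<union> verts F"
  "verts (F @ G) = verts F \<union> verts G"
  by (auto simp: verts_def)

lemma verts_rl [simp]: "verts (rl f F) = f ` verts F"
  by (force simp: verts_def)

lemma finite_verts [simp]: "finite (verts F)" by (simp add: verts_def)

lemma rl_rl: "rl f (rl g F) = rl (f \<circ> g) F"
  by (induction F) auto

lemma rl_cong: "(\<And>v. v \<in> verts F \<Longrightarrow> f v = g v) \<Longrightarrow> rl f F = rl g F"
  by (induction F) auto

lemma rl_ident: "(\<And>v. v \<in> verts F \<Longrightarrow> f v = v) \<Longrightarrow> rl f F = F"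
  using rl_cong[of F f id] by (simp add: map_prod.id)

lemma del_op_sum: "del_op eps om g F = (\<Sum>s<length F. om (F ! s) * eps ^ s * g (take s F @ drop (Suc s) F))"
proof (induction F arbitrary: g)
  case (Cons f F)
  have "(\<Sum>s<length (f # F). om ((f # F) ! s) * eps ^ s * g (take s (f # F) @ drop (Suc s) (f # F))) =
     om f * g F + (\<Sum>s<length F. om (F ! s) * eps ^ Suc s * g (f # take s F @ drop (Suc s) F))"
    by (simp only: length_Cons sum.lessThan_Suc_shift) simp
  then show ?case by (simp add: Cons sum_distrib_left mult_ac)
qed simp

lemma del_op_add: "del_op eps om (\<lambda>G. g G + h G) F = del_op eps om g F + del_op eps om h F"
  by (simp add: del_op_sum sum.distrib algebra_simps)

lemma del_op_wt_add: "del_op eps (\<lambda>f. om f + om' f) g F = del_op eps om g F + del_op eps om' g F"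
  by (simp add: del_op_sum sum.distrib algebra_simps)

lemma del_op_wt_mult: "del_op eps (\<lambda>f. c * om f) g F = c * del_op eps om g F"
  by (simp add: del_op_sum sum_distrib_left algebra_simps)

lemma del_op_sum_fun: "del_op eps om (\<lambda>G. \<Sum>i\<in>I. g i G) F = (\<Sum>i\<in>I. del_op eps om (g i) F)"
  unfolding del_op_sum sum_distrib_left by (rule sum.swap)

lemma del_op_zero [simp]: "del_op eps om (\<lambda>G. 0) F = 0"
  by (simp add: del_op_sum)

lemma del_op_mult: "del_op eps om (\<lambda>G. c * g G) F = c * del_op eps om g F"
  by (simp add: del_op_sum sum_distrib_left algebra_simps)

lemma del_op_map: "del_op eps om g (map f F) = del_op eps (\<lambda>v. om (f v)) (\<lambda>G. g (map f G)) F"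
  by (induction F arbitrary: g) auto

text \<open>In exactly one of the two orders of deletion the first edge removed has to pass the
  other one, which gives one extra factor \<open>eps\<close>.\<close>

lemma del_op_commute:
  assumes "eps * eps = 1"
  shows "del_op eps om (\<lambda>G. del_op eps om' g G) F = eps * del_op eps om' (\<lambda>G. del_op eps om g G) F"
proof (induction F arbitrary: g)
  case (Cons f F)
  have e: "eps * (eps * c) = c" for c using assms by (metis mult.assoc mult_1)
  have "del_op eps om (\<lambda>G. del_op eps om' g G) (f # F) =
     om f * del_op eps om' g F + eps * (om' f * del_op eps om g F)
      + eps * (eps * del_op eps om (\<lambda>G. del_op eps om' (\<lambda>H. g (f # H)) G) F)"
    by (simp add: del_op_add del_op_mult distrib_left)
  moreover have "del_op eps om' (\<lambda>G. del_op eps om g G) (f # F) =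
     om' f * del_op eps om g F + eps * (om f * del_op eps om' g F)
      + eps * (eps * del_op eps om' (\<lambda>G. del_op eps om (\<lambda>H. g (f # H)) G) F)"
    by (simp add: del_op_add del_op_mult distrib_left)
  ultimately show ?case by (simp add: e Cons algebra_simps)
qed simp

lemma verts_remove: "verts F \<subseteq> verts (take s F @ drop (Suc s) F) \<union> (if s < length F then {fst (F ! s), snd (F ! s)} else {})"
proof (cases "s < length F")
  case True
  then have "verts F = verts (take s F @ F ! s # drop (Suc s) F)" by (simp add: id_take_nth_drop[symmetric])
  then show ?thesis using True by auto
next
  case False then show ?thesis by auto
qed

lemma verts_remove_subset: "verts (take s F @ drop (Suc s) F) \<subseteq> verts F"
  by (auto simp: verts_def dest: in_set_takeD in_set_dropD)

lemma contr_add: "contr dl eps x a (\<lambda>G. g G + h G) F = contr dl eps x a g F + contr dl eps x a h F"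
  by (simp add: contr_def del_op_add)

lemma contr_sum_fun: "contr dl eps x a (\<lambda>G. \<Sum>i\<in>I. g i G) F = (\<Sum>i\<in>I. contr dl eps x a (g i) F)"
  by (simp add: contr_def del_op_sum_fun)

lemma contr_zero [simp]: "contr dl eps x a (\<lambda>G. 0) F = 0"
  by (simp add: contr_def)

lemma contr_sum: "contr dl eps x a e F =
   (\<Sum>s<length F. wt dl x a (F ! s) * eps ^ s * e (rl (sbv x a) (take s F @ drop (Suc s) F)))"
  by (simp add: contr_def del_op_sum)

lemma contr_rl:
  assumes "inj f"
  shows "contr dl eps (f x) (f a) e (rl f F) = contr dl eps x a (\<lambda>G. e (rl f G)) F"
proof -
  have "wt dl (f x) (f a) (map_prod f f v) = wt dl x a v" for v
    using assms by (cases v) (auto simp: wt_def inj_eq)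
  moreover have "rl (sbv (f x) (f a)) (rl f G) = rl f (rl (sbv x a) G)" for G
    unfolding rl_rl using assms by (intro rl_cong) (auto simp: sbv_def inj_eq)
  ultimately show ?thesis by (simp add: contr_def del_op_map del: map_map)
qed

text \<open>Only an edge between x and a is deleted, so the points of Y remain vertices of every
  term with nonzero weight, and e vanishes there.\<close>

lemma contr_zeroI:
  assumes "\<And>G. Y \<subseteq> verts G \<Longrightarrow> e G = 0" "Y \<subseteq> verts F" "x \<notin> Y" "a \<notin> Y"
  shows "contr dl eps x a e F = 0"
  unfolding contr_sum
proof (intro sum.neutral ballI)
  fix s assume "s \<in> {..<length F}"
  show "wt dl x a (F ! s) * eps ^ s * e (rl (sbv x a) (take s F @ drop (Suc s) F)) = 0"
  proof (cases "F ! s = (x, a) \<or> F ! s = (a, x)")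
    case True
    then have "Y \<subseteq> verts (take s F @ drop (Suc s) F)"
      using verts_remove[of F s] assms(2-4) by (auto split: if_splits)
    then have "sbv x a ` Y \<subseteq> verts (rl (sbv x a) (take s F @ drop (Suc s) F))"
      unfolding verts_rl by blast
    moreover have "sbv x a ` Y = Y" using assms(3) by (force simp: sbv_def)
    ultimately show ?thesis using assms(1) by simp
  qed (simp add: wt_def)
qed

lemma contr_no_vertex:
  assumes "x \<notin> verts F" shows "contr dl eps x a e F = 0"
  unfolding contr_sum
proof (intro sum.neutral ballI)
  fix s assume "s \<in> {..<length F}"
  then have "{fst (F ! s), snd (F ! s)} \<subseteq> verts F" by (auto simp: verts_def)
  then have "F ! s \<noteq> (x, a)" "F ! s \<noteq> (a, x)" using assms by force+
  then show "wt dl x a (F ! s) * eps ^ s * e (rl (sbv x a) (take s F @ drop (Suc s) F)) = 0"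
    by (simp add: wt_def)
qed

text \<open>Interchanging x and a reverses the contracted edge and becomes invisible on the rest
  once both points carry the name a.\<close>

lemma contr_flip:
  assumes "dl * dl = 1" "x \<noteq> a"
  shows "contr dl eps x a e (rl (Transposition.transpose x a) F) = dl * contr dl eps x a e F"
proof -
  have "wt dl x a (map_prod (Transposition.transpose x a) (Transposition.transpose x a) v) = dl * wt dl x a v" for v
    using assms by (cases v) (auto simp: wt_def Transposition.transpose_def)
  moreover have "rl (sbv x a) (rl (Transposition.transpose x a) G) = rl (sbv x a) G" for G
    unfolding rl_rl by (intro rl_cong) (auto simp: sbv_def Transposition.transpose_def)
  ultimately show ?thesis by (simp add: contr_def del_op_map del_op_wt_mult del: map_map)
qed

lemma contr_contr: "contr dl eps x a (\<lambda>G. contr dl eps y b e G) F =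
   del_op eps (wt dl x a) (del_op eps (\<lambda>v. wt dl y b (map_prod (sbv x a) (sbv x a) v))
       (\<lambda>G. e (rl (sbv y b \<circ> sbv x a) G))) F"
  by (simp add: contr_def del_op_map rl_rl del: map_map)

text \<open>The two pairs share no point, so neither renaming affects the weights of the other
  contraction; only the sign of \<open>del_op_commute\<close> is left.\<close>

lemma contr_commute:
  assumes "eps * eps = 1" "x \<noteq> y" "x \<noteq> b" "a \<noteq> y" "a \<noteq> b"
  shows "contr dl eps x a (\<lambda>G. contr dl eps y b e G) F = eps * contr dl eps y b (\<lambda>G. contr dl eps x a e G) F"
proof -
  have 1: "wt dl y b (map_prod (sbv x a) (sbv x a) v) = wt dl y b v" for v
    using assms by (cases v) (auto simp: wt_def sbv_def)
  have 2: "wt dl x a (map_prod (sbv y b) (sbv y b) v) = wt dl x a v" for v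
    using assms by (cases v) (auto simp: wt_def sbv_def)
  have 3: "sbv y b \<circ> sbv x a = sbv x a \<circ> sbv y b"
    using assms by (auto simp: sbv_def)
  show ?thesis
    unfolding contr_contr 1 2 3 by (rule del_op_commute[OF assms(1)])
qed

text \<open>The Arnold relation, dually.\<close>
lemma contr_jacobi:
  assumes "x \<noteq> y" "x \<noteq> a" "y \<noteq> a"
  shows "contr 1 (-1) x a (\<lambda>G. contr 1 (-1) y a e G) F + contr 1 (-1) y a (\<lambda>G. contr 1 (-1) x a e G) F
     + contr 1 (-1) x y (\<lambda>G. contr 1 (-1) y a e G) F = 0"
proof -
  \<comment> \<open>After x is renamed to a, an edge between y and a comes from one between y and a
    or one between x and y. So each of the three summands splits into two double deletions, and the
    six cancel in pairs by anticommutation.\<close>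
  have 1: "wt 1 y a (map_prod (sbv x a) (sbv x a) v) = wt 1 y a v + wt 1 x y v" for v
    using assms by (cases v) (auto simp: wt_def sbv_def)
  have 2: "wt 1 x a (map_prod (sbv y a) (sbv y a) v) = wt 1 x a v + wt 1 x y v" for v
    using assms by (cases v) (auto simp: wt_def sbv_def)
  have 3: "wt 1 y a (map_prod (sbv x y) (sbv x y) v) = wt 1 y a v + wt 1 x a v" for v
    using assms by (cases v) (auto simp: wt_def sbv_def)
  have 4: "sbv x a \<circ> sbv y a = sbv y a \<circ> sbv x a" "sbv y a \<circ> sbv x y = sbv y a \<circ> sbv x a"
    using assms by (auto simp: sbv_def)
  define g where "g = (\<lambda>G. e (rl (sbv y a \<circ> sbv x a) G))"
  have c: "del_op (-1) om (\<lambda>G. del_op (-1) om' g G) F = - del_op (-1) om' (\<lambda>G. del_op (-1) om g G) F" for om om'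
    using del_op_commute[of "-1" om om' g F] by simp
  show ?thesis
    unfolding contr_contr 1 2 3 4 g_def[symmetric] del_op_wt_add del_op_add
    using c[of "wt 1 x a" "wt 1 y a"] c[of "wt 1 x a" "wt 1 x y"] c[of "wt 1 y a" "wt 1 x y"]
    by simp
qed

lemma avoid_contr:
  assumes "z \<noteq> x" "z \<noteq> a"
  shows "avoid z (contr dl eps x a e) = contr dl eps x a (avoid z e)"
proof
  fix F
  show "avoid z (contr dl eps x a e) F = contr dl eps x a (avoid z e) F"
  proof (cases "z \<in> verts F")
    case True
    have "contr dl eps x a (avoid z e) F = 0"
      by (rule contr_zeroI[of "{z}"]) (use True assms in \<open>auto simp: avoid_def\<close>)
    then show ?thesis using True by (simp add: avoid_def)
  next
    case False
    have "z \<notin> verts (rl (sbv x a) (take s F @ drop (Suc s) F))" for s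
      unfolding verts_rl using False assms verts_remove_subset[of s F] by (auto simp: sbv_def split: if_splits)
    then show ?thesis using False by (simp add: avoid_def contr_sum)
  qed
qed

lemma valid_rl: "valid S F \<Longrightarrow> inj_on f S \<Longrightarrow> f ` S \<subseteq> S' \<Longrightarrow> valid S' (rl f F)"
  by (fastforce simp: valid_def inj_on_def)

subsection \<open>Families closed under collisions\<close>

text \<open>The model: E S i consists of the evaluations of the degree i monomials in the classes
  \<open>omega_ab\<close> of the configuration space of S on its homology classes.\<close>
locale config_family =
  fixes E :: "nat set \<Rightarrow> nat \<Rightarrow> (edge list \<Rightarrow> int) set" and dl eps :: int
  assumes dec: "\<And>S x e i. finite S \<Longrightarrow> x \<in> S \<Longrightarrow> e \<in> E S i \<Longrightarrow> \<exists>e0\<in>E (S - {x}) i. \<exists>h.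
      (\<forall>a\<in>S - {x}. h a = (\<lambda>F. 0) \<or> (\<exists>j. i = Suc j \<and> h a \<in> E (S - {x}) j)) \<and>
      e = (\<lambda>F. avoid x e0 F + (\<Sum>a\<in>S - {x}. contr dl eps x a (h a) F))"
    and E_avoid: "\<And>S x e i. finite S \<Longrightarrow> x \<notin> S \<Longrightarrow> e \<in> E S i \<Longrightarrow> avoid x e \<in> E (insert x S) i"
    and E_contr: "\<And>S x a e i. finite S \<Longrightarrow> x \<notin> S \<Longrightarrow> a \<in> S \<Longrightarrow> e \<in> E S i \<Longrightarrow>
        contr dl eps x a e \<in> E (insert x S) (Suc i)"
    and E_valid: "\<And>S i e F. e \<in> E S i \<Longrightarrow> e F \<noteq> 0 \<Longrightarrow> valid S F \<and> length F = i"
    and E_unit: "(\<lambda>F. if F = [] then 1 else 0) \<in> E {} 0"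
    and dl: "dl * dl = 1" and eps: "eps * eps = 1"
begin

text \<open>Induction principle from \<open>dec\<close>: a functional is a sum of one in which x
  stays alone and of collisions of x with other points, so an additive Q has to be tested on these
  two kinds only.\<close>

lemma E_test:
  assumes "finite S" "x \<in> S" "e \<in> E S i"
    and add: "\<And>f g. Q (\<lambda>F. f F + g F) = Q f + (Q g :: int)"
    and 1: "\<And>e0. e0 \<in> E (S - {x}) i \<Longrightarrow> Q (avoid x e0) = 0"
    and 2: "\<And>a j h. a \<in> S - {x} \<Longrightarrow> i = Suc j \<Longrightarrow> h \<in> E (S - {x}) j \<Longrightarrow> Q (contr dl eps x a h) = 0"
  shows "Q e = 0"
proof -
  from dec[OF assms(1-3)] obtain e0 h where e0: "e0 \<in> E (S - {x}) i"
    and h': "\<forall>a\<in>S - {x}. h a = (\<lambda>F. 0) \<or> (\<exists>j. i = Suc j \<and> h a \<in> E (S - {x}) j)"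
    and e: "e = (\<lambda>F. avoid x e0 F + (\<Sum>a\<in>S - {x}. contr dl eps x a (h a) F))"
    by (elim bexE exE conjE) (rule that)
  note h = bspec[OF h']
  have zero: "Q (\<lambda>F. 0) = 0" using add[of "\<lambda>F. 0" "\<lambda>F. 0"] by simp
  have "Q (\<lambda>F. \<Sum>a\<in>A. contr dl eps x a (h a) F) = (\<Sum>a\<in>A. Q (contr dl eps x a (h a)))"
    if "finite A" for A
    using that by (induction A) (simp_all add: zero add)
  moreover have "Q (contr dl eps x a (h a)) = 0" if a: "a \<in> S - {x}" for a
  proof (cases "h a = (\<lambda>F. 0)")
    case True
    then have "contr dl eps x a (h a) = (\<lambda>F. 0)" by auto
    then show ?thesis using zero by simp
  next
    case False then show ?thesis using h[OF a] 2[OF a] by blast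
  qed
  ultimately show ?thesis
    unfolding e add using 1[OF e0] assms(1) by simp
qed

text \<open>Linear independence in the configuration space of three points forces the commutation sign.\<close>
lemma eps_eq: "eps = - dl"
proof -
  have 0: "contr dl eps 1 0 (\<lambda>F. if F = [] then 1 else 0) \<in> E {0,1} 1"
  proof -
    have "avoid 0 (\<lambda>F. if F = [] then 1 else 0) = (\<lambda>F. if F = [] then (1::int) else 0)"
      by (auto simp: avoid_def)
    then have "(\<lambda>F. if F = [] then 1 else 0) \<in> E {0} 0"
      using E_avoid[of "{}" 0, OF _ _ E_unit] by simp
    then show ?thesis using E_contr[of "{0}" 1 0] by (simp add: insert_commute)
  qed
  \<comment> \<open>In this class 2 circles around 1 and 1 around 0. It is built with 2 as the last
    point; expanding it with respect to 0 instead yields a second expression for the same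
    values.\<close>
  define e where "e = contr dl eps 2 1 (contr dl eps 1 0 (\<lambda>F. if F = [] then 1 else 0))"
  have e: "e \<in> E {0,1,2} 2"
    using E_contr[of "{0,1}" 2 1 _ 1, OF _ _ _ 0] unfolding e_def by (simp add: insert_commute numeral_2_eq_2)
  have single: "h [(2,1)] = dl * h [(1,2)]" if "h \<in> E {1,2} 1" for h
  proof -
    have "h [(2,1)] - dl * h [(1,2)] = 0"
      by (rule E_test[OF _ _ that, of 1 "\<lambda>h. h [(2,1)] - dl * h [(1,2)]"])
         (auto simp: algebra_simps avoid_def contr_def wt_def)
    then show ?thesis by simp
  qed
  have "finite {0,1,2::nat}" "(0::nat) \<in> {0,1,2}" by auto
  from dec[OF this e] obtain e0 h where e0: "e0 \<in> E ({0,1,2} - {0}) 2"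
    and h': "\<forall>a\<in>{0,1,2} - {0}. h a = (\<lambda>F. 0) \<or> (\<exists>j. 2 = Suc j \<and> h a \<in> E ({0,1,2} - {0}) j)"
    and eq: "e = (\<lambda>F. avoid 0 e0 F + (\<Sum>a\<in>{0,1,2} - {0}. contr dl eps 0 a (h a) F))"
    by (elim bexE exE conjE) (rule that)
  note h = bspec[OF h']
  have S: "{0,1,2} - {0::nat} = {1,2}" by auto
  have h2: "h 2 [(2,1)] = dl * h 2 [(1,2)]"
    using h[of 2] single[of "h 2"] unfolding S by (auto simp: numeral_2_eq_2)
  note ev = contr_def wt_def sbv_def avoid_def
  \<comment> \<open>One monomial for each pair of edges of the triangle: three linear equations for
    the values of \<open>h 1\<close> and \<open>h 2\<close> on the edge between 1 and 2.\<close>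
  have "e [(0,1),(0,2)] = 0" by (simp add: e_def ev)
  then have 1: "h 1 [(1,2)] + eps * h 2 [(2,1)] = 0"
    by (simp add: eq S ev)
  have "e [(0,1),(1,2)] = eps" using dl by (simp add: e_def ev mult.assoc)
  then have 2: "h 1 [(1,2)] = eps" by (simp add: eq S ev)
  have "e [(0,2),(1,2)] = eps" using dl by (simp add: e_def ev mult.assoc)
  then have 3: "h 2 [(1,2)] = eps" by (simp add: eq S ev)
  have "eps + eps * (dl * eps) = 0" using 1 2 3 h2 by simp
  then have "eps + dl * (eps * eps) = 0" by (simp add: algebra_simps)
  then show ?thesis using eps by simp
qed

section \<open>Averaging over the permutations of a set of points\<close>

text \<open>For finite K this is the average multiplied by the factorial of \<open>card K\<close>,
  which keeps the values integral.\<close>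

definition orb :: "nat set \<Rightarrow> (edge list \<Rightarrow> int) \<Rightarrow> edge list \<Rightarrow> int" where
  "orb K e F = (\<Sum>b | b permutes K. e (rl b F))"

lemma orb_add: "orb K (\<lambda>F. f F + g F) F = orb K f F + orb K g F"
  by (simp add: orb_def sum.distrib)

lemma orb_mult: "orb K (\<lambda>F. c * f F) F = c * orb K f F"
  by (simp add: orb_def sum_distrib_left)

lemma bij_betw_compose_permutes:
  assumes "c permutes K"
  shows "bij_betw (\<lambda>b. c \<circ> b) {b. b permutes K} {b. b permutes K}"
proof (rule bij_betw_byWitness[where f' = "\<lambda>b. inv_into UNIV c \<circ> b"])
  show "\<forall>b\<in>{b. b permutes K}. inv_into UNIV c \<circ> (c \<circ> b) = b"
    using permutes_inv_o(2)[OF assms] by (simp flip: comp_assoc)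
  show "\<forall>b\<in>{b. b permutes K}. c \<circ> (inv_into UNIV c \<circ> b) = b"
    using permutes_inv_o(1)[OF assms] by (simp flip: comp_assoc)
  show "(\<lambda>b. c \<circ> b) ` {b. b permutes K} \<subseteq> {b. b permutes K}"
    using assms by (auto intro: permutes_compose)
  show "(\<lambda>b. inv_into UNIV c \<circ> b) ` {b. b permutes K} \<subseteq> {b. b permutes K}"
    using permutes_inv[OF assms] by (auto intro: permutes_compose)
qed

lemma orb_translate:
  assumes "c permutes K" "finite K"
  shows "orb K (\<lambda>F. e (rl c F)) F = orb K e F"
proof -
  have "bij_betw (\<lambda>b. c \<circ> b) {b. b permutes K} {b. b permutes K}"
    using assms(1) by (rule bij_betw_compose_permutes)
  then show ?thesis
    unfolding orb_def rl_rl by (rule sum.reindex_bij_betw)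
qed

text \<open>The sum over K is invariant under translation by permutations of K', so e may be
  replaced by its sum over them; this only multiplies the result by their nonzero number. L is the
  form taken by the translates of e.\<close>

lemma orb_average:
  assumes "finite K" "K' \<subseteq> K"
    and "\<And>b G. b permutes K' \<Longrightarrow> e (rl b G) = L b G"
    and "\<And>G. K \<subseteq> verts G \<Longrightarrow> (\<Sum>b | b permutes K'. L b G) = 0" and "K \<subseteq> verts F"
  shows "orb K e F = 0"
proof -
  have fin: "finite K'" using assms finite_subset by blast
  have "of_nat (card {b. b permutes K'}) * orb K e F = (\<Sum>b | b permutes K'. orb K e F)" by simp
  also have "\<dots> = (\<Sum>b | b permutes K'. orb K (\<lambda>G. e (rl b G)) F)"
    using assms(1,2) by (intro sum.cong refl orb_translate[symmetric]) (auto intro: permutes_subset)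
  also have "\<dots> = (\<Sum>b | b permutes K'. orb K (L b) F)"
    using assms(3) by (intro sum.cong refl) (auto simp: orb_def)
  also have "\<dots> = (\<Sum>c | c permutes K. \<Sum>b | b permutes K'. L b (rl c F))"
    unfolding orb_def by (rule sum.swap)
  also have "\<dots> = 0"
  proof (rule sum.neutral, rule ballI)
    fix c :: "nat \<Rightarrow> nat" assume "c \<in> {c. c permutes K}"
    then have "c ` K = K" by (simp add: permutes_image)
    then have "K \<subseteq> verts (rl c F)" using assms(5) by (metis verts_rl image_mono)
    then show "(\<Sum>b | b permutes K'. L b (rl c F)) = 0" by (rule assms(4))
  qed
  finally have "int (card {b. b permutes K'}) * orb K e F = 0" .
  moreover have "card {b. b permutes K'} \<noteq> 0"
    using card_permutations[OF refl fin] by simp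
  ultimately show ?thesis by simp
qed


lemma orb_zeroI:
  assumes "\<And>G. K \<subseteq> verts G \<Longrightarrow> e G = 0" "K \<subseteq> verts F"
  shows "orb K e F = 0"
  unfolding orb_def
proof (intro sum.neutral ballI)
  fix c :: "nat \<Rightarrow> nat" assume "c \<in> {c. c permutes K}"
  then have "c ` K = K" by (simp add: permutes_image)
  then have "K \<subseteq> verts (rl c F)" using assms(2) by (metis verts_rl image_mono)
  then show "e (rl c F) = 0" by (rule assms(1))
qed

lemma orb_avoid: "x \<in> K \<Longrightarrow> K \<subseteq> verts F \<Longrightarrow> orb K (avoid x e) F = 0"
  by (rule orb_zeroI) (auto simp: avoid_def)

lemma orb_contr_add: "orb K (contr dl eps x a (\<lambda>F. f F + g F)) F = orb K (contr dl eps x a f) F + orb K (contr dl eps x a g) F"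
  by (simp add: orb_def contr_add sum.distrib)

lemma contr_add_fun: "contr dl eps x a (\<lambda>F. f F + g F) = (\<lambda>F. contr dl eps x a f F + contr dl eps x a g F)"
  by (auto simp: contr_add)

lemma permutes_fix: "b permutes K \<Longrightarrow> x \<notin> K \<Longrightarrow> b x = x"
  by (rule permutes_not_in)

text \<open>Permutations of K - {x} fix both ends of the contracted edge. They therefore act on the
  inner functional, which gets averaged over the remaining points of K.\<close>

lemma orb_contr_out:
  assumes "x \<in> K" "a \<notin> K" "K \<subseteq> verts F"
    and IH: "\<And>G. K - {x} \<subseteq> verts G \<Longrightarrow> orb (K - {x}) e G = 0"
  shows "orb K (contr dl eps x a e) F = 0"
proof (rule orb_average[of _ "K - {x}" _ "\<lambda>b. contr dl eps x a (\<lambda>H. e (rl b H))"])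
  show "finite K" by (rule finite_subset[OF assms(3)]) simp
  show "contr dl eps x a e (rl b G) = contr dl eps x a (\<lambda>H. e (rl b H)) G" if "b permutes K - {x}" for b G
    using contr_rl[OF permutes_inj[OF that], of dl eps x a e G] that assms(2) by (simp add: permutes_fix)
  show "(\<Sum>b | b permutes K - {x}. contr dl eps x a (\<lambda>H. e (rl b H)) G) = 0" if "K \<subseteq> verts G" for G
    unfolding contr_sum_fun[symmetric]
    by (rule contr_zeroI[of "K - {x}"]) (use IH that assms(2) in \<open>auto simp: orb_def\<close>)
qed (use assms in auto)

text \<open>The same for a chain of two collisions that leaves K at c: permutations of the rest of K
  pass through both contractions.\<close>

lemma orb_contr2_out:
  assumes "p \<in> K" "q \<in> K" "c \<notin> K" "K \<subseteq> verts F"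
    and IH: "\<And>G. K - {p,q} \<subseteq> verts G \<Longrightarrow> orb (K - {p,q}) e G = 0"
  shows "orb K (contr dl eps p q (contr dl eps q c e)) F = 0"
proof (rule orb_average[of _ "K - {p,q}" _ "\<lambda>b. contr dl eps p q (contr dl eps q c (\<lambda>H. e (rl b H)))"])
  show "finite K" by (rule finite_subset[OF assms(4)]) simp
  show "contr dl eps p q (contr dl eps q c e) (rl b G) = contr dl eps p q (contr dl eps q c (\<lambda>H. e (rl b H))) G"
    if "b permutes K - {p,q}" for b G
  proof -
    have "contr dl eps q c e (rl b H) = contr dl eps q c (\<lambda>H. e (rl b H)) H" for H
      using contr_rl[OF permutes_inj[OF that], of dl eps q c e H] that assms(3) by (simp add: permutes_fix)
    then show ?thesis
      using contr_rl[OF permutes_inj[OF that], of dl eps p q "contr dl eps q c e" G] that by (simp add: permutes_fix)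
  qed
  show "(\<Sum>b | b permutes K - {p,q}. contr dl eps p q (contr dl eps q c (\<lambda>H. e (rl b H))) G) = 0" if "K \<subseteq> verts G" for G
    unfolding contr_sum_fun[symmetric]
    by (rule contr_zeroI[of "K - {p,q}"], rule contr_zeroI[of "K - {p,q}"])
       (use IH that assms(3) in \<open>auto simp: orb_def\<close>)
qed (use assms in auto)

lemma E_zero: "e \<in> E S 0 \<Longrightarrow> F \<noteq> [] \<Longrightarrow> e F = 0"
  using E_valid by fastforce

theorem orb_zero_odd:
  assumes odd: "dl = -1"
  shows "finite S \<Longrightarrow> K \<subseteq> S \<Longrightarrow> e \<in> E S i \<Longrightarrow> K \<subseteq> verts F \<Longrightarrow> i < card K \<Longrightarrow> orb K e F = 0"
proof (induction i arbitrary: S K e F)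
  case 0
  \<comment> \<open>A list that has a vertex is not empty, and functionals of degree 0 see only the
    empty list.\<close>
  have "e G = 0" if "K \<subseteq> verts G" for G
  proof -
    have "G \<noteq> []" using that 0(5) by (cases G) auto
    then show ?thesis by (rule E_zero[OF 0(3)])
  qed
  then show ?case by (rule orb_zeroI[OF _ 0(4)])
next
  case (Suc i)
  have fin: "finite K" by (rule finite_subset[OF Suc.prems(2,1)])
  have "K \<noteq> {}" using Suc.prems(5) by auto
  then obtain x where x: "x \<in> K" by blast
  have xS: "x \<in> S" using x Suc.prems(2) by blast
  show ?case
  proof (rule E_test[of S x e "Suc i" "\<lambda>e. orb K e F"])
    fix a j h assume a: "a \<in> S - {x}" and j: "Suc i = Suc j" and h: "h \<in> E (S - {x}) j"
    show "orb K (contr dl eps x a h) F = 0"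
    \<comment> \<open>A collision with a point outside K lowers the degree and the size of K by one,
      so the strict bound is inherited. Inside K, interchanging x and a gives the factor
      \<open>dl\<close>, which is -1.\<close>
    proof (cases "a \<in> K")
      case False
      show ?thesis
        by (rule orb_contr_out[OF x False Suc.prems(4)], rule Suc.IH[of "S - {x}"])
           (use Suc.prems(1,2,5) h j x fin in \<open>auto simp: card_Diff_singleton_if\<close>)
    next
      case True
      have "orb K (contr dl eps x a h) F = orb K (\<lambda>F. contr dl eps x a h (rl (Transposition.transpose x a) F)) F"
        by (rule orb_translate[symmetric]) (use True x fin in \<open>auto intro: permutes_swap_id\<close>)
      also have "\<dots> = dl * orb K (contr dl eps x a h) F"
        using a by (subst contr_flip[OF dl]) (auto simp: orb_mult)
      finally show ?thesis using odd by simp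
    qed
  qed (simp_all add: Suc.prems(1,3) xS orb_add orb_avoid[OF x Suc.prems(4)])
qed

text \<open>Either G lives on T and is not changed at all, or it has a vertex outside T before and
  after relabelling, and both values vanish.\<close>

lemma E_rl_fix:
  assumes "k \<in> E T i" "inj f" "\<And>v. v \<in> T \<Longrightarrow> f v = v"
  shows "k (rl f G) = k G"
proof (cases "verts G \<subseteq> T")
  case True
  then show ?thesis using assms(3) by (subst rl_ident) auto
next
  case False
  have v: "k H \<noteq> 0 \<Longrightarrow> verts H \<subseteq> T" for H using E_valid[OF assms(1), of H] by (auto simp: valid_def verts_def)
  obtain u where u: "u \<in> verts G" "u \<notin> T" using False by auto
  then have "f u \<notin> T" using assms(2,3) by (metis inj_eq)
  then have "\<not> verts (rl f G) \<subseteq> T" using u by auto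
  then show ?thesis using v False by metis
qed

lemma avoid_ident: "e \<in> E T i \<Longrightarrow> a \<notin> T \<Longrightarrow> avoid a e = e"
  using E_valid[of e T i] by (fastforce simp: avoid_def valid_def verts_def)

lemma avoid_add: "avoid a (\<lambda>F. f F + g F) = (\<lambda>F. avoid a f F + avoid a g F)"
  by (auto simp: avoid_def)

context
  assumes even: "dl = 1"
begin

lemma eps_even: "eps = -1" using eps_eq even by simp

text \<open>The three terms of the Arnold relation become equal after averaging: interchanging x and
  y identifies the first two, interchanging y and a identifies the first and the third. As they add
  up to zero, each is zero.\<close>

lemma orb_jacobi:
  assumes K: "x \<in> K" "y \<in> K" "a \<in> K" "finite K" and ne: "x \<noteq> y" "x \<noteq> a" "y \<noteq> a"
    and k: "k \<in> E T l" "x \<notin> T" "y \<notin> T"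
  shows "orb K (contr dl eps x y (contr dl eps y a k)) F = 0"
proof -
  let ?A = "\<lambda>F. contr dl eps x a (contr dl eps y a k) F"
  let ?B = "\<lambda>F. contr dl eps y a (contr dl eps x a k) F"
  let ?C = "\<lambda>F. contr dl eps x y (contr dl eps y a k) F"
  have "?A F + ?B F + ?C F = 0" for F
    using contr_jacobi[OF ne, of k F] by (simp add: even eps_even)
  then have sum: "orb K ?A F + orb K ?B F + orb K ?C F = 0"
    unfolding orb_def by (simp flip: sum.distrib)
  let ?s = "Transposition.transpose x y"
  have kfix: "k (rl ?s G) = k G" for G
    by (rule E_rl_fix[OF k(1)]) (use k in \<open>auto simp: Transposition.transpose_def\<close>)
  have B: "?B (rl ?s F) = ?A F" for F
  proof -
    have "contr dl eps x a k (rl ?s G) = contr dl eps y a k G" for G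
      using contr_rl[of ?s dl eps y a k G] ne kfix by (simp add: inj_swap Transposition.transpose_def)
    then show ?thesis
      using contr_rl[of ?s dl eps x a "contr dl eps x a k" F] ne by (simp add: Transposition.transpose_def)
  qed
  have "orb K ?B F = orb K (\<lambda>F. ?B (rl ?s F)) F"
    by (rule orb_translate[symmetric]) (use K in \<open>auto intro: permutes_swap_id\<close>)
  then have 1: "orb K ?B F = orb K ?A F" by (simp only: B)
  let ?t = "Transposition.transpose y a"
  have A: "?A (rl ?t F) = ?C F" for F
  proof -
    have "contr dl eps y a k (rl ?t G) = contr dl eps y a k G" for G
      using contr_flip[OF dl ne(3), of eps k G] even by simp
    then show ?thesis
      using contr_rl[of ?t dl eps x y "contr dl eps y a k" F] ne by (simp add: Transposition.transpose_def)
  qed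
  have "orb K ?A F = orb K (\<lambda>F. ?A (rl ?t F)) F"
    by (rule orb_translate[symmetric]) (use K in \<open>auto intro: permutes_swap_id\<close>)
  then have 2: "orb K ?A F = orb K ?C F" by (simp only: A)
  show ?thesis using sum 1 2 by simp
qed

text \<open>Follow a point x of K. A collision leaving K reduces to a smaller K and a smaller
  degree; a chain of two collisions starting in K is handled by J. If x and a form an isolated pair,
  take a third point y of K: its collision leaves K, starts a chain, or forms a second isolated
  pair, and exchanging the two pairs costs the sign -1.\<close>

theorem orb_zero_even:
  "finite S \<Longrightarrow> K \<subseteq> S \<Longrightarrow> e \<in> E S i \<Longrightarrow> K \<subseteq> verts F \<Longrightarrow> Suc i < card K \<Longrightarrow> orb K e F = 0"
proof (induction i arbitrary: S K e F rule: less_induct)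
  case (less i)
  have fin: "finite K" by (rule finite_subset[OF less.prems(2,1)])
  note KF = less.prems(4)
  \<comment> \<open>A chain p, q, c that starts with two points of K: if c is in K too, the Arnold
    relation applies; otherwise two degrees and two points of K are used up, and the bound is
    inherited.\<close>
  have J: "orb K (contr dl eps p q (contr dl eps q c k)) F = 0"
    if "p \<in> K" "q \<in> K" "p \<noteq> q" "c \<in> S - {p} - {q}" "k \<in> E (S - {p} - {q}) l" "i = Suc (Suc l)" for p q c k l
  proof (cases "c \<in> K")
    case True
    show ?thesis using that True fin by (intro orb_jacobi[of _ _ _ _ _ "S - {p} - {q}" l]) auto
  next
    case False
    have "card (K - {p,q}) = card K - 2" using that fin by (simp add: card_Diff_subset)
    moreover have "S - {p,q} = S - {p} - {q}" by auto
    ultimately show ?thesis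
      by (intro orb_contr2_out[OF that(1,2) False KF] less.IH[of l "S - {p,q}"]) (use that less.prems(1,2,5) in auto)
  qed
  have out: "orb K (contr dl eps p c k) F = 0" if "p \<in> K" "c \<notin> K" "k \<in> E (S - {p}) l" "i = Suc l" for p c k l
    by (rule orb_contr_out[OF that(1,2) KF], rule less.IH[of l "S - {p}"])
       (use less.prems(1,2,5) that fin in \<open>auto simp: card_Diff_singleton_if\<close>)
  have comm: "contr dl eps x a (contr dl eps y b k) = (\<lambda>F. eps * contr dl eps y b (contr dl eps x a k) F)"
    if "x \<noteq> y" "x \<noteq> b" "a \<noteq> y" "a \<noteq> b" for x y a b k
    using contr_commute[OF eps that] by auto
  have "K \<noteq> {}" using less.prems(5) by auto
  then obtain x where x: "x \<in> K" by blast
  have xS: "x \<in> S" using x less.prems by auto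
  show ?case
  proof (rule E_test[of S x e i "\<lambda>e. orb K e F"])
    fix a j h assume a: "a \<in> S - {x}" and j: "i = Suc j" and h: "h \<in> E (S - {x}) j"
    show "orb K (contr dl eps x a h) F = 0"
    proof (cases "a \<in> K")
      case False then show ?thesis using out x h j by blast
    next
      case True
      \<comment> \<open>Here i is at least 1, so K has at least three points.\<close>
      have "\<not> K \<subseteq> {x, a}"
        using card_mono[of "{x,a}" K] less.prems(5) j a by auto
      then obtain y where y: "y \<in> K" "y \<noteq> x" "y \<noteq> a" by auto
      show ?thesis
      proof (rule E_test[of "S - {x}" a h j "\<lambda>h. orb K (contr dl eps x a h) F"])
        fix c l k assume "c \<in> S - {x} - {a}" "j = Suc l" "k \<in> E (S - {x} - {a}) l"
        then show "orb K (contr dl eps x a (contr dl eps a c k)) F = 0"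
          using J[of x a c k l] x True a j by auto
      next
        fix h0 assume h0: "h0 \<in> E (S - {x} - {a}) j"
        show "orb K (contr dl eps x a (avoid a h0)) F = 0"
        proof (rule E_test[of "S - {x} - {a}" y h0 j "\<lambda>h. orb K (contr dl eps x a (avoid a h)) F"])
          fix h1 assume "h1 \<in> E (S - {x} - {a} - {y}) j"
          show "orb K (contr dl eps x a (avoid a (avoid y h1))) F = 0"
            by (rule orb_zeroI[OF _ KF], rule contr_zeroI[of "{y}"]) (use y in \<open>auto simp: avoid_def\<close>)
        next
          fix b l k assume b: "b \<in> S - {x} - {a} - {y}" and l: "j = Suc l" and k: "k \<in> E (S - {x} - {a} - {y}) l"
          have 1: "avoid a (contr dl eps y b g) = contr dl eps y b (avoid a g)" for g
            using b y by (intro avoid_contr) auto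
          show "orb K (contr dl eps x a (avoid a (contr dl eps y b k))) F = 0"
            unfolding 1
          proof (cases "b \<in> K")
            case False
            have "avoid a k \<in> E (insert a (S - {x} - {a} - {y})) l"
              using E_avoid[OF _ _ k] less.prems(1) by auto
            then have "contr dl eps x a (avoid a k) \<in> E (insert x (insert a (S - {x} - {a} - {y}))) (Suc l)"
              using less.prems(1) a y by (intro E_contr) auto
            moreover have "insert x (insert a (S - {x} - {a} - {y})) = S - {y}" using xS a y by auto
            ultimately have "orb K (contr dl eps y b (contr dl eps x a (avoid a k))) F = 0"
              using out[OF y(1) False] j l by auto
            then show "orb K (contr dl eps x a (contr dl eps y b (avoid a k))) F = 0"
              using a b y by (subst comm) (auto simp: orb_mult)
          next
            case bK: True
            show "orb K (contr dl eps x a (contr dl eps y b (avoid a k))) F = 0"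
            proof (rule E_test[of "S - {x} - {a} - {y}" b k l "\<lambda>k. orb K (contr dl eps x a (contr dl eps y b (avoid a k))) F"])
              fix k0 assume k0: "k0 \<in> E (S - {x} - {a} - {y} - {b}) l"
              have id: "avoid a (avoid b k0) = k0" using avoid_ident[OF k0] by auto
              \<comment> \<open>This permutation exchanges the colliding pairs (x, a) and (y, b), so
                that the two contractions change places.\<close>
              let ?t = "Transposition.transpose x y \<circ> Transposition.transpose a b"
              let ?Phi = "contr dl eps x a (contr dl eps y b k0)"
              have inj: "inj ?t" by (simp add: inj_compose)
              have kfix: "k0 (rl ?t G) = k0 G" for G
                by (rule E_rl_fix[OF k0 inj]) (auto simp: Transposition.transpose_def)
              have "contr dl eps y b k0 (rl ?t G) = contr dl eps x a k0 G" for G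
                using contr_rl[OF inj, of dl eps x a k0 G] a b y kfix by (auto simp: Transposition.transpose_def)
              then have "?Phi (rl ?t G) = contr dl eps y b (contr dl eps x a k0) G" for G
                using contr_rl[OF inj, of dl eps y b "contr dl eps y b k0" G] a b y
                by (auto simp: Transposition.transpose_def)
              also have "contr dl eps y b (contr dl eps x a k0) G = eps * ?Phi G" for G
                using a b y by (subst comm) auto
              finally have "?Phi (rl ?t G) = eps * ?Phi G" for G .
              moreover have "orb K ?Phi F = orb K (\<lambda>F. ?Phi (rl ?t F)) F"
                by (rule orb_translate[symmetric]) (use True x y bK fin in \<open>auto intro!: permutes_compose permutes_swap_id\<close>)
              ultimately have "orb K ?Phi F = eps * orb K ?Phi F" by (simp add: orb_mult)
              then have "orb K ?Phi F = 0" using eps_even by simp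
              then show "orb K (contr dl eps x a (contr dl eps y b (avoid a (avoid b k0)))) F = 0"
                by (simp only: id)
            next
              fix c m k1 assume c: "c \<in> S - {x} - {a} - {y} - {b}" and m: "l = Suc m"
                and k1: "k1 \<in> E (S - {x} - {a} - {y} - {b}) m"
              \<comment> \<open>The collision of x with a is moved inwards by two commutations, so
                that the chain y, b, c stands outermost and J applies.\<close>
              let ?k2 = "avoid a k1"
              have "?k2 \<in> E (insert a (S - {x} - {a} - {y} - {b})) m"
                using E_avoid[OF _ _ k1] less.prems(1) by auto
              then have "contr dl eps x a ?k2 \<in> E (insert x (insert a (S - {x} - {a} - {y} - {b}))) (Suc m)"
                using less.prems(1) a y b by (intro E_contr) auto
              moreover have "insert x (insert a (S - {x} - {a} - {y} - {b})) = S - {y} - {b}" using xS a y b by auto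
              ultimately have J': "orb K (contr dl eps y b (contr dl eps b c (contr dl eps x a ?k2))) F = 0"
                using J[OF y(1) bK, of c "contr dl eps x a ?k2" "Suc m"] b c j l m by auto
              have "avoid a (contr dl eps b c k1) = contr dl eps b c ?k2"
                using b c by (intro avoid_contr) auto
              moreover have "contr dl eps x a (contr dl eps y b (contr dl eps b c ?k2)) =
                  (\<lambda>F. eps * contr dl eps y b (contr dl eps x a (contr dl eps b c ?k2)) F)"
                using a b c y by (intro comm) auto
              moreover have "contr dl eps x a (contr dl eps b c ?k2) = (\<lambda>F. eps * contr dl eps b c (contr dl eps x a ?k2) F)"
                using a b c y by (intro comm) auto
              moreover have "contr dl eps y b (\<lambda>F. eps * g F) = (\<lambda>F. eps * contr dl eps y b g F)" for g
                by (auto simp: contr_def del_op_mult)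
              ultimately show "orb K (contr dl eps x a (contr dl eps y b (avoid a (contr dl eps b c k1)))) F = 0"
                using J' by (simp add: orb_mult)
            qed (use less.prems(1) b k in \<open>auto simp: avoid_add contr_add_fun orb_add\<close>)
          qed
        qed (use less.prems(1,2) y h0 in \<open>auto simp: avoid_add orb_contr_add\<close>)
      qed (use less.prems(1) a h in \<open>auto simp: orb_contr_add\<close>)
    qed
  qed (simp_all add: less.prems(1,3) xS orb_add orb_avoid[OF x KF])
qed

end

end

section \<open>Cycles and boundaries of integral singular chains\<close>

abbreviation is_cycle :: "nat \<Rightarrow> 'a topology \<Rightarrow> 'a chain \<Rightarrow> bool" where
  "is_cycle p X c \<equiv> singular_relcycle p X {} c"

abbreviation is_bdry :: "nat \<Rightarrow> 'a topology \<Rightarrow> 'a chain \<Rightarrow> bool" where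
  "is_bdry p X c \<equiv> singular_relboundary p X {} c"

lemma is_bdry_boundary: "singular_chain (Suc p) X d \<Longrightarrow> is_bdry p X (chain_boundary (Suc p) d)"
  by (auto simp: singular_boundary)

lemma is_bdry_trans: "is_bdry p X (a - b) \<Longrightarrow> is_bdry p X (b - c) \<Longrightarrow> is_bdry p X (a - c)"
  using singular_relboundary_add[of p X "{}" "a - b" "b - c"] by simp

lemma is_bdry_transfer: "is_bdry p X (a - b) \<Longrightarrow> is_bdry p X b \<Longrightarrow> is_bdry p X a"
  using singular_relboundary_add[of p X "{}" "a - b" "b"] by simp

lemma is_bdry_imp_cycle: "is_bdry p X c \<Longrightarrow> is_cycle p X c"
  by (rule singular_relboundary_imp_relcycle)

lemma is_cycle_map: "is_cycle p X c \<Longrightarrow> continuous_map X Y f \<Longrightarrow> is_cycle p Y (chain_map p f c)"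
  by (erule singular_relcycle_chain_map) auto

lemma is_bdry_map: "is_bdry p X c \<Longrightarrow> continuous_map X Y f \<Longrightarrow> is_bdry p Y (chain_map p f c)"
  by (erule singular_relboundary_chain_map) auto

lemma chain_map_map: "chain_map p h (chain_map p g c) = chain_map p (\<lambda>x. h (g x)) c"
  using fun_cong[OF chain_map_compose[of p h g], of c] by (simp add: o_def)

lemma is_cycle_0: "is_cycle 0 X c \<longleftrightarrow> singular_chain 0 X c"
  by (simp add: singular_cycle chain_boundary_def)

lemma homotopic_bdry:
  assumes "homotopic_with (\<lambda>_. True) X Y f g" "is_cycle p X c"
  shows "is_bdry p Y (chain_map p f c - chain_map p g c)"
  using homotopic_imp_homologous_rel_chain_maps[of "{}" "{}" X Y f g p c] assms
  by (simp add: homologous_rel_def)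

subsection \<open>Small chains\<close>

lemma small_chain_split:
  assumes "singular_chain p Y c"
    and "\<And>f. f \<in> Poly_Mapping.keys c \<Longrightarrow> \<exists>V \<in> {U, V}. f \<in> standard_simplex p \<rightarrow> V"
  obtains a b where "singular_chain p (subtopology Y U) a" "singular_chain p (subtopology Y V) b"
    "c = a + b"
proof -
  have "Poly_Mapping.keys c \<subseteq> singular_simplex_set p (subtopology Y U) \<union> singular_simplex_set p (subtopology Y V)"
    using assms by (fastforce simp: singular_chain_def singular_simplex_subtopology)
  then show ?thesis
    using that unfolding singular_chain_def by (metis frag_split)
qed

lemma cycle_split:
  assumes "openin Y U" "openin Y V" "topspace Y \<subseteq> U \<union> V" "is_cycle p Y w"
  obtains a b where "singular_chain p (subtopology Y U) a" "singular_chain p (subtopology Y V) b"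
    "is_bdry p Y (w - (a + b))"
proof -
  obtain c where c: "is_cycle p Y c" "homologous_rel p Y {} w c"
      "\<And>f. f \<in> Poly_Mapping.keys c \<Longrightarrow> \<exists>V \<in> {U,V}. f \<in> standard_simplex p \<rightarrow> V"
    by (rule small_homologous_rel_relcycle_exists[of "{U,V}" Y p "{}" w]) (use assms in auto)
  then have "singular_chain p Y c" by (simp add: singular_cycle)
  then obtain a b where "singular_chain p (subtopology Y U) a" "singular_chain p (subtopology Y V) b" "c = a + b"
    using small_chain_split[of p Y c U V] c(3) by metis
  with c that show ?thesis by (simp add: homologous_rel_def)
qed

text \<open>A bounding chain is subdivided until it is small. The error is a chain homotopy applied
  to a + b, and since the homotopy preserves the chains of each subspace, it splits along a and
  b.\<close>

lemma small_boundary_split: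
  assumes "openin Y U" "openin Y V" "topspace Y \<subseteq> U \<union> V"
    and a: "singular_chain p (subtopology Y U) a" and b: "singular_chain p (subtopology Y V) b"
    and "is_bdry p Y (a + b)"
  obtains c d where "singular_chain (Suc p) (subtopology Y U) c" "singular_chain (Suc p) (subtopology Y V) d"
    "a + b = chain_boundary (Suc p) (c + d)"
proof -
  obtain e where e: "singular_chain (Suc p) Y e" "chain_boundary (Suc p) e = a + b"
    using assms by (auto simp: singular_boundary)
  obtain n where n: "\<And>m f. \<lbrakk>n \<le> m; f \<in> Poly_Mapping.keys ((singular_subdivision (Suc p) ^^ m) e)\<rbrakk>
                      \<Longrightarrow> \<exists>V \<in> {U, V}. f \<in> standard_simplex (Suc p) \<rightarrow> V"
    by (rule sufficient_iterated_singular_subdivision_exists[of "{U,V}" Y "Suc p" e]) (use assms e in auto)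
  define e' where "e' = (singular_subdivision (Suc p) ^^ n) e"
  have e'ch: "singular_chain (Suc p) Y e'"
    unfolding e'_def using e by (induction n) (auto intro: singular_chain_singular_subdivision)
  obtain c d where cd: "singular_chain (Suc p) (subtopology Y U) c" "singular_chain (Suc p) (subtopology Y V) d" "e' = c + d"
    by (rule small_chain_split[OF e'ch n[OF order_refl, folded e'_def]])
  obtain h :: "nat \<Rightarrow> 'a chain \<Rightarrow> 'a chain" where h: "\<And>p. h p 0 = 0" "\<And>p c1 c2. h p (c1-c2) = h p c1 - h p c2"
    "\<And>p X c. singular_chain p X c \<Longrightarrow> singular_chain (Suc p) X (h p c)"
    "\<And>p X c. singular_chain p X c \<Longrightarrow> chain_boundary (Suc p) (h p c) + h (p - Suc 0) (chain_boundary p c)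
                   = (singular_subdivision p ^^ n) c - c"
    using chain_homotopic_iterated_singular_subdivision by blast
  have hm: "h p (- x) = - h p x" for x p using h(2)[of p 0 x] h(1) by simp
  have ha: "h p (x + y) = h p x + h p y" for x y p using h(2)[of p x "-y"] hm by simp
  have ch: "singular_chain p Y (a + b)"
    using a b by (meson singular_chain_add singular_chain_subtopology)
  have cyc: "chain_boundary p (a + b) = 0"
    using e chain_boundary_boundary_alt by metis
  have "e' - e = chain_boundary (Suc (Suc p)) (h (Suc p) e) + h p (a + b)"
    using h(4)[OF e(1)] e(2) by (simp add: e'_def)
  then have "chain_boundary (Suc p) (e' - e) = chain_boundary (Suc p) (h p (a + b))"
    using chain_boundary_boundary_alt[OF h(3)[OF e(1)]] by (simp add: chain_boundary_add)
  then have "a + b = chain_boundary (Suc p) ((c - h p a) + (d - h p b))"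
    using e cd by (simp add: chain_boundary_diff chain_boundary_add ha algebra_simps)
  then show ?thesis
    using that cd h(3) a b by (metis singular_chain_diff)
qed

lemma singular_chain_subtopology_Int:
  "singular_chain p (subtopology Y U) a \<Longrightarrow> singular_chain p (subtopology Y V) a \<Longrightarrow>
    singular_chain p (subtopology Y (U \<inter> V)) a"
  by (auto simp: singular_chain_subtopology)

text \<open>By exactness w represents the connecting image of the cycle c - d, where c and d fill w
  in U and V. This image vanishes, since c - d is homologous to a cycle of V.\<close>

lemma mayer_vietoris_inj:
  assumes op: "openin Y U" "openin Y V" "topspace Y \<subseteq> U \<union> V"
    and w: "is_bdry p (subtopology Y U) w" "is_bdry p (subtopology Y V) w"
    and onto: "\<And>z. is_cycle (Suc p) Y z \<Longrightarrow>
        \<exists>v. is_cycle (Suc p) (subtopology Y V) v \<and> is_bdry (Suc p) Y (z - v)"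
  shows "is_bdry p (subtopology Y (U \<inter> V)) w"
proof -
  obtain c d where c: "singular_chain (Suc p) (subtopology Y U) c" "chain_boundary (Suc p) c = w"
    and d: "singular_chain (Suc p) (subtopology Y V) d" "chain_boundary (Suc p) d = w"
    using w by (auto simp: singular_boundary)
  have "is_cycle (Suc p) Y (c - d)"
    using c d by (auto simp: singular_cycle chain_boundary_diff singular_chain_subtopology intro: singular_chain_diff)
  then obtain v where v: "is_cycle (Suc p) (subtopology Y V) v" "is_bdry (Suc p) Y ((c - d) - v)"
    using onto by blast
  \<comment> \<open>Now c - d - v bounds, and a bounding chain splits into e in U and f in V.
    Subtracting the boundary of e from c leaves a filling of w in U which, by the splitting, also
    lies in V.\<close>
  have dv: "singular_chain (Suc p) (subtopology Y V) (- d - v)"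
    using d v by (metis singular_chain_diff singular_chain_minus singular_cycle)
  obtain e f where e: "singular_chain (Suc (Suc p)) (subtopology Y U) e"
    and f: "singular_chain (Suc (Suc p)) (subtopology Y V) f"
    and ef: "c + (- d - v) = chain_boundary (Suc (Suc p)) (e + f)"
    by (rule small_boundary_split[OF op c(1) dv]) (use v(2) in \<open>simp add: algebra_simps\<close>)
  define g where "g = c - chain_boundary (Suc (Suc p)) e"
  have "g = d + v + chain_boundary (Suc (Suc p)) f"
    using ef by (simp add: g_def chain_boundary_add algebra_simps)
  moreover have "singular_chain (Suc p) (subtopology Y V) (d + v + chain_boundary (Suc (Suc p)) f)"
    using d v f by (metis singular_chain_add singular_chain_boundary_alt singular_cycle)
  moreover have "singular_chain (Suc p) (subtopology Y U) g"
    unfolding g_def using c e by (metis singular_chain_diff singular_chain_boundary_alt)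
  moreover have "chain_boundary (Suc p) g = w"
    unfolding g_def using c e by (simp add: chain_boundary_diff chain_boundary_boundary_alt)
  ultimately show ?thesis
    by (metis is_bdry_boundary singular_chain_subtopology_Int)
qed

subsection \<open>Products with subsets of a vector space\<close>

abbreviation XT :: "'a topology \<Rightarrow> 'b::topological_space set \<Rightarrow> ('a \<times> 'b) topology" where
  "XT X T \<equiv> prod_topology X (top_of_set T)"

lemma subtopology_XT: "T' \<subseteq> T \<Longrightarrow> subtopology (XT X T) (topspace X \<times> T') = XT X T'"
  by (simp add: subtopology_Times subtopology_subtopology inf.absorb2)

lemma chain_XT_mono: "singular_chain p (XT X T') c \<Longrightarrow> T' \<subseteq> T \<Longrightarrow> singular_chain p (XT X T) c"
  by (metis subtopology_XT singular_chain_subtopology)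

lemma cycle_XT_mono: "is_cycle p (XT X T') c \<Longrightarrow> T' \<subseteq> T \<Longrightarrow> is_cycle p (XT X T) c"
  by (metis chain_XT_mono singular_cycle)

lemma bdry_XT_mono: "is_bdry p (XT X T') c \<Longrightarrow> T' \<subseteq> T \<Longrightarrow> is_bdry p (XT X T) c"
  by (metis chain_XT_mono singular_boundary)

lemma chain_XT_Int:
  assumes "singular_chain p (XT X T1) c" "singular_chain p (XT X T2) c"
  shows "singular_chain p (XT X (T1 \<inter> T2)) c"
proof -
  have "singular_chain p (subtopology (XT X (T1 \<union> T2)) ((topspace X \<times> T1) \<inter> (topspace X \<times> T2))) c"
    by (rule singular_chain_subtopology_Int) (simp_all add: subtopology_XT assms)
  moreover have "(topspace X \<times> T1) \<inter> (topspace X \<times> T2) = topspace X \<times> (T1 \<inter> T2)" by auto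
  moreover have "subtopology (XT X (T1 \<union> T2)) (topspace X \<times> (T1 \<inter> T2)) = XT X (T1 \<inter> T2)"
    by (rule subtopology_XT) auto
  ultimately show ?thesis by simp
qed

lemma openin_XT: "openin (top_of_set T) T' \<Longrightarrow> openin (XT X T) (topspace X \<times> T')"
  by (simp add: openin_prod_Times_iff)

lemma continuous_map_segment:
  fixes f g :: "'a \<Rightarrow> 'b::real_normed_vector"
  assumes "continuous_map Z euclidean f" "continuous_map Z euclidean g"
  shows "continuous_map (prod_topology (top_of_set {0..1::real}) Z) euclidean
    (\<lambda>p. (1 - fst p) *\<^sub>R f (snd p) + fst p *\<^sub>R g (snd p))"
proof -
  let ?P = "prod_topology (top_of_set {0..1::real}) Z"
  have f: "continuous_map ?P euclidean (\<lambda>p. f (snd p))" and g: "continuous_map ?P euclidean (\<lambda>p. g (snd p))"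
    using continuous_map_compose[OF continuous_map_snd assms(1)] continuous_map_compose[OF continuous_map_snd assms(2)]
    by (simp_all add: o_def)
  have t: "continuous_map ?P euclideanreal fst"
    using continuous_map_into_fulltopology[OF continuous_map_fst] .
  have 1: "continuous_map ?P (prod_topology euclidean (prod_topology euclidean euclidean))
     (\<lambda>p. (fst p, (f (snd p), g (snd p))))"
    by (intro continuous_map_pairedI t f g)
  have 2: "continuous_map (prod_topology euclidean (prod_topology euclidean euclidean)) euclidean
      (\<lambda>q::real \<times> 'b \<times> 'b. (1 - fst q) *\<^sub>R fst (snd q) + fst q *\<^sub>R snd (snd q))"
    by simp (intro continuous_intros)
  show ?thesis
    using continuous_map_compose[OF 1 2] by (simp add: o_def)
qed

lemma homotopic_XT_segment:
  fixes f g :: "'a \<Rightarrow> 'b::real_normed_vector"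
  assumes k: "continuous_map Z X k" and f: "continuous_map Z euclidean f" and g: "continuous_map Z euclidean g"
    and seg: "\<And>z t. z \<in> topspace Z \<Longrightarrow> 0 \<le> t \<Longrightarrow> t \<le> 1 \<Longrightarrow> (1 - t) *\<^sub>R f z + t *\<^sub>R g z \<in> T"
  shows "homotopic_with (\<lambda>_. True) Z (XT X T) (\<lambda>z. (k z, f z)) (\<lambda>z. (k z, g z))"
proof -
  let ?P = "prod_topology (top_of_set {0..1::real}) Z"
  let ?h = "\<lambda>p. (k (snd p), (1 - fst p) *\<^sub>R f (snd p) + fst p *\<^sub>R g (snd p))"
  have "continuous_map ?P X (\<lambda>p. k (snd p))"
    using continuous_map_compose[OF continuous_map_snd k] by (simp add: o_def)
  moreover have "continuous_map ?P (top_of_set T) (\<lambda>p. (1 - fst p) *\<^sub>R f (snd p) + fst p *\<^sub>R g (snd p))"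
    using continuous_map_segment[OF f g] seg by (auto simp: continuous_map_in_subtopology)
  ultimately have "continuous_map ?P (XT X T) ?h" by (intro continuous_map_pairedI)
  then show ?thesis unfolding homotopic_with_def
    by (intro exI[of _ ?h]) auto
qed

lemma continuous_map_XT_snd: "continuous_map (XT X T) euclidean snd"
  using continuous_map_into_fulltopology[OF continuous_map_snd] by blast

lemma continuous_map_XT_fst: "continuous_map (XT X T) X fst"
  by (rule continuous_map_fst)

lemma continuous_map_section: "e \<in> T \<Longrightarrow> continuous_map X (XT X T) (\<lambda>x. (x, e))"
  by (intro continuous_map_pairedI) (auto simp: id_def[symmetric])

text \<open>T contracts to e along segments, so a cycle can be moved to its projection placed at
  e.\<close>

lemma star_bdry:
  fixes e :: "'b::real_normed_vector"
  assumes "\<And>u t. u \<in> T \<Longrightarrow> 0 \<le> t \<Longrightarrow> t \<le> 1 \<Longrightarrow> (1 - t) *\<^sub>R u + t *\<^sub>R e \<in> T" "is_cycle p (XT X T) w"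
  shows "is_bdry p (XT X T) (w - chain_map p (\<lambda>x. (x, e)) (chain_map p fst w))"
proof -
  have "homotopic_with (\<lambda>_. True) (XT X T) (XT X T) (\<lambda>z. (fst z, snd z)) (\<lambda>z. (fst z, e))"
    using assms(1) by (intro homotopic_XT_segment continuous_map_XT_fst continuous_map_XT_snd) auto
  then have "is_bdry p (XT X T) (chain_map p (\<lambda>z. (fst z, snd z)) w - chain_map p (\<lambda>z. (fst z, e)) w)"
    using assms(2) by (rule homotopic_bdry)
  moreover have "chain_map p (\<lambda>z. (fst z, snd z)) w = w"
    using assms(2) by (intro chain_map_id_gen[where X="XT X T"]) (auto simp: singular_cycle)
  ultimately show ?thesis by (simp add: chain_map_map)
qed


subsection \<open>The residue on products with a punctured vector space\<close>

text \<open>For distinct coordinates this is, up to homotopy, a sphere of dimension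
  \<open>length js - 1\<close>. Listing the coordinates allows induction on the dimension inside one
  fixed vector space.\<close>

definition Tn :: "'d::finite list \<Rightarrow> (real^'d) set" where
  "Tn js = {u. \<exists>i\<in>set js. u $ i \<noteq> 0}"

text \<open>\<open>Tpl\<close> and \<open>Tmi\<close> are the two cones of a suspension: they cover
  \<open>Tn (j # js)\<close>, meet in \<open>Tn js\<close>, and are star-shaped if j is not in
  \<open>js\<close>.\<close>

definition Tpl :: "'d::finite \<Rightarrow> 'd list \<Rightarrow> (real^'d) set" where
  "Tpl j js = {u. u \<in> Tn js \<or> u $ j > 0}"

definition Tmi :: "'d::finite \<Rightarrow> 'd list \<Rightarrow> (real^'d) set" where
  "Tmi j js = {u. u \<in> Tn js \<or> u $ j < 0}"

lemma Tpl_Un_Tmi: "Tpl j js \<union> Tmi j js = Tn (j # js)"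
  and Tpl_Int_Tmi: "Tpl j js \<inter> Tmi j js = Tn js"
  and Tn_Nil: "Tn [] = {}"
  by (auto simp: Tn_def Tpl_def Tmi_def)

lemma Tpl_sub: "Tpl j js \<subseteq> Tn (j # js)" and Tmi_sub: "Tmi j js \<subseteq> Tn (j # js)"
  and Tn_sub_Tpl: "Tn js \<subseteq> Tpl j js" and Tn_sub_Tmi: "Tn js \<subseteq> Tmi j js"
  by (auto simp: Tn_def Tpl_def Tmi_def)

lemma open_Tn: "open (Tn js)"
proof -
  have "Tn js = (\<Union>i\<in>set js. {u. u $ i \<noteq> 0})" by (auto simp: Tn_def)
  then show ?thesis by (auto intro!: open_UN open_Collect_neq continuous_intros)
qed

lemma open_Tpl: "open (Tpl j js)" and open_Tmi: "open (Tmi j js)"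
proof -
  have "Tpl j js = Tn js \<union> {u. 0 < u $ j}" "Tmi j js = Tn js \<union> {u. u $ j < 0}"
    by (auto simp: Tpl_def Tmi_def)
  then show "open (Tpl j js)" "open (Tmi j js)"
    by (auto intro!: open_Un open_Tn open_Collect_less continuous_intros)
qed

lemma openin_Tpl: "openin (XT X (Tn (j # js))) (topspace X \<times> Tpl j js)"
  and openin_Tmi: "openin (XT X (Tn (j # js))) (topspace X \<times> Tmi j js)"
  by (intro openin_XT open_openin_trans open_Tn open_Tpl open_Tmi Tpl_sub Tmi_sub)+

text \<open>A splitting of the class of w over the two half spaces; the boundary of a then
  represents its connecting image. It is a relation because a and b are not determined by w.\<close>

definition MVr :: "'a topology \<Rightarrow> 'd::finite \<Rightarrow> 'd list \<Rightarrow> nat \<Rightarrow> ('a \<times> (real^'d)) chain \<Rightarrow>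
    ('a \<times> (real^'d)) chain \<Rightarrow> ('a \<times> (real^'d)) chain \<Rightarrow> bool" where
  "MVr X j js p w a b \<longleftrightarrow> singular_chain p (XT X (Tpl j js)) a \<and> singular_chain p (XT X (Tmi j js)) b
     \<and> is_bdry p (XT X (Tn (j # js))) (w - (a + b))"

lemma MVr_exists: "is_cycle p (XT X (Tn (j # js))) w \<Longrightarrow> \<exists>a b. MVr X j js p w a b"
proof -
  assume w: "is_cycle p (XT X (Tn (j # js))) w"
  have "topspace (XT X (Tn (j # js))) \<subseteq> topspace X \<times> Tpl j js \<union> topspace X \<times> Tmi j js"
    using Tpl_Un_Tmi[of j js] by auto
  from cycle_split[OF openin_Tpl openin_Tmi this w] obtain a b where
    "singular_chain p (subtopology (XT X (Tn (j # js))) (topspace X \<times> Tpl j js)) a"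
    "singular_chain p (subtopology (XT X (Tn (j # js))) (topspace X \<times> Tmi j js)) b"
    "is_bdry p (XT X (Tn (j # js))) (w - (a + b))"
    by metis
  then show ?thesis
    by (auto simp: MVr_def subtopology_XT Tpl_sub Tmi_sub)
qed

lemma MVrI:
  assumes "singular_chain p (XT X (Tpl j js)) a" "singular_chain p (XT X (Tmi j js)) b"
  shows "MVr X j js p (a - b) a (- b)"
proof -
  have "a - b - (a + - b) = 0" by (metis add_uminus_conv_diff diff_self)
  then show ?thesis using assms unfolding MVr_def by (metis singular_chain_minus singular_relboundary_0)
qed

lemma MVr_diff: "MVr X j js p w a b \<Longrightarrow> MVr X j js p w' a' b' \<Longrightarrow> MVr X j js p (w - w') (a - a') (b - b')"
  unfolding MVr_def using singular_relboundary_diff[of p "XT X (Tn (j # js))" "{}" "w - (a + b)" "w' - (a' + b')"]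
  by (auto simp: singular_chain_diff algebra_simps)

lemma MVr_map:
  assumes "MVr X j js p w a b" "continuous_map X X' f"
  shows "MVr X' j js p (chain_map p (\<lambda>z. (f (fst z), snd z)) w) (chain_map p (\<lambda>z. (f (fst z), snd z)) a) (chain_map p (\<lambda>z. (f (fst z), snd z)) b)"
proof -
  have "continuous_map (XT X T) (XT X' T) (\<lambda>z. (f (fst z), snd z))" for T :: "(real^'b) set"
    using assms(2) by (auto intro!: continuous_map_pairedI
      continuous_map_compose[OF continuous_map_fst, unfolded o_def] continuous_map_snd)
  then show ?thesis using assms(1) unfolding MVr_def
    by (metis (no_types, lifting) chain_map_add chain_map_diff is_bdry_map singular_chain_chain_map)
qed

lemma MVr_boundary_eq:
  assumes "MVr X j js p w a b" "is_cycle p (XT X (Tn (j # js))) w"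
  shows "chain_boundary p b = - chain_boundary p a"
proof -
  have "is_cycle p (XT X (Tn (j # js))) (w - (a + b))"
    using assms(1) by (auto simp: MVr_def intro: is_bdry_imp_cycle)
  then show ?thesis using assms(2)
    by (simp add: singular_cycle chain_boundary_diff chain_boundary_add add_eq_0_iff)
qed

lemma MVr_boundary_cycle:
  assumes "MVr X j js (Suc p) w a b" "is_cycle (Suc p) (XT X (Tn (j # js))) w"
  shows "is_cycle p (XT X (Tn js)) (chain_boundary (Suc p) a)"
proof -
  have "singular_chain p (XT X (Tpl j js)) (chain_boundary (Suc p) a)"
    using assms(1) by (auto simp: MVr_def intro: singular_chain_boundary_alt)
  moreover have "singular_chain p (XT X (Tmi j js)) (chain_boundary (Suc p) a)"
    using assms MVr_boundary_eq[OF assms] unfolding MVr_def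
    by (metis singular_chain_boundary_alt singular_chain_minus)
  ultimately have "singular_chain p (XT X (Tn js)) (chain_boundary (Suc p) a)"
    using chain_XT_Int Tpl_Int_Tmi by metis
  moreover have "chain_boundary p (chain_boundary (Suc p) a) = 0"
    using assms(1) chain_boundary_boundary_alt unfolding MVr_def by blast
  ultimately show ?thesis by (simp add: singular_cycle)
qed

lemma chain_XT_empty: "singular_chain p (XT X {}) c \<longleftrightarrow> c = 0"
  by (rule singular_chain_empty) simp

text \<open>With no coordinate left the two half spaces are disjoint, so there is no room for a
  connecting image.\<close>

lemma MVr_boundary_zero:
  assumes "MVr X j [] p w a b" "is_cycle p (XT X (Tn [j])) w"
  shows "chain_boundary p a = 0"
proof (cases p)
  case 0 then show ?thesis by (simp add: chain_boundary_def)
next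
  case (Suc q)
  then have "is_cycle q (XT X (Tn [])) (chain_boundary p a)"
    using MVr_boundary_cycle[of X j "[]" q w a b] assms by simp
  then show ?thesis unfolding Tn_Nil singular_cycle chain_XT_empty by simp
qed

text \<open>Here a + b bounds a small chain c + d, and a minus the boundary of c equals the boundary
  of d minus b, hence lies in both half spaces.\<close>

lemma MVr_bdry:
  assumes "MVr X j js p w a b" "is_bdry p (XT X (Tn (j # js))) w"
  obtains c g where "singular_chain (Suc p) (XT X (Tpl j js)) c" "singular_chain p (XT X (Tn js)) g"
    "a = chain_boundary (Suc p) c + g"
proof -
  let ?Y = "XT X (Tn (j # js))"
  have ab: "singular_chain p (subtopology ?Y (topspace X \<times> Tpl j js)) a" 
     "singular_chain p (subtopology ?Y (topspace X \<times> Tmi j js)) b"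
    using assms by (auto simp: MVr_def subtopology_XT Tpl_sub Tmi_sub)
  have "is_bdry p ?Y (w - (w - (a + b)))"
    using assms unfolding MVr_def by (blast intro: singular_relboundary_diff)
  then have "is_bdry p ?Y (a + b)" by (simp add: algebra_simps)
  moreover have "topspace ?Y \<subseteq> topspace X \<times> Tpl j js \<union> topspace X \<times> Tmi j js"
    using Tpl_Un_Tmi[of j js] by auto
  ultimately obtain c d where "singular_chain (Suc p) (subtopology ?Y (topspace X \<times> Tpl j js)) c"
    "singular_chain (Suc p) (subtopology ?Y (topspace X \<times> Tmi j js)) d" "a + b = chain_boundary (Suc p) (c + d)"
    using small_boundary_split[OF openin_Tpl openin_Tmi _ ab] by metis
  then have c: "singular_chain (Suc p) (XT X (Tpl j js)) c" and d: "singular_chain (Suc p) (XT X (Tmi j js)) d"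
    and abcd: "a + b = chain_boundary (Suc p) c + chain_boundary (Suc p) d"
    by (simp_all add: subtopology_XT Tpl_sub Tmi_sub chain_boundary_add)
  define g where "g = a - chain_boundary (Suc p) c"
  have "g = chain_boundary (Suc p) d - b" using abcd by (simp add: g_def algebra_simps)
  then have "singular_chain p (XT X (Tmi j js)) g"
    using d assms(1) by (auto simp: MVr_def intro!: singular_chain_diff singular_chain_boundary_alt)
  moreover have "singular_chain p (XT X (Tpl j js)) g"
    using c assms(1) by (auto simp: g_def MVr_def intro!: singular_chain_diff singular_chain_boundary_alt)
  ultimately have "singular_chain p (XT X (Tn js)) g"
    using chain_XT_Int Tpl_Int_Tmi by metis
  then show ?thesis using that[OF c] by (simp add: g_def)
qed

text \<open>The residue of a cycle of \<open>X \<times> (V - 0)\<close> along \<open>X \<times> 0\<close>, as a relation between chains: V is stripped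
  of one coordinate after the other, each time by the connecting map of the Mayer--Vietoris sequence
  of the two half spaces on which that coordinate is positive or negative.\<close>
fun ResR :: "'a topology \<Rightarrow> 'd::finite list \<Rightarrow> nat \<Rightarrow> ('a \<times> (real^'d)) chain \<Rightarrow> 'a chain \<Rightarrow> bool" where
  "ResR X [] p w z = False"
| "ResR X [j] p w z = (\<exists>a b. MVr X j [] p w a b \<and> z = chain_map p fst a)"
| "ResR X (j # i # js) p w z = (\<exists>q a b. p = Suc q \<and> MVr X j (i # js) p w a b \<and>
      ResR X (i # js) q (chain_boundary p a) z)"

lemma ResR_length: "ResR X js p w z \<Longrightarrow> length js \<le> Suc p"
  by (induction X js p w z rule: ResR.induct) auto

lemma ResR_diff: "ResR X js p w z \<Longrightarrow> ResR X js p w' z' \<Longrightarrow> ResR X js p (w - w') (z - z')"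
proof (induction X js p w z arbitrary: w' z' rule: ResR.induct)
  case (2 X j p w z)
  then show ?case by (force simp: chain_map_diff dest: MVr_diff)
next
  case (3 X j i js p w z)
  obtain q a b where 1: "p = Suc q" "MVr X j (i # js) p w a b" "ResR X (i # js) q (chain_boundary p a) z"
    using 3(2) by auto
  obtain a' b' where 2: "MVr X j (i # js) p w' a' b'" "ResR X (i # js) q (chain_boundary p a') z'"
    using 3(3) 1 by auto
  have "ResR X (i # js) q (chain_boundary p (a - a')) (z - z')"
    using 3(1)[OF 1(3) 2(2)] by (simp add: chain_boundary_diff)
  with MVr_diff[OF 1(2) 2(1)] 1 show ?case by auto
qed auto

lemma ResR_cycle:
  "ResR X js p w z \<Longrightarrow> is_cycle p (XT X (Tn js)) w \<Longrightarrow> is_cycle (Suc p - length js) X z"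
proof (induction X js p w z rule: ResR.induct)
  case (2 X j p w z)
  then obtain a b where ab: "MVr X j [] p w a b" "z = chain_map p fst a" by auto
  have "is_cycle p (XT X (Tpl j [])) a"
    using ab MVr_boundary_zero[OF ab(1) 2(2)] by (auto simp: MVr_def singular_cycle)
  then show ?case using ab by (simp add: is_cycle_map[OF _ continuous_map_XT_fst])
next
  case (3 X j i js p w z)
  then show ?case using MVr_boundary_cycle by fastforce
qed auto

lemma ResR_exists:
  "js \<noteq> [] \<Longrightarrow> length js \<le> Suc p \<Longrightarrow> is_cycle p (XT X (Tn js)) w \<Longrightarrow> \<exists>z. ResR X js p w z"
proof (induction js arbitrary: p w)
  case (Cons j js)
  obtain a b where ab: "MVr X j js p w a b" using MVr_exists[OF Cons.prems(3)] by blast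
  show ?case
  proof (cases js)
    case Nil with ab show ?thesis by auto
  next
    case (Cons i js')
    then obtain q where q: "p = Suc q" using Cons.prems by (cases p) auto
    have "\<exists>z. ResR X js q (chain_boundary p a) z"
      using Cons.prems(2,3) MVr_boundary_cycle[of X j js q w a b] ab q \<open>js = _\<close>
      by (intro Cons.IH) auto
    then show ?thesis using Cons ab q by auto
  qed
qed auto

lemma ResR_bdry:
  "ResR X js p w z \<Longrightarrow> is_bdry p (XT X (Tn js)) w \<Longrightarrow> is_bdry (Suc p - length js) X z"
proof (induction X js p w z rule: ResR.induct)
  case (2 X j p w z)
  then obtain a b where ab: "MVr X j [] p w a b" "z = chain_map p fst a" by auto
  obtain c g where c: "singular_chain (Suc p) (XT X (Tpl j [])) c" "a = chain_boundary (Suc p) c + g"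
    and "singular_chain p (XT X (Tn [])) g"
    using MVr_bdry[OF ab(1) 2(2)] by metis
  then have "g = 0" unfolding Tn_Nil chain_XT_empty by simp
  then have "is_bdry p X (chain_map p fst a)"
    using is_bdry_map[OF is_bdry_boundary[OF c(1)] continuous_map_XT_fst] c by simp
  then show ?case using ab by simp
next
  case (3 X j i js p w z)
  then obtain q a b where 1: "p = Suc q" "MVr X j (i # js) p w a b" "ResR X (i # js) q (chain_boundary p a) z"
    by auto
  obtain c g where cg: "singular_chain (Suc p) (XT X (Tpl j (i # js))) c" "singular_chain p (XT X (Tn (i # js))) g"
    "a = chain_boundary (Suc p) c + g"
    using MVr_bdry[OF 1(2) 3(3)] by blast
  have "chain_boundary p a = chain_boundary p g"
    using cg by (simp add: chain_boundary_add chain_boundary_boundary_alt)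
  then have "is_bdry q (XT X (Tn (i # js))) (chain_boundary p a)"
    using cg(2) 1(1) is_bdry_boundary by auto
  then show ?case using 3(1)[OF 1(3)] 1(1) by simp
qed auto

lemma ResR_map:
  "ResR X js p w z \<Longrightarrow> continuous_map X X' f \<Longrightarrow>
    ResR X' js p (chain_map p (\<lambda>z. (f (fst z), snd z)) w) (chain_map (Suc p - length js) f z)"
proof (induction X js p w z rule: ResR.induct)
  case (2 X j p w z)
  then obtain a b where ab: "MVr X j [] p w a b" "z = chain_map p fst a" by auto
  have "chain_map p f z = chain_map p fst (chain_map p (\<lambda>z. (f (fst z), snd z)) a)"
    by (simp add: ab chain_map_map)
  moreover have l: "Suc p - length [j] = p" by simp
  ultimately show ?case using MVr_map[OF ab(1) 2(2)] unfolding ResR.simps l by blast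
next
  case (3 X j i js p w z)
  then obtain q a b where 1: "p = Suc q" "MVr X j (i # js) p w a b" "ResR X (i # js) q (chain_boundary p a) z"
    by auto
  have "ResR X' (i # js) q (chain_map q (\<lambda>z. (f (fst z), snd z)) (chain_boundary p a)) (chain_map (Suc q - length (i # js)) f z)"
    using 3(1)[OF 1(3) 3(3)] .
  moreover have "chain_map q (\<lambda>z. (f (fst z), snd z)) (chain_boundary p a) = chain_boundary p (chain_map p (\<lambda>z. (f (fst z), snd z)) a)"
    using chain_boundary_chain_map[of p "XT X (Tpl j (i # js))" a "\<lambda>z. (f (fst z), snd z)"] 1(1,2) by (auto simp: MVr_def)
  moreover have "Suc p - length (j # i # js) = Suc q - length (i # js)" using 1(1) by simp
  ultimately have "ResR X' (i # js) q (chain_boundary p (chain_map p (\<lambda>z. (f (fst z), snd z)) a))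
     (chain_map (Suc p - length (j # i # js)) f z)" by (simp only:)
  then show ?case using MVr_map[OF 1(2) 3(3)] 1(1) unfolding ResR.simps by blast
qed auto

lemma ResR_zero: "js \<noteq> [] \<Longrightarrow> length js \<le> Suc p \<Longrightarrow> ResR X js p 0 0"
  using ResR_exists[of js p X 0] ResR_diff[of X js p 0 _ 0] by fastforce

lemma ResR_minus: "ResR X js p w z \<Longrightarrow> ResR X js p (- w) (- z)"
  using ResR_diff[OF ResR_zero, of js p X w z] ResR_length[of X js p w z] by (cases "js = []") auto

lemma ResR_unique:
  assumes "ResR X js p w z" "ResR X js p w' z'" "is_bdry p (XT X (Tn js)) (w - w')"
  shows "is_bdry (Suc p - length js) X (z - z')"
  using ResR_bdry[OF ResR_diff[OF assms(1,2)] assms(3)] .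

lemma Tpl_star: "j \<notin> set js \<Longrightarrow> u \<in> Tpl j js \<Longrightarrow> 0 \<le> t \<Longrightarrow> t \<le> 1 \<Longrightarrow>
    (1 - t) *\<^sub>R u + t *\<^sub>R axis j 1 \<in> Tpl j js"
  and Tmi_star: "j \<notin> set js \<Longrightarrow> u \<in> Tmi j js \<Longrightarrow> 0 \<le> t \<Longrightarrow> t \<le> 1 \<Longrightarrow>
    (1 - t) *\<^sub>R u + t *\<^sub>R axis j (-1) \<in> Tmi j js"
proof -
  assume j: "j \<notin> set js" and t: "0 \<le> t" "t \<le> 1"
  have ne: "i \<in> set js \<Longrightarrow> i \<noteq> j" for i using j by auto
  { assume u: "u \<in> Tpl j js"
    show "(1 - t) *\<^sub>R u + t *\<^sub>R axis j 1 \<in> Tpl j js"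
    proof (cases "t = 1")
      case False
      with u t ne show ?thesis
        by (auto simp: Tpl_def Tn_def axis_def intro!: add_pos_nonneg)
    qed (auto simp: Tpl_def axis_def) }
  { assume u: "u \<in> Tmi j js"
    show "(1 - t) *\<^sub>R u + t *\<^sub>R axis j (-1) \<in> Tmi j js"
    proof (cases "t = 1")
      case False
      with u t ne have "u \<in> Tn js \<or> (1 - t) * u $ j < 0"
        by (auto simp: Tmi_def mult_less_0_iff)
      with False t ne show ?thesis
        by (auto simp: Tmi_def Tn_def axis_def)
    qed (auto simp: Tmi_def axis_def) }
qed

lemma Tpl_star_bdry: "j \<notin> set js \<Longrightarrow> is_cycle p (XT X (Tpl j js)) w \<Longrightarrow>
    is_bdry p (XT X (Tpl j js)) (w - chain_map p (\<lambda>x. (x, axis j 1)) (chain_map p fst w))"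
  and Tmi_star_bdry: "j \<notin> set js \<Longrightarrow> is_cycle p (XT X (Tmi j js)) w \<Longrightarrow>
    is_bdry p (XT X (Tmi j js)) (w - chain_map p (\<lambda>x. (x, axis j (-1))) (chain_map p fst w))"
  by (intro star_bdry Tpl_star Tmi_star; assumption)+

lemma chain_map_fst_section: "is_cycle p X z \<Longrightarrow> chain_map p fst (chain_map p (\<lambda>x. (x, e)) z) = z"
  by (simp add: chain_map_map) (rule chain_map_id_gen[where X=X], auto simp: singular_cycle)

text \<open>An iterated suspension: start with the difference of two opposite sections over z, and
  for each further coordinate fill the cycle in both half spaces. The fillings exist because the
  projection to X bounds.\<close>

lemma ResR_surj:
  fixes js :: "'b::finite list"
  assumes "is_cycle k X z"
  shows "js \<noteq> [] \<Longrightarrow> distinct js \<Longrightarrow> p = k + length js - 1 \<Longrightarrow>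
    \<exists>w. is_cycle p (XT X (Tn js)) w \<and> ResR X js p w z \<and> is_bdry p X (chain_map p fst w)"
proof (induction js arbitrary: p)
  case (Cons j js)
  have e: "axis j 1 \<in> Tpl j js" "axis j (-1) \<in> Tmi j js" by (auto simp: Tpl_def Tmi_def axis_def)
  show ?case
  proof (cases "js = []")
    case True
    then have p: "p = k" using Cons by simp
    define a where "a = chain_map p (\<lambda>x. (x, axis j 1 :: real^'b)) z"
    define b where "b = chain_map p (\<lambda>x. (x, axis j (-1) :: real^'b)) z"
    have a: "is_cycle p (XT X (Tpl j js)) a" and b: "is_cycle p (XT X (Tmi j js)) b"
      unfolding a_def b_def using assms p by (auto intro!: is_cycle_map continuous_map_section e)
    have fab: "chain_map p fst a = z" "chain_map p fst b = z"
      unfolding a_def b_def using assms p by (auto intro: chain_map_fst_section)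
    have "MVr X j js p (a - b) a (- b)"
      using a b unfolding singular_cycle by (intro MVrI) blast+
    moreover have "is_cycle p (XT X (Tn (j # js))) (a - b)"
      by (intro singular_relcycle_diff cycle_XT_mono[OF a Tpl_sub] cycle_XT_mono[OF b Tmi_sub])
    ultimately show ?thesis using True fab
      by (intro exI[of _ "a - b"]) (auto simp: chain_map_diff)
  next
    case False
    obtain q where p: "p = Suc q" "q = k + length js - 1" using Cons.prems False by (cases p; cases js) auto
    obtain w where w: "is_cycle q (XT X (Tn js)) w" "ResR X js q w z" "is_bdry q X (chain_map q fst w)"
      using Cons.IH[of q] False Cons.prems p by auto
    have j: "j \<notin> set js" using Cons.prems by simp
    have "is_bdry q (XT X (Tpl j js)) w"
      by (rule is_bdry_transfer[OF Tpl_star_bdry[OF j cycle_XT_mono[OF w(1) Tn_sub_Tpl]] is_bdry_map[OF w(3) continuous_map_section[OF e(1)]]])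
    then obtain a0 where a0: "singular_chain p (XT X (Tpl j js)) a0" "chain_boundary p a0 = w"
      using p by (auto simp: singular_boundary)
    have "is_bdry q (XT X (Tmi j js)) w"
      by (rule is_bdry_transfer[OF Tmi_star_bdry[OF j cycle_XT_mono[OF w(1) Tn_sub_Tmi]] is_bdry_map[OF w(3) continuous_map_section[OF e(2)]]])
    then obtain b where b: "singular_chain p (XT X (Tmi j js)) b" "chain_boundary p b = w"
      using p by (auto simp: singular_boundary)
    define y where "y = chain_map p fst (a0 - b)"
    have "is_cycle p (XT X (Tn (j # js))) (a0 - b)"
      unfolding singular_cycle using a0(2) b(2)
        singular_chain_diff[OF chain_XT_mono[OF a0(1) Tpl_sub] chain_XT_mono[OF b(1) Tmi_sub]]
      by (simp add: chain_boundary_diff)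
    then have y: "is_cycle p X y" unfolding y_def by (rule is_cycle_map[OF _ continuous_map_XT_fst])
    \<comment> \<open>Subtracting a section over the projection makes the projection of the new
      cycle zero, which the induction needs; the boundary of a is not affected.\<close>
    define sy where "sy = chain_map p (\<lambda>x. (x, axis j 1::real^'b)) y"
    have sy: "is_cycle p (XT X (Tpl j js)) sy"
      unfolding sy_def by (rule is_cycle_map[OF y continuous_map_section[OF e(1)]])
    define a where "a = a0 - sy"
    have a: "singular_chain p (XT X (Tpl j js)) a" "chain_boundary p a = w"
      using a0 sy by (auto simp: a_def singular_cycle chain_boundary_diff intro: singular_chain_diff)
    have "is_cycle p (XT X (Tn (j # js))) (a - b)"
      unfolding singular_cycle using a(2) b(2)
        singular_chain_diff[OF chain_XT_mono[OF a(1) Tpl_sub] chain_XT_mono[OF b(1) Tmi_sub]]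
      by (simp add: chain_boundary_diff)
    moreover have "MVr X j js p (a - b) a (- b)"
      using a(1) b(1) by (rule MVrI)
    then have "ResR X (j # js) p (a - b) z"
      using False w(2) a(2) p by (cases js) auto
    moreover have "chain_map p fst (a - b) = y - chain_map p fst sy"
      by (simp add: a_def y_def chain_map_diff)
    then have "chain_map p fst (a - b) = 0"
      by (simp add: sy_def chain_map_fst_section[OF y])
    ultimately show ?thesis by (intro exI[of _ "a - b"]) auto
  qed
qed auto

lemma section_bdry:
  fixes e e' :: "'b::real_normed_vector"
  assumes "\<And>t. 0 \<le> t \<Longrightarrow> t \<le> 1 \<Longrightarrow> (1 - t) *\<^sub>R e + t *\<^sub>R e' \<in> T" "is_cycle p X z"
  shows "is_bdry p (XT X T) (chain_map p (\<lambda>x. (x, e)) z - chain_map p (\<lambda>x. (x, e')) z)"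
  using assms by (intro homotopic_bdry[of X] homotopic_XT_segment) (auto simp: id_def[symmetric])

text \<open>Both cycles are moved to the section at a unit vector of a coordinate in
  \<open>js\<close>, which lies in both half spaces. There they add up to a section over a
  boundary.\<close>

lemma cycles_sum_bdry:
  fixes i j :: "'b::finite"
  assumes j: "j \<notin> set js" "i \<in> set js" and a: "is_cycle p (XT X (Tpl j js)) a" and b: "is_cycle p (XT X (Tmi j js)) b"
    and ab: "is_bdry p X (chain_map p fst (a + b))"
  shows "is_bdry p (XT X (Tn (j # js))) (a + b)"
proof -
  let ?Y = "XT X (Tn (j # js))"
  define e where "e = (axis i 1 :: real^'b)"
  have ij: "i \<noteq> j" using j by auto
  have fa: "is_cycle p X (chain_map p fst a)" and fb: "is_cycle p X (chain_map p fst b)"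
    using a b by (auto intro: is_cycle_map continuous_map_XT_fst)
  have "is_bdry p (XT X (Tpl j js)) (a - chain_map p (\<lambda>x. (x, axis j 1)) (chain_map p fst a))"
    by (rule Tpl_star_bdry[OF j(1) a])
  moreover have "is_bdry p (XT X (Tpl j js)) (chain_map p (\<lambda>x. (x, axis j 1)) (chain_map p fst a)
      - chain_map p (\<lambda>x. (x, e)) (chain_map p fst a))"
  proof (rule section_bdry[OF _ fa])
    fix t :: real assume "0 \<le> t" "t \<le> 1" then show "(1 - t) *\<^sub>R axis j 1 + t *\<^sub>R e \<in> Tpl j js"
      using j ij by (cases "t = 1") (auto simp: Tpl_def Tn_def e_def axis_def)
  qed
  ultimately have 1: "is_bdry p ?Y (a - chain_map p (\<lambda>x. (x, e)) (chain_map p fst a))"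
    using is_bdry_trans bdry_XT_mono[OF _ Tpl_sub] by blast
  have "is_bdry p (XT X (Tmi j js)) (b - chain_map p (\<lambda>x. (x, axis j (-1))) (chain_map p fst b))"
    by (rule Tmi_star_bdry[OF j(1) b])
  moreover have "is_bdry p (XT X (Tmi j js)) (chain_map p (\<lambda>x. (x, axis j (-1))) (chain_map p fst b)
      - chain_map p (\<lambda>x. (x, e)) (chain_map p fst b))"
  proof (rule section_bdry[OF _ fb])
    fix t :: real assume "0 \<le> t" "t \<le> 1" then show "(1 - t) *\<^sub>R axis j (-1) + t *\<^sub>R e \<in> Tmi j js"
      using j ij by (cases "t = 1") (auto simp: Tmi_def Tn_def e_def axis_def)
  qed
  ultimately have 2: "is_bdry p ?Y (b - chain_map p (\<lambda>x. (x, e)) (chain_map p fst b))"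
    using is_bdry_trans bdry_XT_mono[OF _ Tmi_sub] by blast
  have "e \<in> Tn (j # js)" using j by (auto simp: e_def Tn_def axis_def)
  then have 3: "is_bdry p ?Y (chain_map p (\<lambda>x. (x, e)) (chain_map p fst (a + b)))"
    by (intro is_bdry_map[OF ab] continuous_map_section)
  have "is_bdry p ?Y ((a + b) - chain_map p (\<lambda>x. (x, e)) (chain_map p fst (a + b)))"
    using singular_relboundary_add[OF 1 2] by (simp add: chain_map_add algebra_simps)
  then show ?thesis using 3 by (rule is_bdry_transfer)
qed

lemma MVr_fst_bdry:
  assumes "MVr X j js p w a b" "is_bdry p X (chain_map p fst w)"
  shows "is_bdry p X (chain_map p fst (a + b))"
proof -
  have "is_bdry p X (chain_map p fst (w - (a + b)))"
    using assms(1) unfolding MVr_def by (blast intro: is_bdry_map continuous_map_XT_fst)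
  from singular_relboundary_diff[OF assms(2) this] show ?thesis by (simp add: chain_map_diff)
qed

lemma MVr_fst_boundary:
  assumes "MVr X j js (Suc q) w a b"
  shows "is_bdry q X (chain_map q fst (chain_boundary (Suc q) a))"
proof -
  have a: "singular_chain (Suc q) (XT X (Tpl j js)) a" using assms by (simp add: MVr_def)
  have "chain_map q fst (chain_boundary (Suc q) a) = chain_boundary (Suc q) (chain_map (Suc q) fst a)"
    using chain_boundary_chain_map[OF a, of fst] by simp
  then show ?thesis
    using is_bdry_boundary[OF singular_chain_chain_map[OF a continuous_map_XT_fst]] by simp
qed

text \<open>If the boundary of a is also the boundary of a chain e in the intersection, then a - e
  and b + e are cycles in the two half spaces, and their sum bounds because its projection
  does.\<close>

lemma ResR_inj:
  assumes "ResR X js p w z" "distinct js" "is_cycle p (XT X (Tn js)) w" "is_bdry p X (chain_map p fst w)"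
    "is_bdry (Suc p - length js) X z"
  shows "is_bdry p (XT X (Tn js)) w"
  using assms
proof (induction X js p w z rule: ResR.induct)
  case (2 X j p w z)
  then obtain a b where ab: "MVr X j [] p w a b" "z = chain_map p fst a" by auto
  have a: "is_cycle p (XT X (Tpl j [])) a"
    using ab MVr_boundary_zero[OF ab(1) 2(3)] by (auto simp: MVr_def singular_cycle)
  have b: "is_cycle p (XT X (Tmi j [])) b"
    using ab MVr_boundary_zero[OF ab(1) 2(3)] MVr_boundary_eq[OF ab(1) 2(3)] by (auto simp: MVr_def singular_cycle)
  have e: "axis j 1 \<in> Tpl j []" "axis j (-1) \<in> Tmi j []" by (auto simp: Tpl_def Tmi_def axis_def)
  have z: "is_bdry p X (chain_map p fst a)" using 2 ab by simp
  have z': "is_bdry p X (chain_map p fst b)"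
    using singular_relboundary_diff[OF MVr_fst_bdry[OF ab(1) 2(4)] z] by (simp add: chain_map_add)
  have "is_bdry p (XT X (Tpl j [])) a"
    by (rule is_bdry_transfer[OF Tpl_star_bdry[OF _ a] is_bdry_map[OF z continuous_map_section[OF e(1)]]]) auto
  moreover have "is_bdry p (XT X (Tmi j [])) b"
    by (rule is_bdry_transfer[OF Tmi_star_bdry[OF _ b] is_bdry_map[OF z' continuous_map_section[OF e(2)]]]) auto
  ultimately have "is_bdry p (XT X (Tn [j])) (a + b)"
    by (intro singular_relboundary_add bdry_XT_mono[OF _ Tpl_sub] bdry_XT_mono[OF _ Tmi_sub])
  then show ?case using ab(1) is_bdry_transfer unfolding MVr_def by metis
next
  case (3 X j i js p w z)
  then obtain q a b where 1: "p = Suc q" "MVr X j (i # js) p w a b" "ResR X (i # js) q (chain_boundary p a) z"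
    by auto
  have "is_bdry q (XT X (Tn (i # js))) (chain_boundary p a)"
    using 3(1)[OF 1(3)] 3(3-) 1 MVr_boundary_cycle[of X j "i # js" q w a b] MVr_fst_boundary[of X j "i # js" q w a b]
    by auto
  then obtain e where e: "singular_chain p (XT X (Tn (i # js))) e" "chain_boundary p e = chain_boundary p a"
    using 1(1) by (auto simp: singular_boundary)
  have ach: "singular_chain p (XT X (Tpl j (i # js))) a" and bch: "singular_chain p (XT X (Tmi j (i # js))) b"
    using 1(2) by (simp_all add: MVr_def)
  have "is_cycle p (XT X (Tpl j (i # js))) (a - e)"
    unfolding singular_cycle using singular_chain_diff[OF ach chain_XT_mono[OF e(1) Tn_sub_Tpl]] e(2)
    by (simp add: chain_boundary_diff)
  moreover have "is_cycle p (XT X (Tmi j (i # js))) (b + e)"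
    unfolding singular_cycle using singular_chain_add[OF bch chain_XT_mono[OF e(1) Tn_sub_Tmi]] e(2)
      MVr_boundary_eq[OF 1(2) 3(4)]
    by (simp add: chain_boundary_add)
  ultimately have "is_bdry p (XT X (Tn (j # i # js))) ((a - e) + (b + e))"
    using MVr_fst_bdry[OF 1(2) 3(5)] 3(3) by (intro cycles_sum_bdry[where i = i]) auto
  then have "is_bdry p (XT X (Tn (j # i # js))) (a + b)" by (simp add: algebra_simps)
  then show ?case using 1(2) is_bdry_transfer unfolding MVr_def by metis
qed auto

text \<open>Degree 0 is below the range of the residue. Two coordinates make the punctured space
  connected, so the projection alone decides.\<close>

lemma cycle_0_inj:
  assumes "distinct js" "2 \<le> length js" "is_cycle 0 (XT X (Tn js)) w" "is_bdry 0 X (chain_map 0 fst w)"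
  shows "is_bdry 0 (XT X (Tn js)) w"
proof -
  obtain j i js' where js: "js = j # i # js'" using assms(2) by (cases js; cases "tl js") auto
  obtain a b where ab: "MVr X j (i # js') 0 w a b" using MVr_exists assms js by blast
  have "is_bdry 0 (XT X (Tn (j # i # js'))) (a + b)"
    using ab MVr_fst_bdry[OF ab assms(4)] js assms(1)
    by (intro cycles_sum_bdry[where i = i]) (auto simp: is_cycle_0 MVr_def)
  then show ?thesis using ab is_bdry_transfer js unfolding MVr_def by metis
qed

subsection \<open>Reflections\<close>

definition reflL :: "'d::finite set \<Rightarrow> real^'d \<Rightarrow> real^'d" where
  "reflL J u = (\<chi> i. if i \<in> J then - u $ i else u $ i)"

lemma continuous_on_reflL: "continuous_on S (reflL J)"
proof -
  have "continuous_on S (\<lambda>x. if i \<in> J then - x $ i else x $ i)" for i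
    by (cases "i \<in> J") (auto intro!: continuous_intros)
  then show ?thesis unfolding reflL_def by (rule continuous_on_vec_lambda)
qed

lemma reflL_nth [simp]: "reflL J u $ i = (if i \<in> J then - u $ i else u $ i)"
  by (simp add: reflL_def)

lemma continuous_map_refl:
  assumes "\<And>u. u \<in> T \<Longrightarrow> reflL J u \<in> T'"
  shows "continuous_map (XT X T) (XT X T') (\<lambda>z. (fst z, reflL J (snd z)))"
proof -
  have "continuous_map (top_of_set T) (top_of_set T') (reflL J)"
    using assms continuous_on_reflL by auto
  then show ?thesis
    by (auto intro!: continuous_map_pairedI continuous_map_fst
      continuous_map_compose[OF continuous_map_snd, unfolded o_def])
qed

text \<open>Reflecting the coordinate that is being split interchanges the half spaces and puts b in
  the place of a, and the boundaries of a and b are opposite. A reflection in another coordinate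
  commutes with the splitting.\<close>

lemma ResR_reflect:
  fixes js :: "'b::finite list"
  assumes "ResR X js p w z" "distinct js" "j0 \<in> set js" "is_cycle p (XT X (Tn js)) w"
     "is_bdry p X (chain_map p fst w)"
  shows "\<exists>z'. ResR X js p (chain_map p (\<lambda>z. (fst z, reflL {j0} (snd z))) w) z' \<and> is_bdry (Suc p - length js) X (z' + z)"
  using assms
proof (induction X js p w z rule: ResR.induct)
  case (2 X j p w z)
  let ?r = "chain_map p (\<lambda>z. (fst z, reflL {j0} (snd z)))"
  obtain a b where ab: "MVr X j [] p w a b" "z = chain_map p fst a" using 2 by auto
  have "singular_chain p (XT X (Tpl j [])) (?r b)"
    using ab 2 by (intro singular_chain_chain_map[where X = "XT X (Tmi j [])"] continuous_map_refl)
      (auto simp: MVr_def Tpl_def Tmi_def Tn_def)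
  moreover have "singular_chain p (XT X (Tmi j [])) (?r a)"
    using ab 2 by (intro singular_chain_chain_map[where X = "XT X (Tpl j [])"] continuous_map_refl)
      (auto simp: MVr_def Tpl_def Tmi_def Tn_def)
  moreover have "is_bdry p (XT X (Tn [j])) (?r (w - (a + b)))"
    using ab by (intro is_bdry_map[where X = "XT X (Tn [j])"] continuous_map_refl) (auto simp: MVr_def Tn_def split: if_splits)
  ultimately have mv: "MVr X j [] p (?r w) (?r b) (?r a)"
    by (simp add: MVr_def chain_map_diff chain_map_add add.commute)
  \<comment> \<open>In the last coordinate the half lines change places: the new residue is the
    projection of b, and it cancels that of a up to a boundary because the projection of w
    bounds.\<close>
  have "chain_map p fst (?r b) + z = chain_map p fst (a + b)"
    by (simp add: ab chain_map_map chain_map_add add.commute)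
  then have "is_bdry (Suc p - length [j]) X (chain_map p fst (?r b) + z)"
    using MVr_fst_bdry[OF ab(1) 2(5)] by simp
  moreover have "ResR X [j] p (?r w) (chain_map p fst (?r b))"
    using mv unfolding ResR.simps by blast
  ultimately show ?case by blast
next
  case (3 X j i js p w z)
  let ?r = "\<lambda>p. chain_map p (\<lambda>z. (fst z, reflL {j0} (snd z)))"
  obtain q a b where 1: "p = Suc q" "MVr X j (i # js) p w a b" "ResR X (i # js) q (chain_boundary p a) z"
    using 3(2) by auto
  define w1 where "w1 = chain_boundary p a"
  have w1: "is_cycle q (XT X (Tn (i # js))) w1"
    unfolding w1_def using 1 3(5) by (auto intro: MVr_boundary_cycle)
  have fw1: "is_bdry q X (chain_map q fst w1)"
    unfolding w1_def using 1 by (auto intro: MVr_fst_boundary)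
  have rb: "is_bdry p (XT X (Tn (j # i # js))) (?r p (w - (a + b)))"
    using 1(2) by (intro is_bdry_map[where X = "XT X (Tn (j # i # js))"] continuous_map_refl) (auto simp: MVr_def Tn_def split: if_splits)
  have cr: "chain_boundary p (?r p c) = ?r q (chain_boundary p c)" if "singular_chain p Y c" for c and Y :: "('a \<times> (real^'b)) topology"
    using chain_boundary_chain_map[OF that] 1(1) by simp
  show ?case
  proof (cases "j0 = j")
    case True
    then have nj: "j0 \<notin> set (i # js)" using 3 by auto
    have "singular_chain p (XT X (Tpl j (i # js))) (?r p b)"
      using 1(2) True nj by (intro singular_chain_chain_map[where X = "XT X (Tmi j (i # js))"] continuous_map_refl)
        (auto simp: MVr_def Tpl_def Tmi_def Tn_def split: if_splits)
    moreover have "singular_chain p (XT X (Tmi j (i # js))) (?r p a)"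
      using 1(2) True nj by (intro singular_chain_chain_map[where X = "XT X (Tpl j (i # js))"] continuous_map_refl)
        (auto simp: MVr_def Tpl_def Tmi_def Tn_def split: if_splits)
    ultimately have mv: "MVr X j (i # js) p (?r p w) (?r p b) (?r p a)"
      using rb by (simp add: MVr_def chain_map_diff chain_map_add add.commute)
    have rw: "is_cycle p (XT X (Tn (j # i # js))) (?r p w)"
      using 3(5) by (intro is_cycle_map[where X = "XT X (Tn (j # i # js))"] continuous_map_refl) (auto simp: Tn_def split: if_splits)
    have "is_cycle q (XT X (Tn (i # js))) (chain_boundary p (?r p b))"
      using MVr_boundary_cycle mv rw 1(1) by blast
    then obtain z1 where z1: "ResR X (i # js) q (chain_boundary p (?r p b)) z1"
      using ResR_exists[of "i # js"] ResR_length[OF 1(3)] by blast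
    have eq: "chain_boundary p (?r p b) = - ?r q w1"
      using cr[of "XT X (Tmi j (i # js))" b] 1(2) MVr_boundary_eq[OF 1(2) 3(5)]
      by (simp add: MVr_def w1_def chain_map_minus)
    \<comment> \<open>Only the coordinate j0 moves along the segment. Being in
      \<open>Tn (i # js)\<close> is decided by other coordinates, so there the reflection is
      homotopic to the identity.\<close>
    have "homotopic_with (\<lambda>_. True) (XT X (Tn (i # js))) (XT X (Tn (i # js))) (\<lambda>z. (fst z, snd z)) (\<lambda>z. (fst z, reflL {j0} (snd z)))"
    proof (intro homotopic_XT_segment continuous_map_XT_fst continuous_map_XT_snd)
      show "continuous_map (XT X (Tn (i # js))) euclidean (\<lambda>z. reflL {j0} (snd z))"
        using continuous_map_compose[OF continuous_map_XT_snd, of euclidean "reflL {j0}" X "Tn (i # js)"] continuous_on_reflL by (auto simp: o_def)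
      fix zz :: "'a \<times> (real^'b)" and t :: real
      assume "zz \<in> topspace (XT X (Tn (i # js)))"
      then have "\<exists>k\<in>set (i # js). snd zz $ k \<noteq> 0" by (auto simp: Tn_def)
      then obtain k where k: "k \<in> set (i # js)" "snd zz $ k \<noteq> 0" by blast
      then have "((1 - t) *\<^sub>R snd zz + t *\<^sub>R reflL {j0} (snd zz)) $ k = snd zz $ k"
        using nj by (auto simp: algebra_simps)
      then show "(1 - t) *\<^sub>R snd zz + t *\<^sub>R reflL {j0} (snd zz) \<in> Tn (i # js)"
        using k unfolding Tn_def by (metis (mono_tags, lifting) mem_Collect_eq)
    qed
    from homotopic_bdry[OF this w1]
    have "is_bdry q (XT X (Tn (i # js))) (chain_map q (\<lambda>z. (fst z, snd z)) w1 - ?r q w1)"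
      .
    moreover have "chain_map q (\<lambda>z. (fst z, snd z)) w1 = w1"
      using w1 by (intro chain_map_id_gen[where X = "XT X (Tn (i # js))"]) (auto simp: singular_cycle)
    ultimately have "is_bdry q (XT X (Tn (i # js))) (chain_boundary p (?r p b) - - w1)"
      by (simp add: eq)
    then have "is_bdry (Suc q - length (i # js)) X (z1 - - z)"
      using ResR_unique[OF z1 ResR_minus[OF 1(3)]] by (simp add: w1_def)
    moreover have "ResR X (j # i # js) p (?r p w) z1"
      using mv z1 1(1) unfolding ResR.simps by blast
    ultimately show ?thesis using 1(1) by auto
  next
    case False
    then have j0: "j0 \<in> set (i # js)" using 3 by auto
    obtain z' where z': "ResR X (i # js) q (?r q w1) z'" "is_bdry (Suc q - length (i # js)) X (z' + z)"
      using 3(1)[OF 1(3) _ j0] w1 fw1 3(3) by (auto simp: w1_def)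
    have "singular_chain p (XT X (Tpl j (i # js))) (?r p a)"
      using 1(2) False by (intro singular_chain_chain_map[where X = "XT X (Tpl j (i # js))"] continuous_map_refl)
        (auto simp: MVr_def Tpl_def Tmi_def Tn_def split: if_splits)
    moreover have "singular_chain p (XT X (Tmi j (i # js))) (?r p b)"
      using 1(2) False by (intro singular_chain_chain_map[where X = "XT X (Tmi j (i # js))"] continuous_map_refl)
        (auto simp: MVr_def Tpl_def Tmi_def Tn_def split: if_splits)
    ultimately have mv: "MVr X j (i # js) p (?r p w) (?r p a) (?r p b)"
      using rb by (simp add: MVr_def chain_map_diff chain_map_add)
    have "chain_boundary p (?r p a) = ?r q w1"
      using cr 1(2) by (auto simp: MVr_def w1_def)
    then have "ResR X (i # js) q (chain_boundary p (?r p a)) z'"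
      using z'(1) by (simp only:)
    then have "ResR X (j # i # js) p (?r p w) z'"
      using mv 1(1) unfolding ResR.simps by blast
    then show ?thesis using z'(2) 1(1) by (intro exI[of _ z']) simp
  qed
qed auto

lemma ResR_reflect_set:
  fixes js :: "'b::finite list"
  assumes "finite J" "ResR X js p w z" "distinct js" "J \<subseteq> set js" "is_cycle p (XT X (Tn js)) w"
     "is_bdry p X (chain_map p fst w)"
  shows "\<exists>z'. ResR X js p (chain_map p (\<lambda>z. (fst z, reflL J (snd z))) w) z' \<and>
     is_bdry (Suc p - length js) X (z' - frag_cmul ((-1) ^ card J) z)"
  using assms
proof (induction J)
  case empty
  have "chain_map p (\<lambda>z. (fst z, reflL {} (snd z))) w = w"
    using empty by (intro chain_map_id_gen[where X = "XT X (Tn js)"]) (auto simp: singular_cycle reflL_def)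
  then show ?case using empty by (intro exI[of _ z]) simp
next
  case (insert j J)
  let ?r = "\<lambda>J. chain_map p (\<lambda>z. (fst z, reflL J (snd z)))"
  obtain z' where z': "ResR X js p (?r J w) z'" "is_bdry (Suc p - length js) X (z' - frag_cmul ((-1) ^ card J) z)"
    using insert by auto
  have cyc: "is_cycle p (XT X (Tn js)) (?r J w)"
    using insert by (intro is_cycle_map[where X = "XT X (Tn js)"] continuous_map_refl) (auto simp: Tn_def split: if_splits)
  have "chain_map p fst (?r J w) = chain_map p fst w"
    by (simp add: chain_map_map)
  then obtain z2 where z2: "ResR X js p (?r {j} (?r J w)) z2" "is_bdry (Suc p - length js) X (z2 + z')"
    using ResR_reflect[OF z'(1) _ _ cyc, of j] insert by auto
  have "reflL {j} (reflL J u) = reflL (insert j J) u" for u :: "real^'b"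
    using insert.hyps by (auto simp: vec_eq_iff)
  then have "?r {j} (?r J w) = ?r (insert j J) w" by (simp add: chain_map_map)
  moreover have "is_bdry (Suc p - length js) X (z2 - frag_cmul ((-1) ^ card (insert j J)) z)"
    using singular_relboundary_diff[OF z2(2) z'(2)] insert.hyps
    by (simp add: algebra_simps minus_frag_cmul[symmetric] del: minus_frag_cmul)
  ultimately show ?case using z2 by auto
qed

subsection \<open>Products of punctured spaces\<close>

definition enumd :: "'d::finite list" where
  "enumd = (SOME js. set js = UNIV \<and> distinct js)"

lemma enumd: "set (enumd :: 'd::finite list) = UNIV" "distinct (enumd :: 'd list)"
  using someI_ex[OF finite_distinct_list[of "UNIV :: 'd set"]] by (auto simp: enumd_def)

lemma length_enumd: "length (enumd :: 'd::finite list) = CARD('d)"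
  using enumd distinct_card by metis

lemma enumd_ne: "(enumd :: 'd::finite list) \<noteq> []"
  using enumd(1) by (metis UNIV_not_empty set_empty2)

lemma Tn_enumd: "Tn enumd = - {0}"
  by (auto simp: Tn_def enumd vec_eq_iff)

definition PA :: "nat set \<Rightarrow> (nat \<Rightarrow> real^'d::finite) topology" where
  "PA I = product_topology (\<lambda>_. top_of_set (- {0})) I"

lemma topspace_PA: "topspace (PA I) = I \<rightarrow>\<^sub>E - {0}"
  by (simp add: PA_def)

lemma continuous_map_PA:
  "continuous_map X (PA I) f \<longleftrightarrow> f ` topspace X \<subseteq> extensional I \<and>
     (\<forall>i\<in>I. continuous_map X euclidean (\<lambda>x. f x i) \<and> (\<forall>x\<in>topspace X. f x i \<noteq> 0))"
  by (auto simp: PA_def continuous_map_componentwise continuous_map_in_subtopology)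

lemma continuous_map_PA_nth: "i \<in> I \<Longrightarrow> continuous_map (PA I) euclidean (\<lambda>x. x i)"
  using continuous_map_PA[of "PA I" I id] by (auto simp: topspace_PA)

lemma continuous_map_PA_restrict: "J \<subseteq> I \<Longrightarrow> continuous_map (PA I) (PA J) (\<lambda>x. restrict x J)"
  unfolding continuous_map_PA by (auto simp: topspace_PA intro: continuous_map_PA_nth)

lemma continuous_map_XTI:
  "continuous_map Z X f \<Longrightarrow> continuous_map Z euclidean g \<Longrightarrow> (\<And>z. z \<in> topspace Z \<Longrightarrow> g z \<in> T) \<Longrightarrow>
    continuous_map Z (XT X T) (\<lambda>z. (f z, g z))"
  by (intro continuous_map_pairedI) (auto simp: continuous_map_in_subtopology)

lemma homotopic_PA_segment:
  fixes f g :: "'a \<Rightarrow> nat \<Rightarrow> real^'d::finite"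
  assumes f: "continuous_map X (PA I) f" and g: "continuous_map X (PA I) g"
    and seg: "\<And>x i t. x \<in> topspace X \<Longrightarrow> i \<in> I \<Longrightarrow> 0 \<le> t \<Longrightarrow> t \<le> 1 \<Longrightarrow> (1 - t) *\<^sub>R f x i + t *\<^sub>R g x i \<noteq> 0"
  shows "homotopic_with (\<lambda>_. True) X (PA I) f g"
proof -
  let ?h = "\<lambda>p. \<lambda>i\<in>I. (1 - fst p) *\<^sub>R f (snd p) i + fst p *\<^sub>R g (snd p) i"
  have "continuous_map (prod_topology (top_of_set {0..1::real}) X) (PA I) ?h"
    unfolding continuous_map_PA
  proof (intro conjI ballI)
    fix i assume i: "i \<in> I"
    have "continuous_map (prod_topology (top_of_set {0..1::real}) X) euclidean
      (\<lambda>p. (1 - fst p) *\<^sub>R f (snd p) i + fst p *\<^sub>R g (snd p) i)"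
      using f g i by (intro continuous_map_segment) (auto simp: continuous_map_PA)
    then show "continuous_map (prod_topology (top_of_set {0..1::real}) X) euclidean (\<lambda>x. ?h x i)"
      using i by simp
  qed (use seg in auto)
  moreover have "\<forall>x\<in>topspace X. ?h (0, x) = f x" "\<forall>x\<in>topspace X. ?h (1, x) = g x"
    using f g unfolding continuous_map_PA by (force simp: extensional_def fun_eq_iff)+
  ultimately show ?thesis
    by (subst homotopic_with) (auto intro!: exI[of _ ?h])
qed

definition spl :: "nat set \<Rightarrow> nat \<Rightarrow> (nat \<Rightarrow> real^'d::finite) \<Rightarrow> (nat \<Rightarrow> real^'d) \<times> (real^'d)" where
  "spl I a x = (restrict x I, x a)"

definition joinc :: "nat set \<Rightarrow> nat \<Rightarrow> (nat \<Rightarrow> real^'d::finite) \<times> (real^'d) \<Rightarrow> nat \<Rightarrow> real^'d" where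
  "joinc I a p = (\<lambda>i\<in>insert a I. if i = a then snd p else fst p i)"

lemma continuous_map_spl: "continuous_map (PA (insert a I)) (XT (PA I) (- {0})) (spl I a)"
  unfolding spl_def using continuous_map_PA_nth[of a "insert a I"]
  by (intro continuous_map_XTI continuous_map_PA_restrict) (auto simp: topspace_PA)

lemma continuous_map_fst_nth: "i \<in> I \<Longrightarrow> continuous_map (XT (PA I) T) euclidean (\<lambda>p. fst p i)"
  using continuous_map_compose[OF continuous_map_fst continuous_map_PA_nth] by (auto simp: o_def)

lemma continuous_map_joinc: "continuous_map (XT (PA I) (- {0})) (PA (insert a I)) (joinc I a)"
  unfolding continuous_map_PA joinc_def
  by (auto simp: topspace_PA continuous_map_XT_snd continuous_map_fst_nth)

lemma joinc_spl: "a \<notin> I \<Longrightarrow> x \<in> topspace (PA (insert a I)) \<Longrightarrow> joinc I a (spl I a x) = x"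
  by (auto simp: joinc_def spl_def topspace_PA PiE_def extensional_def fun_eq_iff)

lemma chain_map_joinc_spl: "a \<notin> I \<Longrightarrow> singular_chain p (PA (insert a I)) w \<Longrightarrow>
    chain_map p (joinc I a) (chain_map p (spl I a) w) = w"
  unfolding chain_map_map by (rule chain_map_id_gen) (auto simp: joinc_spl)

text \<open>The simplex at the only point of the empty product.\<close>
definition pt0 :: "(nat \<Rightarrow> real) \<Rightarrow> nat \<Rightarrow> 'b" where
  "pt0 = restrict (\<lambda>_ _. undefined) (standard_simplex 0)"

text \<open>An arbitrary choice among the residues of w; \<open>ResR_unique\<close> makes it well
  defined up to boundaries.\<close>

definition resc :: "'a topology \<Rightarrow> nat \<Rightarrow> ('a \<times> (real^'d::finite)) chain \<Rightarrow> 'a chain" where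
  "resc X p w = (SOME z. ResR X enumd p w z)"

text \<open>The degree of a cycle in the top dimension of the i-fold power of a punctured space.\<close>
primrec tau :: "nat \<Rightarrow> (nat \<Rightarrow> real^'d::finite) chain \<Rightarrow> int" where
  "tau 0 c = Poly_Mapping.lookup c pt0"
| "tau (Suc i) c = tau i (resc (PA {..<i}) (Suc i * (CARD('d) - 1))
      (chain_map (Suc i * (CARD('d) - 1)) (spl {..<i} i) c))"

lemma topspace_PA_empty: "topspace (PA {}) = {\<lambda>_. undefined}"
  by (auto simp: topspace_PA)

locale punctured =
  fixes ty :: "'d::finite itself" and D :: nat
  assumes card2: "2 \<le> CARD('d)" and D_eq: "D = CARD('d) - 1"
begin

abbreviation PAn :: "nat \<Rightarrow> (nat \<Rightarrow> real^'d) topology" where "PAn i \<equiv> PA {..<i}"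

lemma D_pos: "0 < D" using card2 by (simp add: D_eq)

lemma tau_Suc: "tau (Suc i) (c :: (nat \<Rightarrow> real^'d) chain) =
    tau i (resc (PAn i) (Suc i * D) (chain_map (Suc i * D) (spl {..<i} i) c))"
  by (simp add: D_eq)

declare tau.simps(2) [simp del] tau_Suc [simp]

lemma Suc_diff_card: "Suc p - length (enumd :: 'd list) = p - D"
  using card2 by (simp add: length_enumd D_eq)

lemma ResR_resc:
  assumes "is_cycle p (XT X (- {0})) w" "D \<le> p"
  shows "ResR X (enumd :: 'd list) p w (resc X p w)" "is_cycle (p - D) X (resc X p w)"
proof -
  have "length (enumd :: 'd list) \<le> Suc p" using assms(2) card2 by (simp add: length_enumd D_eq)
  then show 1: "ResR X (enumd :: 'd list) p w (resc X p w)"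
    unfolding resc_def using assms(1) ResR_exists[OF enumd_ne, of p X w] by (metis Tn_enumd someI_ex)
  show "is_cycle (p - D) X (resc X p w)"
    using ResR_cycle[OF 1] assms by (simp add: Tn_enumd Suc_diff_card)
qed

lemma ResR_uniq:
  assumes "ResR X (enumd :: 'd list) p w z" "ResR X (enumd :: 'd list) p w z'"
  shows "is_bdry (p - D) X (z - z')"
  using ResR_unique[OF assms] by (simp add: Suc_diff_card)

lemma punctured_inj:
  assumes "is_cycle p (XT X (- {0 :: real^'d})) w" "is_bdry p X (chain_map p fst w)"
    "D \<le> p \<Longrightarrow> is_bdry (p - D) X (resc X p w)" "p = 0 \<or> D \<le> p"
  shows "is_bdry p (XT X (- {0})) w"
proof (cases "D \<le> p")
  case True
  then show ?thesis
    using ResR_inj[OF ResR_resc(1)[OF assms(1) True] enumd(2)] assms by (simp add: Tn_enumd Suc_diff_card)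
next
  case False
  then show ?thesis
    using cycle_0_inj[of "enumd :: 'd list" X w] assms card2 by (simp add: Tn_enumd enumd length_enumd D_eq)
qed

text \<open>Both the projection and the residue of such a cycle lie again above the top dimension of
  the product with one factor less.\<close>

lemma cycles_above_top_dim:
  assumes "finite I" "is_cycle p (PA I :: (nat \<Rightarrow> real^'d) topology) w" "card I * D < p"
  shows "is_bdry p (PA I) w"
  using assms
proof (induction I arbitrary: p w rule: finite_induct)
  case empty
  then show ?case
    using singular_boundary_eq_cycle_singleton[OF topspace_PA_empty, of p w] by simp
next
  case (insert a I)
  have w: "is_cycle p (XT (PA I) (- {0})) (chain_map p (spl I a) w)"
    using insert.prems continuous_map_spl by (blast intro: is_cycle_map)
  have p: "D \<le> p" "card I * D < p - D" "card I * D < p"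
    using insert by auto
  have "is_bdry p (XT (PA I) (- {0})) (chain_map p (spl I a) w)"
    by (rule punctured_inj[OF w]) (use p insert.IH is_cycle_map[OF w continuous_map_fst] ResR_resc(2)[OF w] in auto)
  then have "is_bdry p (PA (insert a I)) (chain_map p (joinc I a) (chain_map p (spl I a) w))"
    by (rule is_bdry_map[OF _ continuous_map_joinc])
  then show ?case
    using chain_map_joinc_spl insert by (metis singular_cycle)
qed

lemma PAn_Suc: "PAn (Suc i) = PA (insert i {..<i})" by (simp add: lessThan_Suc)

lemma spl_cycle: "is_cycle p (PAn (Suc i)) w \<Longrightarrow> is_cycle p (XT (PAn i) (- {0})) (chain_map p (spl {..<i} i) w)"
  unfolding PAn_Suc by (rule is_cycle_map[OF _ continuous_map_spl])

lemma spl_bdry: "is_bdry p (PAn (Suc i)) w \<Longrightarrow> is_bdry p (XT (PAn i) (- {0})) (chain_map p (spl {..<i} i) w)"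
  unfolding PAn_Suc by (rule is_bdry_map[OF _ continuous_map_spl])

lemma spl_ResR:
  assumes "is_cycle (Suc i * D) (PAn (Suc i)) w"
  defines "z \<equiv> resc (PAn i) (Suc i * D) (chain_map (Suc i * D) (spl {..<i} i) w)"
  shows "ResR (PAn i) (enumd :: 'd list) (Suc i * D) (chain_map (Suc i * D) (spl {..<i} i) w) z"
    "is_cycle (i * D) (PAn i) z"
  using ResR_resc[OF spl_cycle[OF assms(1)]] by (auto simp: z_def)

text \<open>Proved as one statement: \<open>resc\<close> is a choice, additive only up to
  boundaries, so additivity at the next stage needs the vanishing on boundaries at the present
  one.\<close>

lemma tau_bdry_diff:
  "(\<forall>w. is_bdry (i * D) (PAn i) w \<longrightarrow> tau i w = 0) \<and>
   (\<forall>w w'. is_cycle (i * D) (PAn i) w \<longrightarrow> is_cycle (i * D) (PAn i) w' \<longrightarrow> tau i (w - w') = tau i w - tau i w')"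
proof (induction i)
  case 0
  have "w = 0" if "is_bdry 0 (PA {}) w" for w :: "(nat \<Rightarrow> real^'d) chain"
    using that singular_boundary_singleton[OF topspace_PA_empty, of 0 w] by simp
  then have "tau 0 w = 0" if "is_bdry 0 (PA {}) w" for w :: "(nat \<Rightarrow> real^'d) chain"
    using that by fastforce
  then show ?case by (auto simp: lookup_minus)
next
  case (Suc i)
  have bd: "tau i z = tau i z'" if "is_cycle (i * D) (PAn i) z" "is_cycle (i * D) (PAn i) z'" "is_bdry (i * D) (PAn i) (z - z')" for z z'
    using that Suc by (metis right_minus_eq)
  show ?case
  proof (intro conjI allI impI)
    fix w assume w: "is_bdry (Suc i * D) (PAn (Suc i)) w"
    have "is_bdry (i * D) (PAn i) (resc (PAn i) (Suc i * D) (chain_map (Suc i * D) (spl {..<i} i) w))"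
      using ResR_bdry[OF spl_ResR(1)[OF is_bdry_imp_cycle[OF w]]] spl_bdry[OF w]
      by (simp add: Tn_enumd Suc_diff_card)
    then show "tau (Suc i) w = 0" using Suc by simp
  next
    fix w w' assume w: "is_cycle (Suc i * D) (PAn (Suc i)) w" "is_cycle (Suc i * D) (PAn (Suc i)) w'"
    note d = singular_relcycle_diff[OF w]
    let ?z = "\<lambda>w. resc (PAn i) (Suc i * D) (chain_map (Suc i * D) (spl {..<i} i) w)"
    have 1: "ResR (PAn i) (enumd :: 'd list) (Suc i * D) (chain_map (Suc i * D) (spl {..<i} i) (w - w')) (?z w - ?z w')"
      using ResR_diff[OF spl_ResR(1)[OF w(1)] spl_ResR(1)[OF w(2)]] by (simp only: chain_map_diff)
    have "is_bdry (Suc i * D - D) (PAn i) (?z (w - w') - (?z w - ?z w'))"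
      by (rule ResR_uniq[OF spl_ResR(1)[OF d] 1])
    then have "tau i (?z (w - w')) = tau i (?z w - ?z w')"
      using spl_ResR(2)[OF w(1)] spl_ResR(2)[OF w(2)] spl_ResR(2)[OF d] by (intro bd singular_relcycle_diff) auto
    also have "\<dots> = tau i (?z w) - tau i (?z w')"
      using Suc spl_ResR(2)[OF w(1)] spl_ResR(2)[OF w(2)] by blast
    finally show "tau (Suc i) (w - w') = tau (Suc i) w - tau (Suc i) w'" by simp
  qed
qed

lemma tau_bdry: "is_bdry (i * D) (PAn i) w \<Longrightarrow> tau i w = 0"
  and tau_diff: "is_cycle (i * D) (PAn i) w \<Longrightarrow> is_cycle (i * D) (PAn i) w' \<Longrightarrow> tau i (w - w') = tau i w - tau i w'"
  using tau_bdry_diff by blast+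

lemma tau_zero: "tau i (0 :: (nat \<Rightarrow> real^'d) chain) = 0"
  by (rule tau_bdry) simp

lemma tau_minus: "is_cycle (i * D) (PAn i) w \<Longrightarrow> tau i (- w) = - tau i w"
  using tau_diff[of i 0 w] tau_zero by simp

lemma tau_add: "is_cycle (i * D) (PAn i) w \<Longrightarrow> is_cycle (i * D) (PAn i) w' \<Longrightarrow> tau i (w + w') = tau i w + tau i w'"
  using tau_diff[of i w "- w'"] tau_minus[of i w'] by (simp add: singular_relcycle_minus)

lemma tau_cong: "is_bdry (i * D) (PAn i) (w - w') \<Longrightarrow> is_cycle (i * D) (PAn i) w' \<Longrightarrow> tau i w = tau i w'"
  using tau_add[of i "w - w'" w'] tau_bdry[of i "w - w'"] is_bdry_imp_cycle by fastforce

lemma tau_cmul: "is_cycle (i * D) (PAn i) w \<Longrightarrow> tau i (frag_cmul k w) = k * tau i w"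
proof (induction k rule: int_induct[where k = 0])
  case base then show ?case by (simp add: tau_zero)
next
  case (step1 k)
  then show ?case by (simp add: frag_cmul_distrib tau_add singular_relcycle_cmul algebra_simps)
next
  case (step2 k)
  then show ?case by (simp add: frag_cmul_diff_distrib tau_diff singular_relcycle_cmul algebra_simps)
qed

lemma tau_Suc_ResR:
  assumes w: "is_cycle (Suc i * D) (PAn (Suc i)) w"
    and z: "ResR (PAn i) (enumd :: 'd list) (Suc i * D) (chain_map (Suc i * D) (spl {..<i} i) w) z"
  shows "tau (Suc i) w = tau i z"
proof -
  have "is_cycle (i * D) (PAn i) z"
    using ResR_cycle[OF z] spl_cycle[OF w] by (simp add: Tn_enumd Suc_diff_card)
  then show ?thesis
    using ResR_uniq[OF spl_ResR(1)[OF w] z] by (simp add: tau_cong)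
qed

text \<open>The projection of a top-dimensional cycle to one factor less bounds for dimension
  reasons, so only the residue matters.\<close>

lemma tau_inj: "is_cycle (i * D) (PAn i) w \<Longrightarrow> tau i w = 0 \<Longrightarrow> is_bdry (i * D) (PAn i) w"
proof (induction i arbitrary: w)
  case 0
  then have "singular_chain 0 (PA {}) w" by (simp add: is_cycle_0)
  then obtain b where "w = frag_cmul b (frag_of pt0)"
    using singular_chain_singleton[OF topspace_PA_empty, of 0 w] by (auto simp: pt0_def)
  then show ?case using 0 by simp
next
  case (Suc i)
  note w = spl_cycle[OF Suc.prems(1)]
  have "is_bdry (Suc i * D) (XT (PAn i) (- {0})) (chain_map (Suc i * D) (spl {..<i} i) w)"
  proof (rule punctured_inj[OF w])
    show "is_bdry (Suc i * D) (PAn i) (chain_map (Suc i * D) fst (chain_map (Suc i * D) (spl {..<i} i) w))"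
      using D_pos by (intro cycles_above_top_dim is_cycle_map[OF w continuous_map_fst]) auto
    show "is_bdry (Suc i * D - D) (PAn i) (resc (PAn i) (Suc i * D) (chain_map (Suc i * D) (spl {..<i} i) w))"
      using Suc.IH[OF spl_ResR(2)[OF Suc.prems(1)]] Suc.prems(2) by simp
  qed auto
  then have "is_bdry (Suc i * D) (PA (insert i {..<i})) (chain_map (Suc i * D) (joinc {..<i} i) (chain_map (Suc i * D) (spl {..<i} i) w))"
    by (rule is_bdry_map[OF _ continuous_map_joinc])
  then show ?case
    using chain_map_joinc_spl[of i "{..<i}" "Suc i * D" w] Suc.prems(1) by (auto simp: singular_cycle PAn_Suc)
qed

lemma chain_map_spl_joinc:
  assumes "singular_chain p (XT (PA I) T) w" "a \<notin> I"
  shows "chain_map p (spl I a) (chain_map p (joinc I a) w) = (w :: ((nat \<Rightarrow> real^'d) \<times> (real^'d)) chain)"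
  unfolding chain_map_map
  by (rule chain_map_id_gen[OF assms(1)])
     (use assms(2) in \<open>auto simp: joinc_def spl_def topspace_PA PiE_def extensional_def fun_eq_iff\<close>)

lemma tau_onto: "\<exists>w. is_cycle (i * D) (PAn i) w \<and> tau i w = 1"
proof (induction i)
  case 0
  have "singular_chain 0 (PAn 0) (frag_of pt0)"
    using singular_chain_singleton[OF topspace_PA_empty, of 0 "frag_of pt0"]
    by (auto simp: pt0_def intro!: exI[of _ 1])
  then show ?case by (intro exI[of _ "frag_of pt0"]) (simp add: is_cycle_0)
next
  case (Suc i)
  then obtain z where z: "is_cycle (i * D) (PAn i) z" "tau i z = 1" by blast
  have "Suc i * D = i * D + length (enumd :: 'd list) - 1" using card2 by (simp add: length_enumd D_eq)
  then obtain w where w: "is_cycle (Suc i * D) (XT (PAn i) (- {0})) w" "ResR (PAn i) (enumd :: 'd list) (Suc i * D) w z"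
    using ResR_surj[OF z(1) enumd_ne enumd(2), of "Suc i * D"] by (auto simp: Tn_enumd)
  have c: "is_cycle (Suc i * D) (PAn (Suc i)) (chain_map (Suc i * D) (joinc {..<i} i) w)"
    unfolding PAn_Suc by (rule is_cycle_map[OF w(1) continuous_map_joinc])
  have "chain_map (Suc i * D) (spl {..<i} i) (chain_map (Suc i * D) (joinc {..<i} i) w) = w"
    using w(1) by (intro chain_map_spl_joinc[where T = "- {0}"]) (auto simp: singular_cycle)
  then show ?case using tau_Suc_ResR[OF c] w(2) z(2) c by auto
qed

text \<open>The image of w in \<open>PA J\<close> bounds because its degree exceeds the top
  dimension there.\<close>

lemma tau_factor_zero:
  fixes f :: "'x \<Rightarrow> nat \<Rightarrow> real^'d"
  assumes "finite J" "card J < i" "continuous_map X (PA J) f" "continuous_map (PA J) (PAn i) g" "is_cycle (i * D) X w"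
  shows "tau i (chain_map (i * D) (\<lambda>x. g (f x)) w) = 0"
proof -
  have "is_bdry (i * D) (PA J) (chain_map (i * D) f w)"
    using assms D_pos by (intro cycles_above_top_dim is_cycle_map) auto
  then have "is_bdry (i * D) (PAn i) (chain_map (i * D) g (chain_map (i * D) f w))"
    using assms is_bdry_map by blast
  then show ?thesis by (simp add: tau_bdry chain_map_map)
qed

end

subsection \<open>Signs of coordinate permutations\<close>

definition pm :: "(nat \<Rightarrow> nat) \<Rightarrow> (nat \<Rightarrow> 'v) \<Rightarrow> nat \<Rightarrow> 'v" where
  "pm b x = (\<lambda>t. x (b t))"

lemma continuous_map_pm: "b permutes I \<Longrightarrow> continuous_map (PA I) (PA I) (pm b)"
  unfolding continuous_map_PA pm_def
  by (auto simp: topspace_PA permutes_in_image permutes_not_in extensional_def intro!: continuous_map_PA_nth)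

definition ins :: "nat \<Rightarrow> nat \<Rightarrow> (nat \<Rightarrow> 'v) \<times> 'v \<Rightarrow> nat \<Rightarrow> 'v" where
  "ins i s p = (\<lambda>t\<in>{..<Suc i}. if t < s then fst p t else if t = s then snd p else fst p (t - 1))"

lemma continuous_map_ins: "s \<le> i \<Longrightarrow> continuous_map (XT (PA {..<i}) (- {0})) (PA {..<Suc i})
    (ins i s :: (nat \<Rightarrow> real^'a::finite) \<times> (real^'a) \<Rightarrow> nat \<Rightarrow> real^'a)"
  unfolding continuous_map_PA
proof (intro conjI ballI)
  fix t assume s: "s \<le> i" and t: "t \<in> {..<Suc i}"
  show "continuous_map (XT (PA {..<i}) (- {0})) euclidean (\<lambda>x. ins i s x t)"
  proof (cases t s rule: linorder_cases)
    case less
    then show ?thesis using s t continuous_map_fst_nth[of t "{..<i}" "- {0}"] by (simp add: ins_def)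
  next
    case equal
    then show ?thesis using s t continuous_map_XT_snd[of "PA {..<i}" "- {0}"] by (simp add: ins_def)
  next
    case greater
    then have "t - 1 \<in> {..<i}" using t by auto
    then show ?thesis using greater t continuous_map_fst_nth[of "t - 1" "{..<i}" "- {0}"] by (simp add: ins_def)
  qed
  fix x :: "(nat \<Rightarrow> real^'a) \<times> (real^'a)" assume "x \<in> topspace (XT (PA {..<i}) (- {0}))"
  then show "ins i s x t \<noteq> 0" using s t
    by (auto simp: ins_def topspace_PA PiE_def Pi_def)
qed (auto simp: ins_def)

lemma ins_last: "ins i i = joinc {..<i} i"
  by (auto simp: ins_def joinc_def fun_eq_iff restrict_def)

lemma ins_swap: "s < i \<Longrightarrow> ins i s p = pm (Transposition.transpose s (Suc s)) (ins i (Suc s) p)"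
  by (auto simp: ins_def pm_def fun_eq_iff restrict_def Transposition.transpose_def)

context punctured
begin

definition torus :: "nat \<Rightarrow> (nat \<Rightarrow> real^'d) chain" where
  "torus i = (SOME w. is_cycle (i * D) (PAn i) w \<and> tau i w = 1)"

lemma torus: "is_cycle (i * D) (PAn i) (torus i)" "tau i (torus i) = 1"
  using someI_ex[OF tau_onto[of i]] unfolding torus_def by auto

text \<open>\<open>tau\<close> identifies the top homology with the integers, so a self-map acts by
  the value it gives on the generator \<open>torus i\<close>.\<close>

lemma tau_degree:
  assumes "continuous_map (PAn i) (PAn i) h" "is_cycle (i * D) (PAn i) w"
  shows "tau i (chain_map (i * D) h w) = tau i (chain_map (i * D) h (torus i)) * tau i w"
proof -
  define v where "v = w - frag_cmul (tau i w) (torus i)"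
  have c: "is_cycle (i * D) (PAn i) (frag_cmul k (torus i))" for k
    by (rule singular_relcycle_cmul[OF torus(1)])
  have v: "is_cycle (i * D) (PAn i) v" unfolding v_def by (rule singular_relcycle_diff[OF assms(2) c])
  have "tau i v = 0"
    unfolding v_def by (simp add: tau_diff[OF assms(2) c] tau_cmul[OF torus(1)] torus(2))
  then have "is_bdry (i * D) (PAn i) (chain_map (i * D) h v)"
    by (intro is_bdry_map[OF tau_inj[OF v] assms(1)])
  then have "tau i (chain_map (i * D) h v) = 0" by (rule tau_bdry)
  moreover have "tau i (chain_map (i * D) h v) =
      tau i (chain_map (i * D) h w) - tau i w * tau i (chain_map (i * D) h (torus i))"
    unfolding v_def chain_map_diff chain_map_cmul
    by (simp add: tau_diff tau_cmul singular_relcycle_cmul is_cycle_map[OF assms(2,1)] is_cycle_map[OF torus(1) assms(1)])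
  ultimately show ?thesis by simp
qed

definition sg :: "nat \<Rightarrow> (nat \<Rightarrow> nat) \<Rightarrow> int" where
  "sg i b = tau i (chain_map (i * D) (pm b) (torus i))"

lemma tau_pm: "b permutes {..<i} \<Longrightarrow> is_cycle (i * D) (PAn i) w \<Longrightarrow>
    tau i (chain_map (i * D) (pm b) w) = sg i b * tau i w"
  unfolding sg_def by (rule tau_degree[OF continuous_map_pm])

lemma sg_mult:
  assumes "b permutes {..<i}" "c permutes {..<i}"
  shows "sg i (b \<circ> c) = sg i c * sg i b"
proof -
  have "chain_map (i * D) (pm (b \<circ> c)) (torus i) = chain_map (i * D) (pm c) (chain_map (i * D) (pm b) (torus i))"
    by (simp add: chain_map_map pm_def[abs_def])
  then show ?thesis
    using tau_pm[OF assms(2) is_cycle_map[OF torus(1) continuous_map_pm[OF assms(1)]]] by (simp add: sg_def)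
qed

lemma sg_id: "sg i id = 1"
proof -
  have "chain_map (i * D) (pm id) (torus i) = torus i"
    using torus(1) by (intro chain_map_id_gen[where X = "PAn i"]) (auto simp: singular_cycle pm_def)
  then show ?thesis by (simp add: sg_def torus(2))
qed

text \<open>The last coordinate is fixed by b, and the residue in it is natural with respect to maps
  of the other coordinates.\<close>

lemma sg_Suc:
  assumes b: "b permutes {..<i}"
  shows "sg (Suc i) b = sg i b"
proof -
  have b': "b permutes {..<Suc i}" by (rule permutes_subset[OF b]) auto
  let ?w = "torus (Suc i)" let ?p = "Suc i * D"
  note w = torus(1)[of "Suc i"]
  define z where "z = resc (PAn i) ?p (chain_map ?p (spl {..<i} i) ?w)"
  have z: "ResR (PAn i) (enumd :: 'd list) ?p (chain_map ?p (spl {..<i} i) ?w) z" "is_cycle (i * D) (PAn i) z"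
    unfolding z_def by (rule spl_ResR[OF w])+
  have "spl {..<i} i (pm b x) = (pm b (fst (spl {..<i} i x)), snd (spl {..<i} i x))" for x :: "nat \<Rightarrow> real^'d"
    using permutes_in_image[OF b] permutes_not_in[OF b] by (auto simp: spl_def pm_def fun_eq_iff restrict_def)
  then have "chain_map ?p (spl {..<i} i) (chain_map ?p (pm b) ?w) =
      chain_map ?p (\<lambda>z. (pm b (fst z), snd z)) (chain_map ?p (spl {..<i} i) ?w)"
    by (simp add: chain_map_map)
  then have "ResR (PAn i) (enumd :: 'd list) ?p (chain_map ?p (spl {..<i} i) (chain_map ?p (pm b) ?w)) (chain_map (i * D) (pm b) z)"
    using ResR_map[OF z(1) continuous_map_pm[OF b]] by (simp add: Suc_diff_card)
  then have "sg (Suc i) b = tau i (chain_map (i * D) (pm b) z)"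
    unfolding sg_def by (rule tau_Suc_ResR[OF is_cycle_map[OF w continuous_map_pm[OF b']]])
  also have "\<dots> = sg i b * tau i z" by (rule tau_pm[OF b z(2)])
  also have "tau i z = tau (Suc i) ?w" by (rule tau_Suc_ResR[OF w z(1), symmetric])
  finally show ?thesis by (simp add: torus)
qed

abbreviation "adj k \<equiv> Transposition.transpose k (Suc k)"

lemma adj_permutes: "Suc k < i \<Longrightarrow> adj k permutes {..<i}"
  by (rule permutes_swap_id) auto

lemma sg_adj_sq: "Suc k < i \<Longrightarrow> sg i (adj k) * sg i (adj k) = 1"
  using sg_mult[OF adj_permutes adj_permutes, of k i k] sg_id[of i] by simp

text \<open>The braid relation, read among commuting signs, equates the values at neighbouring
  transpositions.\<close>

lemma sg_adj_Suc:
  assumes "Suc (Suc k) < i" shows "sg i (adj (Suc k)) = sg i (adj k)"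
proof -
  have p: "adj k permutes {..<i}" "adj (Suc k) permutes {..<i}" using assms by (auto intro: adj_permutes)
  have "adj k \<circ> (adj (Suc k) \<circ> adj k) = adj (Suc k) \<circ> (adj k \<circ> adj (Suc k))"
    by (auto simp: fun_eq_iff Transposition.transpose_def)
  then have "sg i (adj k \<circ> (adj (Suc k) \<circ> adj k)) = sg i (adj (Suc k) \<circ> (adj k \<circ> adj (Suc k)))" by simp
  then have "sg i (adj k) * sg i (adj (Suc k)) * sg i (adj k) = sg i (adj (Suc k)) * sg i (adj k) * sg i (adj (Suc k))"
    using sg_mult[OF p(1) permutes_compose[OF p(1,2)]] sg_mult[OF p(2,1)]
      sg_mult[OF p(2) permutes_compose[OF p(2,1)]] sg_mult[OF p] by simp
  then have "sg i (adj (Suc k)) * (sg i (adj k) * sg i (adj k)) = sg i (adj k) * (sg i (adj (Suc k)) * sg i (adj (Suc k)))"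
    by (simp add: ac_simps)
  then show ?thesis using sg_adj_sq[of k i] sg_adj_sq[of "Suc k" i] assms by simp
qed

text \<open>Only its square is computed; the value follows from \<open>eps_eq\<close> once the
  functionals are known to form a \<open>config_family\<close>.\<close>

definition eps0 :: int where "eps0 = sg 2 (adj 0)"

lemma eps0_sq: "eps0 * eps0 = 1" unfolding eps0_def by (rule sg_adj_sq) simp

lemma sg_adj: "Suc k < i \<Longrightarrow> sg i (adj k) = eps0"
proof (induction k)
  case 0
  then have "2 \<le> i" by simp
  then show ?case
  proof (induction i rule: dec_induct)
    case base show ?case by (simp add: eps0_def)
  next
    case (step i)
    then show ?case using sg_Suc[OF adj_permutes[of 0 i]] by simp
  qed
next
  case (Suc k)
  then show ?case using sg_adj_Suc[of k i] by simp
qed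

text \<open>\<open>tau\<close> strips the last coordinate first, so a vector inserted at position s
  has to pass i - s others, each for a factor \<open>eps0\<close>.\<close>

lemma tau_ins:
  assumes w: "is_cycle (Suc i * D) (XT (PAn i) (- {0})) w" and z: "ResR (PAn i) (enumd :: 'd list) (Suc i * D) w z"
  shows "s \<le> i \<Longrightarrow> tau (Suc i) (chain_map (Suc i * D) (ins i s) w) = eps0 ^ (i - s) * tau i z"
proof (induction rule: inc_induct)
  case base
  have c: "is_cycle (Suc i * D) (PAn (Suc i)) (chain_map (Suc i * D) (joinc {..<i} i) w)"
    unfolding PAn_Suc by (rule is_cycle_map[OF w continuous_map_joinc])
  have "chain_map (Suc i * D) (spl {..<i} i) (chain_map (Suc i * D) (joinc {..<i} i) w) = w"
    using w by (intro chain_map_spl_joinc[where T = "- {0}"]) (auto simp: singular_cycle)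
  then have "ResR (PAn i) (enumd :: 'd list) (Suc i * D)
      (chain_map (Suc i * D) (spl {..<i} i) (chain_map (Suc i * D) (joinc {..<i} i) w)) z"
    using z by (simp only:)
  from tau_Suc_ResR[OF c this] show ?case by (simp add: ins_last del: tau_Suc)
next
  case (step s)
  have "chain_map (Suc i * D) (ins i s) w = chain_map (Suc i * D) (pm (adj s)) (chain_map (Suc i * D) (ins i (Suc s)) w)"
    unfolding chain_map_map using ins_swap[OF step.hyps(2)] by (metis (no_types))
  moreover have "is_cycle (Suc i * D) (PAn (Suc i)) (chain_map (Suc i * D) (ins i (Suc s)) w)"
    using step.hyps by (intro is_cycle_map[OF w continuous_map_ins]) auto
  ultimately have "tau (Suc i) (chain_map (Suc i * D) (ins i s) w) = eps0 * (eps0 ^ (i - Suc s) * tau i z)"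
    using tau_pm[OF adj_permutes[of s "Suc i"]] sg_adj[of s "Suc i"] step by (simp del: tau_Suc)
  moreover have "i - s = Suc (i - Suc s)" using step.hyps by simp
  ultimately show ?case by simp
qed

definition dl0 :: int where "dl0 = (-1) ^ CARD('d)"

lemma dl0_sq: "dl0 * dl0 = 1" by (simp add: dl0_def flip: power_add mult_2)

text \<open>The antipode is the product of the reflections in all coordinates, with one sign for
  each.\<close>

lemma ResR_antipode:
  assumes "ResR X (enumd :: 'd list) p w z" "is_cycle p (XT X (- {0})) w" "is_bdry p X (chain_map p fst w)"
  shows "\<exists>z'. ResR X (enumd :: 'd list) p (chain_map p (\<lambda>z. (fst z, - snd z)) w) z' \<and>
     is_bdry (p - D) X (z' - frag_cmul dl0 z)"
proof -
  have "reflL UNIV u = - u" for u :: "real^'d" by (simp add: vec_eq_iff)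
  moreover have "UNIV \<subseteq> set (enumd :: 'd list)" by (simp add: enumd(1))
  moreover have "is_cycle p (XT X (Tn enumd)) w" using assms(2) by (simp add: Tn_enumd)
  ultimately show ?thesis
    using ResR_reflect_set[OF _ assms(1) enumd(2) _ _ assms(3), of UNIV]
    by (simp add: Suc_diff_card dl0_def)
qed

end

subsection \<open>Configuration spaces\<close>

definition CS :: "nat set \<Rightarrow> (nat \<Rightarrow> 'v::topological_space) topology" where
  "CS S = subtopology (product_topology (\<lambda>_. euclidean) S) {x. inj_on x S}"

lemma topspace_CS: "topspace (CS S) = {x \<in> extensional S. inj_on x S}"
  by (auto simp: CS_def PiE_def)

lemma continuous_map_CS:
  "continuous_map X (CS S) f \<longleftrightarrow> f ` topspace X \<subseteq> extensional S \<and>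
     (\<forall>a\<in>S. continuous_map X euclidean (\<lambda>x. f x a)) \<and> (\<forall>x\<in>topspace X. inj_on (f x) S)"
  by (auto simp: CS_def continuous_map_in_subtopology continuous_map_componentwise)

lemma continuous_map_CS_nth: "a \<in> S \<Longrightarrow> continuous_map (CS S) euclidean (\<lambda>x. x a)"
  using continuous_map_CS[of "CS S" S id] by (auto simp: topspace_CS)

lemma continuous_map_CS_restrict: "J \<subseteq> I \<Longrightarrow> continuous_map (CS I) (CS J) (\<lambda>x. restrict x J)"
  unfolding continuous_map_CS
  by (auto simp: topspace_CS inj_on_def intro: continuous_map_CS_nth)

lemma continuous_map_CS_diff:
  fixes a b :: nat
  assumes "a \<in> S" "b \<in> S"
  shows "continuous_map (CS S) euclidean (\<lambda>x. x a - (x b :: 'v::real_normed_vector))"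
  using assms by (intro continuous_map_diff continuous_map_CS_nth)

text \<open>The reversal makes the head of F the last coordinate, which is the one that
  \<open>tau\<close> strips first.\<close>

definition pi :: "edge list \<Rightarrow> (nat \<Rightarrow> 'v::real_normed_vector) \<Rightarrow> nat \<Rightarrow> 'v" where
  "pi F x = (\<lambda>t\<in>{..<length F}. x (fst (rev F ! t)) - x (snd (rev F ! t)))"

lemma valid_nth:
  assumes "valid S F" "t < length F"
  shows "fst (rev F ! t) \<in> S" "snd (rev F ! t) \<in> S" "fst (rev F ! t) \<noteq> snd (rev F ! t)"
proof -
  have "rev F ! t \<in> set F" using assms(2) nth_mem[of t "rev F"] by simp
  then show "fst (rev F ! t) \<in> S" "snd (rev F ! t) \<in> S" "fst (rev F ! t) \<noteq> snd (rev F ! t)"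
    using assms(1) by (auto simp: valid_def)
qed

lemma continuous_map_pi:
  assumes "valid S F"
  shows "continuous_map (CS S) (PA {..<length F}) (pi F :: _ \<Rightarrow> nat \<Rightarrow> real^'d::finite)"
  unfolding continuous_map_PA
proof (intro conjI ballI)
  fix t assume "t \<in> {..<length F}"
  then have t: "t < length F" by simp
  note v = valid_nth[OF assms t]
  show "continuous_map (CS S) euclidean (\<lambda>x. pi F x t :: real^'d)"
    using t v by (simp add: pi_def continuous_map_CS_diff)
  fix x :: "nat \<Rightarrow> real^'d" assume "x \<in> topspace (CS S)"
  then show "pi F x t \<noteq> 0"
    using t v by (auto simp: pi_def topspace_CS inj_on_def)
qed (auto simp: pi_def)

lemma pi_compose: "pi F (\<lambda>a. x (f a)) = pi (rl f F) x"
  by (auto simp: pi_def fun_eq_iff restrict_def rev_map)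

lemma pi_cong: "(\<And>a. a \<in> verts F \<Longrightarrow> x a = y a) \<Longrightarrow> pi F x = pi F y"
proof -
  assume a: "\<And>a. a \<in> verts F \<Longrightarrow> x a = y a"
  have "rev F ! t \<in> set F" if "t < length F" for t
    using that nth_mem[of t "rev F"] by simp
  then show ?thesis using a by (auto simp: pi_def fun_eq_iff restrict_def verts_def)
qed

lemma valid_verts: "valid S F \<Longrightarrow> verts F \<subseteq> S"
  by (auto simp: valid_def verts_def)

lemma spl_pi: "spl {..<length F} (length F) (pi (f # F) x) = (pi F x, x (fst f) - x (snd f))"
  by (auto simp: spl_def pi_def fun_eq_iff restrict_def nth_append)

lemma continuous_map_scaleR:
  fixes g :: "'a \<Rightarrow> 'b::real_normed_vector"
  shows "continuous_map X euclideanreal f \<Longrightarrow> continuous_map X euclidean g \<Longrightarrow> continuous_map X euclidean (\<lambda>x. f x *\<^sub>R g x)"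
  by (simp add: continuous_map_atin tendsto_scaleR)

definition qd :: "nat set \<Rightarrow> nat \<Rightarrow> nat \<Rightarrow> (nat \<Rightarrow> 'v) \<Rightarrow> (nat \<Rightarrow> 'v) \<times> 'v::real_normed_vector" where
  "qd S x b y = (restrict y S, y x - y b)"

lemma continuous_map_qd: "x \<notin> S \<Longrightarrow> b \<in> S \<Longrightarrow>
    continuous_map (CS (insert x S)) (XT (CS S) (- {0})) (qd S x b)"
  unfolding qd_def by (intro continuous_map_XTI continuous_map_CS_restrict continuous_map_CS_diff)
    (auto simp: topspace_CS inj_on_def)

text \<open>The new point has to avoid all points of S; these conditions are imposed one after the other, and
  the section given by \<open>far\<close> makes the connecting map of each Mayer--Vietoris sequence vanish.\<close>
lemma add_point_inj:
  fixes w :: "(nat \<Rightarrow> 'v::real_normed_vector) chain"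
  assumes S: "finite S" "x \<notin> S" and w: "is_cycle p (CS (insert x S)) w"
    and far: "continuous_map (CS S) euclidean far" "\<And>y b. y \<in> topspace (CS S) \<Longrightarrow> b \<in> S \<Longrightarrow> far y \<noteq> (y b :: 'v)"
    and fw: "is_bdry p (CS S) (chain_map p (\<lambda>y. restrict y S) w)"
    and qw: "\<And>b. b \<in> S \<Longrightarrow> is_bdry p (XT (CS S) (- {0})) (chain_map p (qd S x b) w)"
  shows "is_bdry p (CS (insert x S)) w"
proof -
  let ?X = "CS S :: (nat \<Rightarrow> 'v) topology"
  let ?P = "prod_topology ?X (euclidean :: 'v topology)"
  \<comment> \<open>Here the new point has to avoid the points of B only; induction on B leads from
    no condition to all of S.\<close>
  define U where "U B = {q \<in> topspace ?P. \<forall>b\<in>B. snd q - fst q b \<noteq> 0}" for B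
  let ?j = "\<lambda>y::nat \<Rightarrow> 'v. (restrict y S, y x)"
  have nth: "continuous_map ?P euclidean (\<lambda>q. snd q - fst q b)" if "b \<in> S" for b
    using continuous_map_compose[OF continuous_map_fst continuous_map_CS_nth[OF that]]
    by (intro continuous_map_diff continuous_map_snd) (simp add: o_def)
  have opU: "openin ?P (U B)" if "B \<subseteq> S" for B
  proof -
    have "openin ?P {q \<in> topspace ?P. snd q - fst q b \<in> - {0}}" if "b \<in> S" for b
      by (rule openin_continuous_map_preimage[OF nth[OF that]]) auto
    moreover have "finite B" using that S finite_subset by blast
    then have "finite B \<and> B \<subseteq> S" using that by blast
    ultimately show ?thesis
    proof (induction B rule: infinite_finite_induct)
      case empty
      have "U {} = topspace ?P" by (auto simp: U_def)
      then show ?case using openin_topspace[of ?P] by argo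
    next
      case (insert b B)
      have "U (insert b B) = {q \<in> topspace ?P. snd q - fst q b \<in> - {0}} \<inter> U B" by (auto simp: U_def)
      then show ?case using insert by auto
    qed (auto simp: U_def)
  qed
  have jc: "continuous_map (CS (insert x S)) (subtopology ?P (U B)) ?j" if "B \<subseteq> S" for B
    using S that by (auto simp: continuous_map_in_subtopology U_def topspace_CS inj_on_def
      intro!: continuous_map_pairedI continuous_map_CS_restrict continuous_map_CS_nth)
  have main: "is_bdry p (subtopology ?P (U B)) (chain_map p ?j w)" if "finite B" "B \<subseteq> S" for B
    using that
  proof (induction B)
    case empty
    have "U {} = topspace ?P" by (auto simp: U_def)
    then have Ue: "subtopology ?P (U {}) = XT ?X UNIV" by (simp only: subtopology_topspace subtopology_UNIV)
    have c: "is_cycle p (XT ?X UNIV) (chain_map p ?j w)"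
      unfolding Ue[symmetric] by (rule is_cycle_map[OF w jc]) auto
    have "is_bdry p (XT ?X UNIV) (chain_map p (\<lambda>x. (x, 0)) (chain_map p fst (chain_map p ?j w)))"
      using fw by (intro is_bdry_map[OF _ continuous_map_section]) (auto simp: chain_map_map)
    then show ?case unfolding Ue by (rule is_bdry_transfer[OF star_bdry[OF _ c], rotated]) auto
  next
    case (insert b B)
    have bS: "b \<in> S" and BS: "B \<subseteq> S" using insert.prems by auto
    \<comment> \<open>The points of a configuration are distinct, so a vector equal to the point b
      avoids all points of B.\<close>
    have un: "topspace ?P \<subseteq> U B \<union> U {b}"
    proof
      fix q assume q: "q \<in> topspace ?P"
      then have inj: "inj_on (fst q) S" by (auto simp: topspace_CS)
      show "q \<in> U B \<union> U {b}"
      proof (cases "snd q = fst q b")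
        case True
        have "snd q - fst q c \<noteq> 0" if "c \<in> B" for c
          using True inj_onD[OF inj, of b c] that BS bS insert.hyps(2) by auto
        then show ?thesis using q unfolding U_def by blast
      next
        case False
        then show ?thesis using q unfolding U_def by auto
      qed
    qed
    \<comment> \<open>The product with the whole vector space deforms onto the graph of
      \<open>far\<close>, which avoids b, so every cycle can be moved into
      \<open>U {b}\<close>.\<close>
    have onto: "\<exists>v. is_cycle (Suc p) (subtopology ?P (U {b})) v \<and> is_bdry (Suc p) ?P (z - v)" if z: "is_cycle (Suc p) ?P z" for z
    proof -
      let ?s = "\<lambda>y. (y, far y)"
      have s: "continuous_map ?X (subtopology ?P (U {b})) ?s"
        using far bS by (auto simp: continuous_map_in_subtopology U_def id_def[symmetric] intro!: continuous_map_pairedI)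
      have z': "is_cycle (Suc p) (XT ?X UNIV) z" using z by simp
      have "homotopic_with (\<lambda>_. True) ?P (XT ?X UNIV) (\<lambda>z. (fst z, snd z)) (\<lambda>z. (fst z, far (fst z)))"
        using continuous_map_compose[OF continuous_map_fst far(1)]
        by (intro homotopic_XT_segment continuous_map_fst continuous_map_snd) (auto simp: o_def)
      from homotopic_bdry[OF this z]
      have "is_bdry (Suc p) ?P (chain_map (Suc p) (\<lambda>z. (fst z, snd z)) z - chain_map (Suc p) (\<lambda>z. (fst z, far (fst z))) z)"
        by simp
      moreover have "chain_map (Suc p) (\<lambda>z. (fst z, snd z)) z = z"
        using z by (intro chain_map_id_gen[where X = ?P]) (auto simp: singular_cycle)
      moreover have "chain_map (Suc p) (\<lambda>z. (fst z, far (fst z))) z = chain_map (Suc p) ?s (chain_map (Suc p) fst z)"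
        by (simp add: chain_map_map)
      ultimately show ?thesis
        using is_cycle_map[OF is_cycle_map[OF z continuous_map_fst] s] by auto
    qed
    have "is_bdry p (subtopology ?P (U {b})) (chain_map p ?j w)"
    proof -
      let ?k = "\<lambda>q::(nat \<Rightarrow> 'v) \<times> 'v. (fst q, snd q + fst q b)"
      have "continuous_map (XT ?X (- {0})) (subtopology ?P (U {b})) ?k"
        using continuous_map_compose[OF continuous_map_fst continuous_map_CS_nth[OF bS]]
        by (auto simp: continuous_map_in_subtopology U_def o_def
          intro!: continuous_map_pairedI continuous_map_fst continuous_map_add continuous_map_XT_snd)
      from is_bdry_map[OF qw[OF bS] this]
      have "is_bdry p (subtopology ?P (U {b})) (chain_map p (\<lambda>y. ?k (qd S x b y)) w)"
        by (simp only: chain_map_map)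
      moreover have "(\<lambda>y. ?k (qd S x b y)) = ?j"
        using bS by (auto simp: qd_def fun_eq_iff)
      ultimately show ?thesis by simp
    qed
    moreover have "openin ?P (U {b})" using bS by (intro opU) auto
    ultimately have "is_bdry p (subtopology ?P (U B \<inter> U {b})) (chain_map p ?j w)"
      by (intro mayer_vietoris_inj[OF opU[OF BS] _ un insert.IH[OF BS] _ onto])
    moreover have "U B \<inter> U {b} = U (insert b B)" by (auto simp: U_def)
    ultimately show ?case by (simp only:)
  qed
  have "continuous_map (subtopology ?P (U S)) (CS (insert x S)) (\<lambda>q. \<lambda>a\<in>insert x S. if a = x then snd q else fst q a)"
    unfolding continuous_map_CS
  proof (intro conjI ballI)
    fix a assume "a \<in> insert x S"
    then show "continuous_map (subtopology ?P (U S)) euclidean (\<lambda>q. (\<lambda>a\<in>insert x S. if a = x then snd q else fst q a) a)"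
      using continuous_map_compose[OF continuous_map_subtopology_fst continuous_map_CS_nth[of a S]]
      by (cases "a = x") (auto simp: o_def continuous_map_subtopology_snd)
  qed (use S(2) in \<open>auto simp: U_def topspace_CS inj_on_def\<close>)
  from is_bdry_map[OF main[OF S(1) subset_refl] this]
  have "is_bdry p (CS (insert x S)) (chain_map p (\<lambda>y. \<lambda>a\<in>insert x S. if a = x then y x else restrict y S a) w)"
    by (simp only: chain_map_map fst_conv snd_conv)
  moreover have "chain_map p (\<lambda>y. \<lambda>a\<in>insert x S. if a = x then y x else restrict y S a) w = w"
    using w by (intro chain_map_id_gen[where X = "CS (insert x S)"])
      (auto simp: singular_cycle topspace_CS extensional_def fun_eq_iff)
  ultimately show ?thesis by simp
qed

subsection \<open>Monomials and the planetary operation\<close>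

text \<open>A position beyond all points of y that depends continuously on y; the axis, given by
  \<open>undefined\<close>, is arbitrary but fixed.\<close>

definition farp :: "nat set \<Rightarrow> (nat \<Rightarrow> real^'d::finite) \<Rightarrow> real^'d" where
  "farp S y = (1 + (\<Sum>a\<in>S. norm (y a))) *\<^sub>R axis undefined 1"

lemma continuous_map_farp: "finite S \<Longrightarrow> continuous_map (CS S) euclidean (farp S)"
  unfolding farp_def
  by (intro continuous_map_scaleR continuous_map_add continuous_map_sum continuous_map_norm continuous_map_CS_nth) auto

text \<open>Otherwise (1 - t) y c would be a vector of length (1 - t)(1 + m) + t, where m is at
  least the norm of y c. Hence the direction towards the far point can be deformed to a constant
  one.\<close>

lemma farp_segment:
  assumes "finite S" "c \<in> S" "0 \<le> t" "t \<le> 1"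
  shows "(1 - t) *\<^sub>R (farp S y - y c) + t *\<^sub>R axis undefined 1 \<noteq> (0 :: real^'d::finite)"
proof
  let ?e = "axis undefined 1 :: real^'d"
  define m where "m = (\<Sum>a\<in>S. norm (y a))"
  assume "(1 - t) *\<^sub>R (farp S y - y c) + t *\<^sub>R ?e = 0"
  then have "((1 - t) * (1 + m) + t) *\<^sub>R ?e = (1 - t) *\<^sub>R y c"
    by (simp add: farp_def m_def[symmetric] algebra_simps)
  then have "\<bar>(1 - t) * (1 + m) + t\<bar> * norm ?e = \<bar>1 - t\<bar> * norm (y c)"
    by (metis norm_scaleR)
  moreover have c: "norm (y c) \<le> m" unfolding m_def using assms by (intro member_le_sum) auto
  moreover have "0 \<le> m" unfolding m_def by (simp add: sum_nonneg)
  ultimately have "(1 - t) * (1 + m) + t = (1 - t) * norm (y c)"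
    using assms by (simp add: abs_of_nonneg)
  moreover have "(1 - t) * norm (y c) \<le> (1 - t) * m" using c assms by (intro mult_left_mono) auto
  ultimately show False using assms by (simp add: algebra_simps)
qed

lemma farp_ne: "finite S \<Longrightarrow> c \<in> S \<Longrightarrow> farp S y \<noteq> y c"
  using farp_segment[of S c 0 y] by auto

lemma inj_on_extend:
  assumes "inj_on y S" "x \<notin> S" "\<And>a. a \<in> S \<Longrightarrow> v \<noteq> y a"
  shows "inj_on (\<lambda>a\<in>insert x S. if a = x then v else y a) (insert x S)"
proof -
  let ?f = "\<lambda>a\<in>insert x S. if a = x then v else y a"
  have f: "?f a = y a" if "a \<in> S" for a using that assms(2) by auto
  have "inj_on ?f S" using assms(1) f inj_on_cong[of S ?f y] by blast
  moreover have "?f x \<notin> ?f ` (S - {x})" using f assms(3) by fastforce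
  ultimately show ?thesis by (simp only: inj_on_insert simp_thms)
qed

definition secp :: "nat set \<Rightarrow> nat \<Rightarrow> (nat \<Rightarrow> real^'d::finite) \<Rightarrow> nat \<Rightarrow> real^'d" where
  "secp S x y = (\<lambda>a\<in>insert x S. if a = x then farp S y else y a)"

lemma continuous_map_secp:
  assumes "finite S" "x \<notin> S" shows "continuous_map (CS S) (CS (insert x S)) (secp S x)"
  unfolding continuous_map_CS
proof (intro conjI ballI)
  fix a assume "a \<in> insert x S"
  then show "continuous_map (CS S) euclidean (\<lambda>y. secp S x y a)"
    using continuous_map_farp[OF assms(1)] assms by (cases "a = x") (auto simp: secp_def continuous_map_CS_nth)
next
  fix y :: "nat \<Rightarrow> real^'b" assume "y \<in> topspace (CS S)"
  then show "inj_on (secp S x y) (insert x S)"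
    using assms farp_ne[OF assms(1), of _ y] unfolding secp_def
    by (intro inj_on_extend) (auto simp: topspace_CS)
qed (auto simp: secp_def)

text \<open>A continuous substitute for the distance from b to its nearest neighbour: the sum of
  reciprocals dominates each of them, and the summand 1 covers the case of no neighbour.\<close>

definition rad :: "nat set \<Rightarrow> nat \<Rightarrow> (nat \<Rightarrow> real^'d::finite) \<Rightarrow> real" where
  "rad S b y = 1 / (1 + (\<Sum>a\<in>S - {b}. 1 / norm (y a - y b)))"

lemma rad_pos: "0 < rad S b y"
  unfolding rad_def by (intro divide_pos_pos add_pos_nonneg sum_nonneg) auto

lemma rad_less:
  assumes "finite S" "a \<in> S" "a \<noteq> b" "y a \<noteq> y b"
  shows "rad S b y < norm (y a - y b)"
proof -
  define s where "s = (\<Sum>a\<in>S - {b}. 1 / norm (y a - y b))"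
  define n where "n = norm (y a - y b)"
  have n: "0 < n" using assms by (simp add: n_def)
  have "1 / n \<le> s" unfolding s_def n_def using assms by (intro member_le_sum) auto
  then have "1 / n < 1 + s" by linarith
  then have "1 < (1 + s) * n" using n by (simp add: pos_divide_less_eq)
  moreover have "0 \<le> s" unfolding s_def by (simp add: sum_nonneg)
  ultimately have "1 / (1 + s) < n" by (simp add: pos_divide_less_eq mult.commute)
  then show ?thesis unfolding rad_def s_def n_def .
qed

lemma continuous_map_rad: "finite S \<Longrightarrow> b \<in> S \<Longrightarrow> continuous_map (CS S) euclideanreal (rad S b)"
  unfolding rad_def
proof (intro continuous_map_real_divide continuous_map_add continuous_map_sum continuous_map_norm continuous_map_CS_diff)
  fix x :: "nat \<Rightarrow> real^'a"
  show "1 + (\<Sum>a\<in>S - {b}. 1 / norm (x a - x b)) \<noteq> 0"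
    using add_pos_nonneg[OF zero_less_one sum_nonneg[of "S - {b}" "\<lambda>a. 1 / norm (x a - x b)"]] by simp
qed (auto simp: topspace_CS inj_on_def)

text \<open>The planetary map: x circles around b in the direction of the second component, closer to b than
  all other points.\<close>
definition plan :: "nat set \<Rightarrow> nat \<Rightarrow> nat \<Rightarrow> (nat \<Rightarrow> real^'d::finite) \<times> (real^'d) \<Rightarrow> nat \<Rightarrow> real^'d" where
  "plan S x b p = (\<lambda>a\<in>insert x S. if a = x then fst p b + (rad S b (fst p) / (1 + norm (snd p))) *\<^sub>R snd p else fst p a)"

text \<open>The quotient of \<open>norm u\<close> by \<open>1 + norm u\<close> stays below 1, so x
  remains within \<open>rad\<close> of b for every length of u.\<close>

lemma plan_small:
  fixes u :: "real^'d::finite"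
  assumes "finite S" "a \<in> S" "a \<noteq> b" "y a \<noteq> y b" "0 \<le> t" "t \<le> 1"
  shows "norm (t *\<^sub>R (rad S b y / (1 + norm u)) *\<^sub>R u) < norm (y a - y b)"
proof -
  have "norm (t *\<^sub>R (rad S b y / (1 + norm u)) *\<^sub>R u) = t * (rad S b y * (norm u / (1 + norm u)))"
    using assms rad_pos[of S b y] by (simp add: abs_of_pos add_pos_nonneg)
  also have "\<dots> \<le> 1 * (rad S b y * 1)"
    using assms rad_pos[of S b y] by (intro mult_mono) (auto simp: divide_le_eq add_pos_nonneg)
  finally show ?thesis using rad_less[OF assms(1-4)] by simp
qed

lemma continuous_map_plan:
  assumes "finite S" "x \<notin> S" "b \<in> S"
  shows "continuous_map (XT (CS S) (- {0})) (CS (insert x S)) (plan S x b)"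
  unfolding continuous_map_CS
proof (intro conjI ballI)
  fix a assume a: "a \<in> insert x S"
  let ?X = "XT (CS S :: (nat \<Rightarrow> real^'b) topology) (- {0})"
  have nth: "continuous_map ?X euclidean (\<lambda>p. fst p c)" if "c \<in> S" for c
    using continuous_map_compose[OF continuous_map_fst continuous_map_CS_nth[OF that]] by (simp add: o_def)
  have "continuous_map ?X euclideanreal (\<lambda>p. rad S b (fst p))"
    using continuous_map_compose[OF continuous_map_fst continuous_map_rad[OF assms(1,3)]] by (simp add: o_def)
  then have "continuous_map ?X euclidean (\<lambda>p. fst p b + (rad S b (fst p) / (1 + norm (snd p))) *\<^sub>R snd p)"
    by (intro continuous_map_add continuous_map_scaleR continuous_map_real_divide continuous_map_norm nth assms
        continuous_map_XT_snd) (auto simp: add_nonneg_eq_0_iff)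
  then show "continuous_map ?X euclidean (\<lambda>p. plan S x b p a)"
    using a nth assms by (cases "a = x") (auto simp: plan_def)
next
  fix p :: "(nat \<Rightarrow> real^'b) \<times> (real^'b)" assume p: "p \<in> topspace (XT (CS S) (- {0}))"
  have ne: "fst p b + (rad S b (fst p) / (1 + norm (snd p))) *\<^sub>R snd p \<noteq> fst p a" if a: "a \<in> S" for a
  proof (cases "a = b")
    case True
    then show ?thesis using p rad_pos[of S b "fst p"] by (auto simp: add_nonneg_eq_0_iff)
  next
    case False
    have "inj_on (fst p) S" using p by (auto simp: topspace_CS)
    then have "fst p a \<noteq> fst p b" using a assms(3) False by (metis inj_on_contraD)
    from plan_small[OF assms(1) a False this, of 1 "snd p"]
    have "norm ((rad S b (fst p) / (1 + norm (snd p))) *\<^sub>R snd p) < norm (fst p a - fst p b)" by simp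
    moreover have "(rad S b (fst p) / (1 + norm (snd p))) *\<^sub>R snd p = fst p a - fst p b"
      if "fst p b + (rad S b (fst p) / (1 + norm (snd p))) *\<^sub>R snd p = fst p a"
      using that by (metis add_diff_cancel_left')
    ultimately show ?thesis by (metis less_irrefl)
  qed
  have "inj_on (fst p) S" using p by (auto simp: topspace_CS)
  then show "inj_on (plan S x b p) (insert x S)"
    unfolding plan_def using assms(2) ne by (intro inj_on_extend) auto
qed (auto simp: plan_def)

context punctured
begin

text \<open>The monomial of the classes of the edges of F, evaluated on a cycle.\<close>
definition mon :: "edge list \<Rightarrow> (nat \<Rightarrow> real^'d) chain \<Rightarrow> int" where
  "mon F w = tau (length F) (chain_map (length F * D) (pi F) w)"

abbreviation CSd :: "nat set \<Rightarrow> (nat \<Rightarrow> real^'d) topology" where "CSd S \<equiv> CS S"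

lemma mon_cycle: "valid S F \<Longrightarrow> is_cycle (length F * D) (CSd S) w \<Longrightarrow>
    is_cycle (length F * D) (PAn (length F)) (chain_map (length F * D) (pi F) w)"
  by (rule is_cycle_map[OF _ continuous_map_pi])

lemma mon_diff: "valid S F \<Longrightarrow> is_cycle (length F * D) (CSd S) w \<Longrightarrow> is_cycle (length F * D) (CSd S) w' \<Longrightarrow>
    mon F (w - w') = mon F w - mon F w'"
  by (simp add: mon_def chain_map_diff tau_diff mon_cycle)

lemma mon_add: "valid S F \<Longrightarrow> is_cycle (length F * D) (CSd S) w \<Longrightarrow> is_cycle (length F * D) (CSd S) w' \<Longrightarrow>
    mon F (w + w') = mon F w + mon F w'"
  by (simp add: mon_def chain_map_add tau_add mon_cycle)

lemma mon_cmul: "valid S F \<Longrightarrow> is_cycle (length F * D) (CSd S) w \<Longrightarrow> mon F (frag_cmul k w) = k * mon F w"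
  by (simp add: mon_def tau_cmul mon_cycle)

lemma mon_bdry: "valid S F \<Longrightarrow> is_bdry (length F * D) (CSd S) w \<Longrightarrow> mon F w = 0"
  unfolding mon_def by (rule tau_bdry, rule is_bdry_map[OF _ continuous_map_pi])

lemma mon_sum:
  assumes "valid S F" "finite B" "\<And>b. b \<in> B \<Longrightarrow> is_cycle (length F * D) (CSd S) (w b)"
  shows "mon F (\<Sum>b\<in>B. w b) = (\<Sum>b\<in>B. mon F (w b))"
  using assms(2,3)
proof (induction B)
  case empty
  show ?case using mon_bdry[OF assms(1), of 0] by simp
next
  case (insert b B)
  then show ?case by (simp add: mon_add[OF assms(1)] singular_relcycle_sum)
qed

lemma mon_rl:
  assumes "f permutes S"
  shows "mon F (chain_map (length F * D) (\<lambda>x. x \<circ> f) w) = mon (rl f F) w"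
  by (simp add: mon_def chain_map_map o_def pi_compose)

lemma mon_restrict:
  assumes "valid S F"
  shows "mon F (chain_map (length F * D) (\<lambda>y. restrict y S) w) = mon F w"
proof -
  have "pi F (restrict y S) = pi F y" for y :: "nat \<Rightarrow> real^'d"
    using valid_verts[OF assms] by (intro pi_cong) auto
  then show ?thesis by (simp add: mon_def chain_map_map)
qed

text \<open>The head edge is the coordinate stripped first by \<open>tau\<close> and also the second
  component of \<open>qd\<close>; the two residues correspond by naturality along
  \<open>pi F\<close>.\<close>

lemma mon_Cons:
  assumes "valid S F" "x \<notin> S" "b \<in> S" and w: "is_cycle (Suc (length F) * D) (CSd (insert x S)) w"
    and z: "ResR (CSd S) (enumd :: 'd list) (Suc (length F) * D) (chain_map (Suc (length F) * D) (qd S x b) w) z"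
  shows "mon ((x, b) # F) w = mon F z"
proof -
  let ?i = "length F" let ?p = "Suc ?i * D"
  have v: "valid (insert x S) ((x, b) # F)" using assms by (auto simp: valid_def)
  have c: "is_cycle ?p (PAn (Suc ?i)) (chain_map ?p (pi ((x,b) # F)) w)"
    using mon_cycle[OF v] w by simp
  have "pi F (restrict y S) = pi F y" for y :: "nat \<Rightarrow> real^'d"
    using valid_verts[OF assms(1)] by (intro pi_cong) auto
  then have "spl {..<?i} ?i (pi ((x,b) # F) y) = (\<lambda>z. (pi F (fst z), snd z)) (qd S x b y)" for y :: "nat \<Rightarrow> real^'d"
    using spl_pi[of F "(x,b)" y] by (simp add: qd_def)
  then have "chain_map ?p (spl {..<?i} ?i) (chain_map ?p (pi ((x,b) # F)) w) =
     chain_map ?p (\<lambda>z. (pi F (fst z), snd z)) (chain_map ?p (qd S x b) w)"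
    by (simp add: chain_map_map)
  then have "ResR (PAn ?i) (enumd :: 'd list) ?p (chain_map ?p (spl {..<?i} ?i) (chain_map ?p (pi ((x,b) # F)) w))
     (chain_map (?i * D) (pi F) z)"
    using ResR_map[OF z continuous_map_pi[OF assms(1)]] by (simp add: Suc_diff_card)
  from tau_Suc_ResR[OF c this] show ?thesis by (simp add: mon_def del: tau_Suc)
qed

text \<open>Through \<open>punctured_inj\<close> the conditions of \<open>add_point_inj\<close>
  become conditions on residues. All degrees are multiples of D, so the gap between 0 and D does not
  arise.\<close>

lemma add_point_inj':
  assumes S: "finite S" "x \<notin> S" and w: "is_cycle (i * D) (CSd (insert x S)) w"
    and r: "is_bdry (i * D) (CSd S) (chain_map (i * D) (\<lambda>y. restrict y S) w)"
    and q: "\<And>j b. i = Suc j \<Longrightarrow> b \<in> S \<Longrightarrow>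
       is_bdry (j * D) (CSd S) (resc (CSd S) (i * D) (chain_map (i * D) (qd S x b) w))"
  shows "is_bdry (i * D) (CSd (insert x S)) w"
proof (rule add_point_inj[OF S w continuous_map_farp[OF S(1)] farp_ne[OF S(1)] r])
  fix b assume b: "b \<in> S"
  show "is_bdry (i * D) (XT (CSd S) (- {0})) (chain_map (i * D) (qd S x b) w)"
  proof (rule punctured_inj)
    show "is_cycle (i * D) (XT (CSd S) (- {0})) (chain_map (i * D) (qd S x b) w)"
      by (rule is_cycle_map[OF w continuous_map_qd[OF S(2) b]])
    show "is_bdry (i * D) (CSd S) (chain_map (i * D) fst (chain_map (i * D) (qd S x b) w))"
      using r by (simp add: chain_map_map qd_def)
    show "is_bdry (i * D - D) (CSd S) (resc (CSd S) (i * D) (chain_map (i * D) (qd S x b) w))" if "D \<le> i * D"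
      using that q[OF _ b] D_pos by (cases i) auto
    show "i * D = 0 \<or> D \<le> i * D" by (cases i) auto
  qed
qed

lemma topspace_CS_empty: "topspace (CS {}) = {\<lambda>_. undefined}"
  by (auto simp: topspace_CS)

lemma resc_qd:
  assumes "x \<notin> S" "b \<in> S" "is_cycle (Suc j * D) (CSd (insert x S)) w"
  shows "ResR (CSd S) (enumd :: 'd list) (Suc j * D) (chain_map (Suc j * D) (qd S x b) w)
       (resc (CSd S) (Suc j * D) (chain_map (Suc j * D) (qd S x b) w))"
    "is_cycle (j * D) (CSd S) (resc (CSd S) (Suc j * D) (chain_map (Suc j * D) (qd S x b) w))"
  using ResR_resc[OF is_cycle_map[OF assms(3) continuous_map_qd[OF assms(1,2)]]] by auto

text \<open>The restriction of w to S is tested by the monomials without x and, through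
  \<open>mon_Cons\<close>, its residue along b by those with head (x, b).\<close>

lemma separation_insert:
  assumes S: "finite S" "x \<notin> S" and w: "is_cycle (i * D) (CSd (insert x S)) w"
    and IH: "\<And>i w. is_cycle (i * D) (CSd S) w \<Longrightarrow> (\<And>F. valid S F \<Longrightarrow> length F = i \<Longrightarrow> mon F w = 0) \<Longrightarrow> is_bdry (i * D) (CSd S) w"
    and 1: "\<And>F. valid S F \<Longrightarrow> length F = i \<Longrightarrow> mon F w = 0"
    and 2: "\<And>F b. valid S F \<Longrightarrow> i = Suc (length F) \<Longrightarrow> b \<in> S \<Longrightarrow> mon ((x, b) # F) w = 0"
  shows "is_bdry (i * D) (CSd (insert x S)) w"
proof (rule add_point_inj'[OF S w])
  show "is_bdry (i * D) (CSd S) (chain_map (i * D) (\<lambda>y. restrict y S) w)"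
    using 1 mon_restrict by (intro IH is_cycle_map[OF w] continuous_map_CS_restrict) auto
next
  fix j b assume j: "i = Suc j" and b: "b \<in> S"
  show "is_bdry (j * D) (CSd S) (resc (CSd S) (i * D) (chain_map (i * D) (qd S x b) w))"
  proof (rule IH)
    show "is_cycle (j * D) (CSd S) (resc (CSd S) (i * D) (chain_map (i * D) (qd S x b) w))"
      using resc_qd(2)[OF S(2) b] w j by simp
    fix F assume F: "valid S F" "length F = j"
    show "mon F (resc (CSd S) (i * D) (chain_map (i * D) (qd S x b) w)) = 0"
      using mon_Cons[OF F(1) S(2) b] 2[OF F(1) _ b] resc_qd(1)[OF S(2) b] w j F(2) by metis
  qed
qed

theorem separation:
  "finite S \<Longrightarrow> is_cycle (i * D) (CSd S) w \<Longrightarrow> (\<And>F. valid S F \<Longrightarrow> length F = i \<Longrightarrow> mon F w = 0) \<Longrightarrow>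
    is_bdry (i * D) (CSd S) w"
proof (induction S arbitrary: i w rule: finite_induct)
  case empty
  show ?case
  proof (cases "i = 0")
    case True
    have "singular_chain 0 (CSd {}) w" using empty True by (simp add: is_cycle_0)
    then obtain b where w: "w = frag_cmul b (frag_of pt0)"
      using singular_chain_singleton[OF topspace_CS_empty, of 0 w] by (auto simp: pt0_def)
    have "simplex_map 0 (pi []) (pt0 :: _ \<Rightarrow> nat \<Rightarrow> real^'d) = pt0"
      by (auto simp: simplex_map_def pt0_def pi_def fun_eq_iff restrict_def)
    then have "mon [] w = b" by (simp add: mon_def w)
    then have "w = 0" using empty(2)[of "[]"] True w by (simp add: valid_def)
    then show ?thesis by simp
  next
    case False
    then show ?thesis
      using singular_boundary_eq_cycle_singleton[OF topspace_CS_empty, of "i * D" w] empty(1) D_pos by simp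
  qed
next
  case (insert x S)
  show ?case
  proof (rule separation_insert[OF insert.hyps insert.prems(1) insert.IH])
    show "mon F w = 0" if "valid S F" "length F = i" for F
      using that insert.prems(2)[of F] by (auto simp: valid_def)
    show "mon ((x, b) # F) w = 0" if "valid S F" "i = Suc (length F)" "b \<in> S" for F b
      using that insert.prems(2)[of "(x,b) # F"] insert.hyps by (auto simp: valid_def)
  qed
qed

end

section \<open>Monomials on classes with a far-away or a circling point\<close>

lemma del_op_zero_wt: "(\<And>f. f \<in> set F \<Longrightarrow> om f = 0) \<Longrightarrow> del_op eps om g F = 0"
  by (induction F arbitrary: g) auto

lemma del_op_single:
  "(\<And>h. h \<in> set L \<union> set M \<Longrightarrow> om h = 0) \<Longrightarrow> del_op eps om g (L @ f # M) = eps ^ length L * om f * g (L @ M)"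
  by (induction L arbitrary: g) (auto simp: del_op_zero_wt)

lemma valid_Nil [simp]: "valid S []"
  and valid_Cons [simp]: "valid S (f # F) \<longleftrightarrow> fst f \<noteq> snd f \<and> fst f \<in> S \<and> snd f \<in> S \<and> valid S F"
  and valid_append [simp]: "valid S (F @ G) \<longleftrightarrow> valid S F \<and> valid S G"
  by (auto simp: valid_def)

lemma valid_rl_sbvD: "valid S (rl (sbv x b) R) \<Longrightarrow> valid (insert x S) R"
  by (induction R) (auto simp: sbv_def split: if_splits)

lemma valid_rl_sbv: "valid (insert x S) R \<Longrightarrow> \<forall>g\<in>set R. g \<noteq> (x, b) \<and> g \<noteq> (b, x) \<Longrightarrow> b \<in> S \<Longrightarrow>
    valid S (rl (sbv x b) R)"
proof (induction R)
  case (Cons g R)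
  obtain u v where g: "g = (u, v)" by force
  have "u \<noteq> v" "u = x \<or> u \<in> S" "v = x \<or> v \<in> S" "\<not> (u = x \<and> v = b)" "\<not> (u = b \<and> v = x)"
    using Cons.prems(1,2) by (simp_all add: g)
  then have "sbv x b u \<noteq> sbv x b v \<and> sbv x b u \<in> S \<and> sbv x b v \<in> S"
    using Cons.prems(3) unfolding sbv_def by (cases "u = x"; cases "v = x") simp_all
  then show ?case using Cons by (simp add: g)
qed simp

lemma contr_valid:
  assumes "contr dl eps x b e F \<noteq> 0" "\<And>G. e G \<noteq> 0 \<Longrightarrow> valid S G \<and> length G = j" "b \<in> S" "x \<notin> S"
  shows "valid (insert x S) F \<and> length F = Suc j"
proof -
  obtain s where s: "s < length F" "wt dl x b (F ! s) * eps ^ s * e (rl (sbv x b) (take s F @ drop (Suc s) F)) \<noteq> 0"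
    using assms(1) unfolding contr_sum by (metis (no_types, lifting) lessThan_iff sum.neutral)
  then have f: "F ! s = (x, b) \<or> F ! s = (b, x)" and e: "e (rl (sbv x b) (take s F @ drop (Suc s) F)) \<noteq> 0"
    by (auto simp: wt_def split: if_splits)
  let ?R = "take s F @ drop (Suc s) F"
  have v: "valid S (rl (sbv x b) ?R)" "length (rl (sbv x b) ?R) = j" using assms(2)[OF e] by auto
  have F: "F = take s F @ F ! s # drop (Suc s) F" using s(1) by (rule id_take_nth_drop)
  have "valid (insert x S) ?R" by (rule valid_rl_sbvD[OF v(1)])
  moreover have "valid (insert x S) [F ! s]" using f assms(3,4) by auto
  ultimately have "valid (insert x S) F" by (subst F) simp
  moreover have "length F = Suc j" using v(2) s(1) by simp
  ultimately show ?thesis by simp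
qed

context punctured
begin

text \<open>Coordinate t is a function of the others, so the map factors through a product with one
  factor less.\<close>

lemma tau_coordinate_zero:
  assumes h: "continuous_map X (PAn i) h" and t: "t < i"
    and k: "continuous_map (PA ({..<i} - {t})) euclidean k" "\<And>v. v \<in> topspace (PA ({..<i} - {t})) \<Longrightarrow> k v \<noteq> (0 :: real^'d)"
    and hk: "\<And>x. x \<in> topspace X \<Longrightarrow> h x t = k (restrict (h x) ({..<i} - {t}))"
    and w: "is_cycle (i * D) X w"
  shows "tau i (chain_map (i * D) h w) = 0"
proof -
  let ?f = "\<lambda>x. restrict (h x) ({..<i} - {t})"
  let ?g = "\<lambda>v. \<lambda>s\<in>{..<i}. if s = t then k v else v s"
  have f: "continuous_map X (PA ({..<i} - {t})) ?f"
    using continuous_map_compose[OF h continuous_map_PA_restrict[of "{..<i} - {t}"]] by (auto simp: o_def)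
  have g: "continuous_map (PA ({..<i} - {t})) (PAn i) ?g"
    unfolding continuous_map_PA
  proof (intro conjI ballI)
    fix s assume "s \<in> {..<i}"
    then show "continuous_map (PA ({..<i} - {t})) euclidean (\<lambda>v. ?g v s)"
      using k(1) by (cases "s = t") (auto intro: continuous_map_PA_nth)
    fix v :: "nat \<Rightarrow> real^'d" assume "v \<in> topspace (PA ({..<i} - {t}))"
    then show "?g v s \<noteq> 0" using k(2) \<open>s \<in> {..<i}\<close> by (auto simp: topspace_PA PiE_def Pi_def)
  qed auto
  have "chain_map (i * D) h w = chain_map (i * D) (\<lambda>x. ?g (?f x)) w"
  proof (rule chain_map_eq)
    show "singular_chain (i * D) X w" using w by (simp add: singular_cycle)
    fix x assume x: "x \<in> topspace X"
    then have "h x \<in> extensional {..<i}" using h by (auto simp: continuous_map_PA)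
    then show "h x = ?g (?f x)" using hk[OF x] by (auto simp: fun_eq_iff extensional_def)
  qed
  moreover have "tau i (chain_map (i * D) (\<lambda>x. ?g (?f x)) w) = 0"
    using t by (intro tau_factor_zero[OF _ _ f g w]) auto
  ultimately show ?thesis by simp
qed

lemma tau_homotopic:
  assumes "homotopic_with (\<lambda>_. True) X (PAn i) f g" "is_cycle (i * D) X w"
  shows "tau i (chain_map (i * D) f w) = tau i (chain_map (i * D) g w)"
  using assms homotopic_bdry[OF assms] homotopic_with_imp_continuous_maps[OF assms(1)]
  by (blast intro: tau_cong is_cycle_map)

lemma segment_self: "(1 - t) *\<^sub>R v + t *\<^sub>R v = (v :: real^'d)"
  by (simp flip: scaleR_left_distrib)

text \<open>An edge at the distant point x can be deformed to a constant direction without passing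
  through zero, and a constant coordinate makes the degree zero.\<close>

lemma mon_secp:
  assumes S: "finite S" "x \<notin> S" and F: "valid (insert x S) F" and z: "is_cycle (length F * D) (CSd S) z"
  shows "mon F (chain_map (length F * D) (secp S x) z) = (if x \<in> verts F then 0 else mon F z)"
proof (cases "x \<in> verts F")
  case False
  then have "verts F \<subseteq> S" using valid_verts[OF F] by auto
  then have "pi F (secp S x y) = pi F y" for y :: "nat \<Rightarrow> real^'d"
    using S by (intro pi_cong) (auto simp: secp_def)
  then show ?thesis using False by (simp add: mon_def chain_map_map)
next
  case True
  let ?i = "length F"
  obtain f where f: "f \<in> set F" "x = fst f \<or> x = snd f" using True by (auto simp: verts_def)
  then obtain t where t: "t < ?i" "rev F ! t = f" by (metis in_set_conv_nth length_rev set_rev)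
  note v = valid_nth[OF F t(1), unfolded t(2)]
  define c where "c = (if x = fst f then snd f else fst f)"
  define s :: real where "s = (if x = fst f then 1 else -1)"
  have c: "c \<in> S" using v f(2) by (auto simp: c_def)
  let ?h = "\<lambda>y :: nat \<Rightarrow> real^'d. pi F (secp S x y)"
  let ?e = "axis undefined 1 :: real^'d"
  let ?g = "\<lambda>y. \<lambda>k\<in>{..<?i}. if k = t then s *\<^sub>R ?e else ?h y k"
  have h: "continuous_map (CSd S) (PAn ?i) ?h"
    using continuous_map_compose[OF continuous_map_secp[OF S] continuous_map_pi[OF F]] by (simp add: o_def)
  have s: "s \<noteq> 0" by (simp add: s_def)
  have g: "continuous_map (CSd S) (PAn ?i) ?g"
    unfolding continuous_map_PA
  proof (intro conjI ballI)
    fix k assume "k \<in> {..<?i}"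
    then show "continuous_map (CSd S) euclidean (\<lambda>y. ?g y k)"
      using h by (cases "k = t") (auto simp: continuous_map_PA)
    fix y :: "nat \<Rightarrow> real^'d" assume "y \<in> topspace (CSd S)"
    then show "?g y k \<noteq> 0" using h \<open>k \<in> {..<?i}\<close> s by (auto simp: continuous_map_PA)
  qed auto
  have ht: "?h y t = s *\<^sub>R (farp S y - y c)" for y
    using t v f(2) c S(2) by (auto simp: pi_def secp_def c_def s_def)
  have "homotopic_with (\<lambda>_. True) (CSd S) (PAn ?i) ?h ?g"
  proof (rule homotopic_PA_segment[OF h g])
    fix y k and r :: real assume y: "y \<in> topspace (CSd S)" and k: "k \<in> {..<?i}" and r: "0 \<le> r" "r \<le> 1"
    show "(1 - r) *\<^sub>R ?h y k + r *\<^sub>R ?g y k \<noteq> 0"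
    proof (cases "k = t")
      case True
      have "(1 - r) *\<^sub>R ?h y t + r *\<^sub>R (s *\<^sub>R ?e) = s *\<^sub>R ((1 - r) *\<^sub>R (farp S y - y c) + r *\<^sub>R ?e)"
        unfolding ht by (simp add: algebra_simps)
      then show ?thesis using True k s farp_segment[OF S(1) c r, of y] by simp
    next
      case False
      then have "?g y k = ?h y k" using k by simp
      then show ?thesis using h y k by (simp only: segment_self) (auto simp: continuous_map_PA)
    qed
  qed
  from tau_homotopic[OF this z]
  have "mon F (chain_map (?i * D) (secp S x) z) = tau ?i (chain_map (?i * D) ?g z)"
    by (simp add: mon_def chain_map_map)
  also have "\<dots> = 0"
    using t(1) s by (intro tau_coordinate_zero[OF g t(1), of "\<lambda>_. s *\<^sub>R ?e", OF _ _ _ z]) auto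
  finally show ?thesis using True by simp
qed

text \<open>Extension by zero to lists that are no monomials of degree i on S makes equations
  between functionals hold on all lists.\<close>

definition evl :: "nat set \<Rightarrow> nat \<Rightarrow> (nat \<Rightarrow> real^'d) chain \<Rightarrow> edge list \<Rightarrow> int" where
  "evl S i w F = (if valid S F \<and> length F = i then mon F w else 0)"

text \<open>The direction of f in the limit where the orbit of x shrinks to b: an edge between x and
  b keeps only the vector of the orbit, any other edge sees x at the position of b.\<close>

definition gedge :: "nat \<Rightarrow> nat \<Rightarrow> edge \<Rightarrow> (nat \<Rightarrow> real^'d) \<times> (real^'d) \<Rightarrow> real^'d" where
  "gedge x b f p = (if f = (x, b) then snd p else if f = (b, x) then - snd p
     else fst p (sbv x b (fst f)) - fst p (sbv x b (snd f)))"

lemma plan_edge_segment: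
  assumes S: "finite S" "x \<notin> S" "b \<in> S" and f: "fst f \<noteq> snd f" "fst f \<in> insert x S" "snd f \<in> insert x S"
    and p: "p \<in> topspace (XT (CSd S) (- {0}))" and r: "0 \<le> r" "r \<le> 1"
  shows "(1 - r) *\<^sub>R (plan S x b p (fst f) - plan S x b p (snd f)) + r *\<^sub>R gedge x b f p \<noteq> 0"
proof -
  obtain y u where yu: "p = (y, u)" by force
  obtain a c where ac: "f = (a, c)" by force
  have u: "u \<noteq> 0" and inj: "inj_on y S" using p yu by (auto simp: topspace_CS)
  have xb: "x \<noteq> b" using S by auto
  define k where "k = rad S b y / (1 + norm u)"
  have k: "0 < k" using rad_pos[of S b y] by (simp add: k_def add_pos_nonneg)
  have px: "plan S x b p x = y b + k *\<^sub>R u" and pa: "\<And>a. a \<in> S \<Longrightarrow> plan S x b p a = y a"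
    using S(2) by (auto simp: plan_def yu k_def)
  have pos: "(1 - r) * k + r \<noteq> 0"
    using k r by (cases "r = 0") (auto simp: add_nonneg_eq_0_iff)
  have small: "(1 - r) *\<^sub>R (y b + k *\<^sub>R u - y d) + r *\<^sub>R (y b - y d) \<noteq> 0" if "d \<in> S" "d \<noteq> b" for d
  proof
    assume "(1 - r) *\<^sub>R (y b + k *\<^sub>R u - y d) + r *\<^sub>R (y b - y d) = 0"
    then have "(1 - r) *\<^sub>R k *\<^sub>R u = y d - y b" by (simp add: algebra_simps)
    moreover have "y d \<noteq> y b" using that inj S(3) by (metis inj_on_contraD)
    then have "norm ((1 - r) *\<^sub>R k *\<^sub>R u) < norm (y d - y b)"
      using plan_small[OF S(1) that, of y "1 - r" u] r by (simp add: k_def)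
    ultimately show False by simp
  qed
  consider "a = x" "c = b" | "a = b" "c = x" | "a = x" "c \<in> S" "c \<noteq> b" | "c = x" "a \<in> S" "a \<noteq> b" | "a \<in> S" "c \<in> S" "a \<noteq> c"
    using f ac by auto
  then show ?thesis
  proof cases
    case 1
    have "(1 - r) *\<^sub>R (y b + k *\<^sub>R u - y b) + r *\<^sub>R u = ((1 - r) * k + r) *\<^sub>R u" by (simp add: algebra_simps)
    then have "(1 - r) *\<^sub>R (y b + k *\<^sub>R u - y b) + r *\<^sub>R u \<noteq> 0" using pos u by (simp only: scaleR_eq_0_iff) simp
    moreover have "gedge x b f p = u" using 1 ac yu by (simp add: gedge_def)
    ultimately show ?thesis using 1 ac by (simp only: px pa S fst_conv snd_conv not_False_eq_True)
  next
    case 2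
    have "(1 - r) *\<^sub>R (y b - (y b + k *\<^sub>R u)) + r *\<^sub>R (- u) = - (((1 - r) * k + r) *\<^sub>R u)" by (simp add: algebra_simps)
    then have "(1 - r) *\<^sub>R (y b - (y b + k *\<^sub>R u)) + r *\<^sub>R (- u) \<noteq> 0" using pos u by (simp only: neg_equal_0_iff_equal scaleR_eq_0_iff) simp
    moreover have "gedge x b f p = - u" using 2 ac xb yu by (simp add: gedge_def)
    ultimately show ?thesis using 2 ac by (simp only: px pa S fst_conv snd_conv not_False_eq_True)
  next
    case 3
    have "gedge x b f p = y b - y c" using 3 ac xb yu S(2) by (auto simp: gedge_def sbv_def)
    then show ?thesis using 3 ac small[of c] by (simp only: px pa S fst_conv snd_conv not_False_eq_True)
  next
    case 4
    have "gedge x b f p = - (y b - y a)" using 4 ac xb yu S(2) by (auto simp: gedge_def sbv_def)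
    moreover have "(1 - r) *\<^sub>R (y a - (y b + k *\<^sub>R u)) + r *\<^sub>R - (y b - y a) = - ((1 - r) *\<^sub>R (y b + k *\<^sub>R u - y a) + r *\<^sub>R (y b - y a))"
      by (simp add: algebra_simps)
    ultimately show ?thesis using 4 ac small[of a] by (simp only: px pa S fst_conv snd_conv neg_equal_0_iff_equal not_False_eq_True)
  next
    case 5
    have "gedge x b f p = y a - y c" using 5 ac xb yu S(2) by (auto simp: gedge_def sbv_def)
    moreover have "y a - y c \<noteq> 0" using 5 inj by (auto simp: inj_on_def)
    ultimately show ?thesis using 5 ac by (simp only: pa fst_conv snd_conv segment_self not_False_eq_True)
  qed
qed

lemma continuous_map_gedge:
  assumes S: "x \<notin> S" "b \<in> S" and f: "fst f \<in> insert x S" "snd f \<in> insert x S"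
  shows "continuous_map (XT (CSd S) (- {0})) euclidean (gedge x b f)"
proof -
  have nth: "continuous_map (XT (CSd S) (- {0 :: real^'d})) euclidean (\<lambda>p. fst p c)" if "c \<in> S" for c
    using continuous_map_compose[OF continuous_map_fst continuous_map_CS_nth[OF that]] by (simp add: o_def)
  have "sbv x b (fst f) \<in> S" "sbv x b (snd f) \<in> S" using f S by (auto simp: sbv_def)
  then have "continuous_map (XT (CSd S) (- {0 :: real^'d})) euclidean (\<lambda>p. fst p (sbv x b (fst f)) - fst p (sbv x b (snd f)))"
    by (intro continuous_map_diff nth)
  then have 3: "continuous_map (XT (CSd S) (- {0 :: real^'d})) euclidean (gedge x b f)" if "f \<noteq> (x, b)" "f \<noteq> (b, x)"
    using that unfolding gedge_def by simp
  have snd: "continuous_map (XT (CSd S) (- {0 :: real^'d})) euclidean snd" by (rule continuous_map_XT_snd)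
  have "gedge x b (x, b) = snd" "gedge x b (b, x) = (\<lambda>p. - snd p)"
    using S by (auto simp: gedge_def fun_eq_iff)
  then show ?thesis using 3 snd continuous_map_minus[OF snd] by metis
qed

text \<open>The geometric source of contraction. In the limit only edges between x and b depend on
  the orbit vector. If there is none, the map factors through the projection of w, which bounds. If
  there are two, their coordinates are proportional. If there is exactly one, its position accounts
  for the power of \<open>eps0\<close> and its orientation for \<open>dl0\<close>.\<close>

lemma mon_plan:
  assumes S: "finite S" "x \<notin> S" "b \<in> S" and F: "valid (insert x S) F" "length F = Suc j"
    and w: "is_cycle (Suc j * D) (XT (CSd S) (- {0})) w"
    and z: "ResR (CSd S) (enumd :: 'd list) (Suc j * D) w z"
    and fw: "is_bdry (Suc j * D) (CSd S) (chain_map (Suc j * D) fst w)"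
  shows "mon F (chain_map (Suc j * D) (plan S x b) w) = contr dl0 eps0 x b (evl S j z) F"
proof -
  let ?p = "Suc j * D" let ?X = "XT (CSd S) (- {0 :: real^'d})"
  let ?G = "\<lambda>q. \<lambda>t\<in>{..<Suc j}. gedge x b (rev F ! t) q"
  have xb: "x \<noteq> b" using S by auto
  have zc: "is_cycle (j * D) (CSd S) z"
    using ResR_cycle[OF z] w by (simp add: Tn_enumd Suc_diff_card)
  have v: "fst (rev F ! t) \<in> insert x S" "snd (rev F ! t) \<in> insert x S" "fst (rev F ! t) \<noteq> snd (rev F ! t)"
    if "t < Suc j" for t
    using valid_nth[OF F(1)] that F(2) by auto
  have h: "continuous_map ?X (PAn (Suc j)) (\<lambda>q. pi F (plan S x b q))"
    using continuous_map_compose[OF continuous_map_plan[OF S] continuous_map_pi[OF F(1)]] F(2) by (simp add: o_def)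
  have G: "continuous_map ?X (PAn (Suc j)) ?G"
    unfolding continuous_map_PA
  proof (intro conjI ballI)
    fix t assume t: "t \<in> {..<Suc j}"
    then show "continuous_map ?X euclidean (\<lambda>q. ?G q t)"
      using continuous_map_gedge[OF S(2,3) v(1,2)[of t]] by simp
    fix q assume "q \<in> topspace ?X"
    from plan_edge_segment[OF S v(3,1,2)[of t] this, of 1] t show "?G q t \<noteq> 0" by simp
  qed auto
  have "homotopic_with (\<lambda>_. True) ?X (PAn (Suc j)) (\<lambda>q. pi F (plan S x b q)) ?G"
  proof (rule homotopic_PA_segment[OF h G])
    fix q t and r :: real assume q: "q \<in> topspace ?X" and t: "t \<in> {..<Suc j}" and r: "0 \<le> r" "r \<le> 1"
    show "(1 - r) *\<^sub>R pi F (plan S x b q) t + r *\<^sub>R ?G q t \<noteq> 0"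
      using plan_edge_segment[OF S v(3,1,2)[of t] q r] t F(2) by (simp add: pi_def)
  qed
  from tau_homotopic[OF this w]
  have eq: "mon F (chain_map ?p (plan S x b) w) = tau (Suc j) (chain_map ?p ?G w)"
    by (simp add: mon_def chain_map_map F(2) del: tau_Suc)
  let ?pos = "\<lambda>f. f = (x, b) \<or> f = (b, x)"
  consider (none) "\<forall>f\<in>set F. \<not> ?pos f"
    | (one) L f M where "F = L @ f # M" "?pos f" "\<forall>g\<in>set L \<union> set M. \<not> ?pos g"
    | (two) L f M where "F = L @ f # M" "?pos f" "\<exists>g\<in>set L \<union> set M. ?pos g"
  proof (cases "\<exists>f\<in>set F. ?pos f")
    case True
    then obtain f L M where "F = L @ f # M" "?pos f" by (meson split_list)
    then show ?thesis using one two by blast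
  qed (use none in blast)
  then show ?thesis
  proof cases
    case none
    then have 0: "contr dl0 eps0 x b (evl S j z) F = 0"
      unfolding contr_def by (intro del_op_zero_wt) (auto simp: wt_def)
    have np: "\<not> ?pos (rev F ! t)" if "t < Suc j" for t
      using none that F(2) nth_mem[of t "rev F"] by auto
    have Ge: "?G = (\<lambda>q. ?G (fst q, 0))" using np by (auto simp: fun_eq_iff gedge_def restrict_def)
    have "continuous_map (CSd S) (PAn (Suc j)) (\<lambda>y. ?G (y, 0))"
    proof -
      \<comment> \<open>The 0 in the second slot is a placeholder outside the punctured space; by
        \<open>Ge\<close> it may be replaced by any nonzero vector, where continuity is
        known.\<close>
      obtain e :: "real^'d" where e: "e \<noteq> 0" by (rule that[of "axis undefined 1"]) (simp add: axis_eq_0_iff)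
      have "continuous_map (CSd S) ?X (\<lambda>y. (y, e))" by (rule continuous_map_section) (use e in auto)
      from continuous_map_compose[OF this G] have "continuous_map (CSd S) (PAn (Suc j)) (\<lambda>y. ?G (y, e))"
        by (simp add: o_def)
      moreover have "?G (y, e) = ?G (y, 0)" for y using fun_cong[OF Ge, of "(y, e)"] by (simp only: fst_conv)
      ultimately show ?thesis by simp
    qed
    from is_bdry_map[OF fw this]
    have "is_bdry ?p (PAn (Suc j)) (chain_map ?p (\<lambda>q. ?G (fst q, 0)) w)"
      by (simp only: chain_map_map)
    then have "tau (Suc j) (chain_map ?p ?G w) = 0" by (subst Ge) (rule tau_bdry)
    then show ?thesis using eq 0 by simp
  next
    case (two L f M)
    obtain g where g: "g \<in> set L \<union> set M" "?pos g" using two(3) by blast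
    obtain s2 where s2: "s2 < length F" "s2 \<noteq> length L" "F ! s2 = g"
    proof -
      from g(1) consider k where "k < length L" "L ! k = g" | k where "k < length M" "M ! k = g"
        by (auto simp: in_set_conv_nth)
      then show ?thesis
      proof cases
        case (1 k)
        then show ?thesis by (intro that[of k]) (simp_all add: two(1) nth_append)
      next
        case (2 k)
        then show ?thesis by (intro that[of "Suc (length L + k)"]) (simp_all add: two(1) nth_append)
      qed
    qed
    define s1 where "s1 = length L"
    have s1: "s1 < length F" "F ! s1 = f" using two(1) by (auto simp: s1_def)
    have ne: "s1 \<noteq> s2" using s2 by (simp add: s1_def)
    have 0: "contr dl0 eps0 x b (evl S j z) F = 0"
      unfolding contr_sum
    proof (intro sum.neutral ballI)
      fix s assume "s \<in> {..<length F}"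
      obtain s' where s': "s' < length F" "s' \<noteq> s" "?pos (F ! s')"
        using s1 s2 ne two(2) g(2) by metis
      have "F ! s' \<in> set (take s F @ drop (Suc s) F)"
      proof (cases "s' < s")
        case True
        then have "F ! s' = take s F ! s'" "s' < length (take s F)" using s' by auto
        then show ?thesis by (metis in_set_conv_nth UnI1 set_append)
      next
        case False
        then have "F ! s' = drop (Suc s) F ! (s' - Suc s)" "s' - Suc s < length (drop (Suc s) F)" using s' by auto
        then show ?thesis by (metis in_set_conv_nth UnI2 set_append)
      qed
      \<comment> \<open>Renaming turns the second edge between x and b into a loop, so the shortened
        list is no valid monomial.\<close>
      then have "(b, b) \<in> set (rl (sbv x b) (take s F @ drop (Suc s) F))"
        using s'(3) xb by (force simp: sbv_def image_iff)
      then have "\<not> valid S (rl (sbv x b) (take s F @ drop (Suc s) F))" unfolding valid_def by blast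
      then show "wt dl0 x b (F ! s) * eps0 ^ s * evl S j z (rl (sbv x b) (take s F @ drop (Suc s) F)) = 0"
        unfolding evl_def by (simp only: simp_thms if_False mult_zero_right)
    qed
    \<comment> \<open>Coordinates are counted from the end of F because of the reversal in
      \<open>pi\<close>.\<close>
    define t1 where "t1 = j - s1" define t2 where "t2 = j - s2"
    have t: "t1 < Suc j" "t2 < Suc j" "t1 \<noteq> t2" "rev F ! t1 = f" "rev F ! t2 = g"
      using s1 s2 ne F(2) by (auto simp: t1_def t2_def rev_nth)
    define c :: real where "c = (if f = g then 1 else -1)"
    have "gedge x b f q = c *\<^sub>R gedge x b g q" for q
      using two(2) g(2) xb by (auto simp: c_def gedge_def)
    then have "tau (Suc j) (chain_map ?p ?G w) = 0"
      using t by (intro tau_coordinate_zero[OF G t(1), of "\<lambda>v. c *\<^sub>R v t2", OF _ _ _ w])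
        (auto simp: c_def topspace_PA PiE_def Pi_def intro!: continuous_map_scaleR continuous_map_PA_nth)
    then show ?thesis using eq 0 by simp
  next
    case (one L f M)
    let ?F = "rl (sbv x b) (L @ M)" let ?s = "if f = (x, b) then 1 else dl0"
    have j: "j = length L + length M" using F(2) one(1) by simp
    have vLM: "valid S ?F"
    proof (rule valid_rl_sbv)
      show "valid (insert x S) (L @ M)" using F(1) one(1) by simp
      show "\<forall>g\<in>set (L @ M). g \<noteq> (x, b) \<and> g \<noteq> (b, x)" using one(3) by auto
    qed (rule S)
    have contr: "contr dl0 eps0 x b (evl S j z) F = eps0 ^ length L * ?s * mon ?F z"
    proof -
      have "contr dl0 eps0 x b (evl S j z) F = eps0 ^ length L * wt dl0 x b f * evl S j z ?F"
        unfolding contr_def one(1) using one(3) by (subst del_op_single) (auto simp: wt_def)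
      then show ?thesis using vLM j one(2) by (auto simp: evl_def wt_def)
    qed
    let ?pF = "\<lambda>q. (pi ?F (fst q), snd q :: real^'d)"
    have pF: "continuous_map (CSd S) (PAn j) (pi ?F)" using continuous_map_pi[OF vLM] j by simp
    have pFX: "continuous_map ?X (XT (PAn j) (- {0})) ?pF"
      using continuous_map_compose[OF continuous_map_fst pF]
      by (intro continuous_map_XTI) (auto simp: o_def continuous_map_XT_snd)
    obtain w' z' where w': "is_cycle ?p ?X w'" "ResR (CSd S) (enumd :: 'd list) ?p w' z'"
      and z': "mon ?F z' = ?s * mon ?F z"
      and Gw: "chain_map ?p ?G w = chain_map ?p (ins j (length M)) (chain_map ?p ?pF w')"
    proof -
      have co: "?G q t = ins j (length M) (?pF (fst q, if f = (x, b) then snd q else - snd q)) t" if "t < Suc j" for q t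
      proof -
        have rF: "rev F = rev M @ f # rev L" using one(1) by simp
        have ge: "gedge x b g q = fst q (sbv x b (fst g)) - fst q (sbv x b (snd g))" if "g \<in> set L \<union> set M" for g
          using one(3) that by (auto simp: gedge_def)
        consider "t < length M" | "t = length M" | "length M < t" by linarith
        then show ?thesis
        proof cases
          case 1
          have "rev M ! t \<in> set L \<union> set M" using 1 nth_mem[of t "rev M"] by auto
          then show ?thesis using 1 j that by (simp add: ins_def rF nth_append pi_def rev_map ge)
        next
          case 2
          then show ?thesis using j one(2) xb by (auto simp: ins_def rF nth_append gedge_def)
        next
          case 3
          have "rev L ! (t - Suc (length M)) \<in> set L \<union> set M"
            using 3 that j nth_mem[of "t - Suc (length M)" "rev L"] by auto
          moreover have "rev F ! t = rev L ! (t - Suc (length M))" using 3 by (simp add: rF nth_append)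
          moreover have "\<not> t - Suc 0 < length M" "t - Suc 0 < length M + length L" "t - Suc 0 < length L + length M"
            "t - Suc (length M) < length L" using 3 that j by auto
          ultimately show ?thesis using 3 j that by (simp add: ins_def pi_def ge rev_map nth_append)
        qed
      qed
      have co': "?G q = ins j (length M) (?pF (fst q, if f = (x, b) then snd q else - snd q))" for q
      proof
        fix t show "?G q t = ins j (length M) (?pF (fst q, if f = (x, b) then snd q else - snd q)) t"
          using co[of t q] by (cases "t < Suc j") (auto simp: ins_def)
      qed
      show ?thesis
      proof (cases "f = (x, b)")
        case True
        show ?thesis
        proof (rule that[OF w z])
          show "mon ?F z = ?s * mon ?F z" using True by simp
          show "chain_map ?p ?G w = chain_map ?p (ins j (length M)) (chain_map ?p ?pF w)"
            unfolding chain_map_map using True by (simp only: co') simp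
        qed
      next
        case False
        \<comment> \<open>The edge is (b, x) and sees the negative of the orbit vector, so the
          antipode is applied first and the residue changes by \<open>dl0\<close>.\<close>
        obtain z' where z': "ResR (CSd S) (enumd :: 'd list) ?p (chain_map ?p (\<lambda>z. (fst z, - snd z)) w) z'"
          "is_bdry (j * D) (CSd S) (z' - frag_cmul dl0 z)"
          using ResR_antipode[OF z w fw] by auto
        have dz: "is_cycle (j * D) (CSd S) (frag_cmul dl0 z)" using zc by (rule singular_relcycle_cmul)
        show ?thesis
        proof (rule that[OF _ z'(1)])
          show "is_cycle ?p ?X (chain_map ?p (\<lambda>z. (fst z, - snd z)) w)"
            by (rule is_cycle_map[OF w]) (intro continuous_map_XTI, auto intro: continuous_map_fst continuous_map_XT_snd)
          have "mon ?F z' = mon ?F (z' - frag_cmul dl0 z) + mon ?F (frag_cmul dl0 z)"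
            using mon_add[OF vLM, of "z' - frag_cmul dl0 z" "frag_cmul dl0 z"] is_bdry_imp_cycle[OF z'(2)] dz j by simp
          also have "mon ?F (z' - frag_cmul dl0 z) = 0" using mon_bdry[OF vLM] z'(2) j by simp
          finally show "mon ?F z' = ?s * mon ?F z" using mon_cmul[OF vLM] zc j False by simp
          show "chain_map ?p ?G w = chain_map ?p (ins j (length M)) (chain_map ?p ?pF (chain_map ?p (\<lambda>z. (fst z, - snd z)) w))"
            unfolding chain_map_map using False by (simp only: co') simp
        qed
      qed
    qed
    have "ResR (PAn j) (enumd :: 'd list) ?p (chain_map ?p ?pF w') (chain_map (j * D) (pi ?F) z')"
      using ResR_map[OF w'(2) pF] by (simp add: Suc_diff_card)
    from tau_ins[OF is_cycle_map[OF w'(1) pFX] this, of "length M"]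
    have "tau (Suc j) (chain_map ?p ?G w) = eps0 ^ (j - length M) * mon ?F z'"
      unfolding Gw mon_def using j by simp
    then show ?thesis using eq contr z' j by simp
  qed
qed

end

section \<open>The evaluation functionals of cycles as a family closed under collisions\<close>

context punctured
begin

lemma lift_exists:
  assumes "is_cycle (j * D) X z"
  obtains w where "is_cycle (Suc j * D) (XT X (- {0})) w" "ResR X (enumd :: 'd list) (Suc j * D) w z"
    "is_bdry (Suc j * D) X (chain_map (Suc j * D) fst w)"
proof -
  have "Suc j * D = j * D + length (enumd :: 'd list) - 1" using card2 by (simp add: length_enumd D_eq)
  then show ?thesis
    using ResR_surj[OF assms enumd_ne enumd(2), of "Suc j * D"] that by (auto simp: Tn_enumd)
qed

definition Efam :: "nat set \<Rightarrow> nat \<Rightarrow> (edge list \<Rightarrow> int) set" where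
  "Efam S i = {evl S i w |w. is_cycle (i * D) (CSd S) w}"

lemma evl_valid: "evl S i w F \<noteq> 0 \<Longrightarrow> valid S F \<and> length F = i"
  by (auto simp: evl_def split: if_splits)

lemma evl_apply: "valid S F \<Longrightarrow> length F = i \<Longrightarrow> evl S i w F = mon F w"
  by (simp add: evl_def)

lemma valid_insert: "valid S F \<Longrightarrow> valid (insert x S) F"
  by (auto simp: valid_def)

lemma valid_insert_iff: "x \<notin> verts F \<Longrightarrow> valid (insert x S) F \<longleftrightarrow> valid S F"
  by (induction F) auto

lemma evl_secp:
  assumes "finite S" "x \<notin> S" "is_cycle (i * D) (CSd S) z"
  shows "evl (insert x S) i (chain_map (i * D) (secp S x) z) = avoid x (evl S i z)"
proof
  fix F show "evl (insert x S) i (chain_map (i * D) (secp S x) z) F = avoid x (evl S i z) F"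
    using mon_secp[OF assms(1,2), of F z] assms(3) valid_insert_iff[of x F S]
    by (auto simp: evl_def avoid_def)
qed

lemma contr_evl_zero:
  assumes "\<not> (valid (insert x S) F \<and> length F = Suc j)" "b \<in> S" "x \<notin> S"
  shows "contr dl0 eps0 x b (evl S j z) F = 0"
proof (rule ccontr)
  assume "contr dl0 eps0 x b (evl S j z) F \<noteq> 0"
  then have "valid (insert x S) F \<and> length F = Suc j"
    by (rule contr_valid[OF _ _ assms(2,3)]) (rule evl_valid)
  then show False using assms(1) by contradiction
qed

lemma evl_plan:
  assumes "finite S" "x \<notin> S" "b \<in> S" "is_cycle (Suc j * D) (XT (CSd S) (- {0})) w"
    "ResR (CSd S) (enumd :: 'd list) (Suc j * D) w z" "is_bdry (Suc j * D) (CSd S) (chain_map (Suc j * D) fst w)"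
  shows "evl (insert x S) (Suc j) (chain_map (Suc j * D) (plan S x b) w) = contr dl0 eps0 x b (evl S j z)"
proof
  fix F
  show "evl (insert x S) (Suc j) (chain_map (Suc j * D) (plan S x b) w) F = contr dl0 eps0 x b (evl S j z) F"
  proof (cases "valid (insert x S) F \<and> length F = Suc j")
    case True
    then show ?thesis using mon_plan[OF assms(1-3) _ _ assms(4-6)] by (simp add: evl_def)
  next
    case False
    have "contr dl0 eps0 x b (evl S j z) F = 0"
      by (rule contr_evl_zero[OF False assms(3,2)])
    then show ?thesis unfolding evl_def[of "insert x S"] if_not_P[OF False] by (rule sym)
  qed
qed

text \<open>From w subtract its restriction to S extended by a far-away point and, for each b, the
  planetary class over its residue along b. All tested monomials vanish on the difference, so it
  bounds, and w has the same values as the sum.\<close>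

lemma Efam_dec:
  assumes "finite S'" "x \<in> S'" "e \<in> Efam S' i"
  shows "\<exists>e0\<in>Efam (S' - {x}) i. \<exists>h.
      (\<forall>a\<in>S' - {x}. h a = (\<lambda>F. 0) \<or> (\<exists>j. i = Suc j \<and> h a \<in> Efam (S' - {x}) j)) \<and>
      e = (\<lambda>F. avoid x e0 F + (\<Sum>a\<in>S' - {x}. contr dl0 eps0 x a (h a) F))"
proof -
  define S where "S = S' - {x}"
  have S: "finite S" "x \<notin> S" and S': "S' = insert x S" using assms by (auto simp: S_def)
  obtain w where w: "is_cycle (i * D) (CSd (insert x S)) w" and e: "e = evl (insert x S) i w"
    using assms(3) unfolding Efam_def S' by blast
  define r where "r = chain_map (i * D) (\<lambda>y. restrict y S) w"
  have r: "is_cycle (i * D) (CSd S) r"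
    unfolding r_def by (rule is_cycle_map[OF w continuous_map_CS_restrict]) auto
  have mr: "mon F r = mon F w" if "valid S F" "length F = i" for F
    using mon_restrict[OF that(1)] that(2) by (simp add: r_def)
  show ?thesis
  proof (cases i)
    case 0
    have "e = (\<lambda>F. avoid x (evl S i r) F + (\<Sum>a\<in>S. contr dl0 eps0 x a (\<lambda>F. 0) F))"
      using mr[of "[]"] 0 by (auto simp: e evl_def avoid_def fun_eq_iff valid_def)
    then show ?thesis unfolding S_def[symmetric] using r
      by (intro bexI[of _ "evl S i r"] exI[of _ "\<lambda>a F. 0"]) (auto simp: Efam_def)
  next
    case (Suc j)
    have w': "is_cycle (Suc j * D) (CSd (insert x S)) w" using w Suc by simp
    define z where "z b = resc (CSd S) (Suc j * D) (chain_map (Suc j * D) (qd S x b) w)" for b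
    have z: "is_cycle (j * D) (CSd S) (z b)" if "b \<in> S" for b
      unfolding z_def by (rule resc_qd(2)[OF S(2) that w'])
    have "\<forall>b. \<exists>l. b \<in> S \<longrightarrow> is_cycle (Suc j * D) (XT (CSd S) (- {0})) l \<and> ResR (CSd S) (enumd :: 'd list) (Suc j * D) l (z b) \<and>
      is_bdry (Suc j * D) (CSd S) (chain_map (Suc j * D) fst l)"
      using lift_exists[OF z] by metis
    then obtain l where l: "\<And>b. b \<in> S \<Longrightarrow> is_cycle (Suc j * D) (XT (CSd S) (- {0})) (l b)"
      "\<And>b. b \<in> S \<Longrightarrow> ResR (CSd S) (enumd :: 'd list) (Suc j * D) (l b) (z b)"
      "\<And>b. b \<in> S \<Longrightarrow> is_bdry (Suc j * D) (CSd S) (chain_map (Suc j * D) fst (l b))"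
      by metis
    define T where "T b = chain_map (Suc j * D) (plan S x b) (l b)" for b
    have T: "is_cycle (Suc j * D) (CSd (insert x S)) (T b)" if "b \<in> S" for b
      unfolding T_def by (rule is_cycle_map[OF l(1)[OF that] continuous_map_plan[OF S that]])
    have eT: "evl (insert x S) (Suc j) (T b) = contr dl0 eps0 x b (evl S j (z b))" if "b \<in> S" for b
      unfolding T_def by (rule evl_plan[OF S that l[OF that]])
    define s where "s = chain_map (Suc j * D) (secp S x) r"
    have s: "is_cycle (Suc j * D) (CSd (insert x S)) s"
      unfolding s_def using r Suc by (intro is_cycle_map[OF _ continuous_map_secp[OF S]]) simp
    have es: "evl (insert x S) (Suc j) s = avoid x (evl S (Suc j) r)"
      unfolding s_def using evl_secp[OF S, of "Suc j" r] r Suc by simp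
    define w2 where "w2 = w - (s + (\<Sum>b\<in>S. T b))"
    have sT: "is_cycle (Suc j * D) (CSd (insert x S)) (s + (\<Sum>b\<in>S. T b))"
      using s T by (intro singular_relcycle_add singular_relcycle_sum)
    have w2: "is_cycle (Suc j * D) (CSd (insert x S)) w2"
      unfolding w2_def by (rule singular_relcycle_diff[OF w' sT])
    have m2: "mon F w2 = mon F w - (avoid x (evl S (Suc j) r) F + (\<Sum>b\<in>S. contr dl0 eps0 x b (evl S j (z b)) F))"
      if F: "valid (insert x S) F" "length F = Suc j" for F
    proof -
      have T': "mon F (T b) = contr dl0 eps0 x b (evl S j (z b)) F" if "b \<in> S" for b
        using fun_cong[OF eT[OF that], of F] evl_apply[OF F] by simp
      have s': "mon F s = avoid x (evl S (Suc j) r) F"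
        using fun_cong[OF es, of F] evl_apply[OF F] by simp
      have "mon F w2 = mon F w - mon F (s + (\<Sum>b\<in>S. T b))"
        unfolding w2_def by (rule mon_diff[OF F(1)]) (simp_all only: F(2) w' sT)
      also have "mon F (s + (\<Sum>b\<in>S. T b)) = mon F s + mon F (\<Sum>b\<in>S. T b)"
        by (rule mon_add[OF F(1)], simp_all only: F(2) s) (rule singular_relcycle_sum[OF T])
      also have "mon F (\<Sum>b\<in>S. T b) = (\<Sum>b\<in>S. mon F (T b))"
        by (rule mon_sum[OF F(1) S(1)]) (simp only: F(2) T)
      finally show ?thesis using T' s' by simp
    qed
    have "is_bdry (Suc j * D) (CSd (insert x S)) w2"
    proof (rule separation_insert[OF S w2 separation[OF S(1)]])
      fix F assume F: "valid S F" "length F = Suc j"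
      have x: "x \<notin> verts F" using valid_verts[OF F(1)] S(2) by auto
      show "mon F w2 = 0"
        using m2[OF valid_insert[OF F(1)] F(2)] mr[of F] F Suc x by (simp add: avoid_def evl_def contr_no_vertex)
    next
      fix F c assume F: "valid S F" "Suc j = Suc (length F)" and c: "c \<in> S"
      have x: "x \<notin> verts F" using valid_verts[OF F(1)] S(2) by auto
      have v: "valid (insert x S) ((x, c) # F)" using F(1) c S(2) by (auto simp: valid_def)
      \<comment> \<open>The point x occurs only in the head of this monomial, so the contraction
        along b sees just that edge.\<close>
      have ct: "contr dl0 eps0 x b (evl S j (z b)) ((x, c) # F) = (if b = c then mon F (z b) else 0)" if "b \<in> S" for b
      proof -
        have "del_op eps0 (wt dl0 x b) g F = 0" for g
          using contr_no_vertex[OF x, of dl0 eps0 b] x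
          by (intro del_op_zero_wt) (force simp: wt_def verts_def)
        moreover have "rl (sbv x b) F = F" using x by (intro rl_ident) (auto simp: sbv_def)
        ultimately show ?thesis using F c S(2) that by (auto simp: contr_def wt_def evl_def)
      qed
      have "mon ((x, c) # F) w = mon F (z c)"
        unfolding z_def using F(2) mon_Cons[OF F(1) S(2) c, of w] w' resc_qd(1)[OF S(2) c w'] by auto
      then show "mon ((x, c) # F) w2 = 0"
        using m2[OF v] F(2) c S(1) by (simp add: ct avoid_def sum.delta)
    qed
    then have "mon F w2 = 0" if "valid (insert x S) F" "length F = Suc j" for F
      using that mon_bdry by metis
    then have val: "mon F w = avoid x (evl S (Suc j) r) F + (\<Sum>b\<in>S. contr dl0 eps0 x b (evl S j (z b)) F)"
      if "valid (insert x S) F" "length F = Suc j" for F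
      using m2[OF that] that by simp
    have "e F = avoid x (evl S i r) F + (\<Sum>a\<in>S. contr dl0 eps0 x a (evl S j (z a)) F)" for F
    proof (cases "valid (insert x S) F \<and> length F = Suc j")
      case True
      then have "e F = mon F w" unfolding e evl_def using Suc by simp
      then show ?thesis using val True Suc by simp
    next
      case False
      have "contr dl0 eps0 x a (evl S j (z a)) F = 0" if "a \<in> S" for a
        by (rule contr_evl_zero[OF False that S(2)])
      moreover have "avoid x (evl S i r) F = 0"
        using False evl_valid[of S i r F] valid_insert Suc unfolding avoid_def by metis
      moreover have "e F = 0" unfolding e evl_def using False Suc by metis
      ultimately show ?thesis by simp
    qed
    then show ?thesis unfolding S_def[symmetric] using r z Suc
      by (intro bexI[of _ "evl S i r"] exI[of _ "\<lambda>a. evl S j (z a)"]) (auto simp: Efam_def)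
  qed
qed

sublocale fam: config_family Efam dl0 eps0
proof
  show "dl0 * dl0 = 1" "eps0 * eps0 = 1" by (rule dl0_sq eps0_sq)+
next
  fix S x e i assume "finite S" "x \<in> S" "e \<in> Efam S i"
  then show "\<exists>e0\<in>Efam (S - {x}) i. \<exists>h.
      (\<forall>a\<in>S - {x}. h a = (\<lambda>F. 0) \<or> (\<exists>j. i = Suc j \<and> h a \<in> Efam (S - {x}) j)) \<and>
      e = (\<lambda>F. avoid x e0 F + (\<Sum>a\<in>S - {x}. contr dl0 eps0 x a (h a) F))"
    by (rule Efam_dec)
next
  fix S :: "nat set" and x e i assume S: "finite S" "x \<notin> S" and "e \<in> Efam S i"
  then obtain z where z: "is_cycle (i * D) (CSd S) z" "e = evl S i z" by (auto simp: Efam_def)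
  then show "avoid x e \<in> Efam (insert x S) i"
    unfolding Efam_def z(2) evl_secp[OF S z(1), symmetric]
    using is_cycle_map[OF z(1) continuous_map_secp[OF S]] by blast
next
  fix S :: "nat set" and x a e i assume S: "finite S" "x \<notin> S" "a \<in> S" and "e \<in> Efam S i"
  then obtain z where z: "is_cycle (i * D) (CSd S) z" "e = evl S i z" by (auto simp: Efam_def)
  obtain w where w: "is_cycle (Suc i * D) (XT (CSd S) (- {0})) w" "ResR (CSd S) (enumd :: 'd list) (Suc i * D) w z"
    "is_bdry (Suc i * D) (CSd S) (chain_map (Suc i * D) fst w)"
    by (rule lift_exists[OF z(1)])
  show "contr dl0 eps0 x a e \<in> Efam (insert x S) (Suc i)"
    unfolding Efam_def z(2) evl_plan[OF S w, symmetric]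
    using is_cycle_map[OF w(1) continuous_map_plan[OF S]] by blast
next
  fix S i e F assume "e \<in> Efam S i" "e F \<noteq> 0"
  then show "valid S F \<and> length F = i" using evl_valid by (auto simp: Efam_def)
next
  have "singular_chain 0 (CSd {}) (frag_of pt0)"
    using singular_chain_singleton[OF topspace_CS_empty, of 0 "frag_of pt0"]
    by (auto simp: pt0_def intro!: exI[of _ 1])
  moreover have "simplex_map 0 (pi []) (pt0 :: _ \<Rightarrow> nat \<Rightarrow> real^'d) = pt0"
    by (auto simp: simplex_map_def pt0_def pi_def fun_eq_iff restrict_def)
  then have "evl {} 0 (frag_of pt0) = (\<lambda>F. if F = [] then 1 else 0)"
    by (auto simp: evl_def mon_def fun_eq_iff valid_def)
  ultimately show "(\<lambda>F. if F = [] then 1 else 0) \<in> Efam {} 0"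
    unfolding Efam_def by (auto simp: is_cycle_0 intro!: exI[of _ "frag_of pt0"])
qed

end

subsection \<open>Rational cochains as additive functions on integral chains\<close>

definition cev :: "('a \<Rightarrow> rat) \<Rightarrow> ('a \<Rightarrow>\<^sub>0 int) \<Rightarrow> rat" where
  "cev \<phi> c = (\<Sum>f\<in>Poly_Mapping.keys c. of_int (Poly_Mapping.lookup c f) * \<phi> f)"

lemma cev_superset:
  assumes "finite A" "Poly_Mapping.keys c \<subseteq> A"
  shows "cev \<phi> c = (\<Sum>f\<in>A. of_int (Poly_Mapping.lookup c f) * \<phi> f)"
  unfolding cev_def by (rule sum.mono_neutral_left[OF assms]) (simp add: in_keys_iff)

lemma cev_add: "cev \<phi> (a + b) = cev \<phi> a + cev \<phi> b"
proof -
  let ?A = "Poly_Mapping.keys a \<union> Poly_Mapping.keys b"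
  have "Poly_Mapping.keys (a + b) \<subseteq> ?A" by (rule Poly_Mapping.keys_add)
  then show ?thesis
    by (simp add: cev_superset[of ?A] lookup_add sum.distrib distrib_right)
qed

lemma cev_zero [simp]: "cev \<phi> 0 = 0" by (simp add: cev_def)

lemma cev_of [simp]: "cev \<phi> (frag_of f) = \<phi> f" by (simp add: cev_def)

lemma cev_minus: "cev \<phi> (- a) = - cev \<phi> a"
  using cev_add[of \<phi> a "- a"] by simp

lemma cev_diff: "cev \<phi> (a - b) = cev \<phi> a - cev \<phi> b"
  using cev_add[of \<phi> a "- b"] cev_minus[of \<phi> b] by simp

lemma cev_cmul: "cev \<phi> (frag_cmul k a) = of_int k * cev \<phi> a"
proof -
  have "Poly_Mapping.keys (frag_cmul k a) \<subseteq> Poly_Mapping.keys a" by (rule keys_cmul)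
  then show ?thesis
    by (simp add: cev_superset[of "Poly_Mapping.keys a"] sum_distrib_left mult_ac)
qed

lemma cev_sum: "cev \<phi> (sum c A) = (\<Sum>i\<in>A. cev \<phi> (c i))"
  by (induction A rule: infinite_finite_induct) (simp_all add: cev_add)

lemma cev_fun_diff: "cev (\<lambda>f. \<phi> f - \<psi> f) c = cev \<phi> c - cev \<psi> c"
  by (simp add: cev_def right_diff_distrib sum_subtractf)

lemma cev_fun_sum: "cev (\<lambda>f. \<Sum>i\<in>I. q i * \<phi> i f) c = (\<Sum>i\<in>I. q i * cev (\<phi> i) c)"
  unfolding cev_def sum_distrib_left by (subst sum.swap) (simp add: mult_ac)

lemma cev_cong: "(\<And>f. f \<in> Poly_Mapping.keys c \<Longrightarrow> \<phi> f = \<psi> f) \<Longrightarrow> cev \<phi> c = cev \<psi> c"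
  by (simp add: cev_def)

lemma common_denominator:
  fixes r :: "'a \<Rightarrow> rat"
  assumes "finite t"
  shows "\<exists>N::int. N > 0 \<and> (\<forall>b\<in>t. \<exists>n::int. of_int N * r b = of_int n)"
  using assms
proof (induction t)
  case empty show ?case by (intro exI[of _ 1]) simp
next
  case (insert b t)
  then obtain N where N: "N > 0" "\<And>c. c \<in> t \<Longrightarrow> \<exists>n::int. of_int N * r c = of_int n" by auto
  obtain p q where pq: "r b = of_int p / of_int q" "q > 0"
    by (metis quotient_of_div quotient_of_denom_pos surj_pair)
  have "\<exists>n::int. of_int (q * N) * r c = of_int n" if "c \<in> insert b t" for c
  proof (cases "c = b")
    case True
    then have "of_int (q * N) * r c = of_int (N * p)" using pq by simp
    then show ?thesis by blast
  next
    case False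
    then have "c \<in> t" using that by simp
    from N(2)[OF this] obtain n where n: "of_int N * r c = of_int n" by blast
    have "of_int (q * N) * r c = of_int q * (of_int N * r c)" by simp
    also have "\<dots> = of_int (q * n)" by (simp add: n)
    finally have "of_int (q * N) * r c = of_int (q * n)" .
    then show ?thesis by blast
  qed
  then show ?case using N(1) pq(2) by (intro exI[of _ "q * N"]) auto
qed

interpretation fun_vs: vector_space "\<lambda>(q::rat) (f :: 'a \<Rightarrow> rat). (\<lambda>s. q * f s)"
  by standard (auto simp: fun_eq_iff algebra_simps)

interpretation rat_vs: vector_space "(*) :: rat \<Rightarrow> rat \<Rightarrow> rat"
  by standard (auto simp: algebra_simps)

interpretation fun_rat: vector_space_pair "\<lambda>(q::rat) (f :: 'a \<Rightarrow> rat). (\<lambda>s. q * f s)" "(*) :: rat \<Rightarrow> rat \<Rightarrow> rat" ..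

text \<open>The rationals are divisible, hence injective among abelian groups. Concretely, a basis
  of the rational span of G is chosen inside G, and l is prescribed on it and extended
  linearly.\<close>

theorem additive_extension:
  fixes G :: "('a \<Rightarrow>\<^sub>0 int) set" and l :: "('a \<Rightarrow>\<^sub>0 int) \<Rightarrow> rat"
  assumes zero: "0 \<in> G" and diff: "\<And>a b. a \<in> G \<Longrightarrow> b \<in> G \<Longrightarrow> a - b \<in> G"
    and l: "\<And>a b. a \<in> G \<Longrightarrow> b \<in> G \<Longrightarrow> l (a - b) = l a - l b"
  shows "\<exists>\<phi>. \<forall>c\<in>G. cev \<phi> c = l c"
proof -
  define emb :: "('a \<Rightarrow>\<^sub>0 int) \<Rightarrow> 'a \<Rightarrow> rat" where "emb c = (\<lambda>s. of_int (Poly_Mapping.lookup c s))" for c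
  have emb_inj: "emb a = emb b \<Longrightarrow> a = b" for a b
    by (auto simp: emb_def fun_eq_iff intro: poly_mapping_eqI)
  have l0: "l 0 = 0" using l[OF zero zero] by simp
  have Gm: "- a \<in> G" "l (- a) = - l a" if "a \<in> G" for a
    using diff[OF zero that] l[OF zero that] l0 by auto
  have Ga: "a + b \<in> G" "l (a + b) = l a + l b" if "a \<in> G" "b \<in> G" for a b
    using diff[OF that(1) Gm(1)[OF that(2)]] l[OF that(1) Gm(1)[OF that(2)]] Gm(2)[OF that(2)] by auto
  have Gc: "frag_cmul k a \<in> G \<and> l (frag_cmul k a) = of_int k * l a" if "a \<in> G" for k a
  proof (induction k rule: int_induct[where k = 0])
    case base show ?case using zero l0 by simp
  next
    case (step1 k) then show ?case using Ga[of "frag_cmul k a" a] that by (simp add: frag_cmul_distrib algebra_simps)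
  next
    case (step2 k) then show ?case using diff[of "frag_cmul k a" a] l[of "frag_cmul k a" a] that
      by (simp add: frag_cmul_diff_distrib algebra_simps)
  qed
  have Gs: "(\<Sum>i\<in>A. c i) \<in> G \<and> l (\<Sum>i\<in>A. c i) = (\<Sum>i\<in>A. l (c i))" if "finite A" "\<And>i. i \<in> A \<Longrightarrow> c i \<in> G"
    for A :: "('a \<Rightarrow> rat) set" and c
    using that by (induction A) (auto simp: zero l0 Ga)
  obtain B where B: "B \<subseteq> emb ` G" "fun_vs.independent B" "emb ` G \<subseteq> fun_vs.span B"
    using fun_vs.maximal_independent_subset[of "emb ` G"] by metis
  define u where "u = inv_into G emb"
  have u: "u b \<in> G" "emb (u b) = b" if "b \<in> B" for b
    using that B(1) unfolding u_def by (auto intro: inv_into_into f_inv_into_f)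
  obtain h where h: "Vector_Spaces.linear (\<lambda>q f s. q * f s) (*) h" "\<And>b. b \<in> B \<Longrightarrow> h b = l (u b)"
    using fun_rat.linear_independent_extend[OF B(2), of "\<lambda>b. l (u b)"] by auto
  interpret h: Vector_Spaces.linear "\<lambda>(q::rat) (f :: 'a \<Rightarrow> rat). (\<lambda>s. q * f s)" "(*)" h by (rule h(1))
  have hG: "h (emb c) = l c" if c: "c \<in> G" for c
  proof -
    have "emb c \<in> fun_vs.span B" using B(3) c by blast
    then obtain t r where t: "finite t" "t \<subseteq> B" and ec: "emb c = (\<Sum>b\<in>t. (\<lambda>s. r b * b s))"
      unfolding fun_vs.span_explicit by blast
    obtain N where N: "N > 0" "\<And>b. b \<in> t \<Longrightarrow> \<exists>n::int. of_int N * r b = of_int n"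
      using common_denominator[OF t(1), of r] by blast
    define n where "n b = (SOME n::int. of_int N * r b = of_int n)" for b
    have n: "of_int N * r b = of_int (n b)" if "b \<in> t" for b
      unfolding n_def using someI_ex[OF N(2)[OF that]] .
    have sum_apply: "(\<Sum>b\<in>t. f b) s = (\<Sum>b\<in>t. f b s)" for f :: "('a \<Rightarrow> rat) \<Rightarrow> 'a \<Rightarrow> rat" and s
      by (induction t rule: infinite_finite_induct) auto
    have look: "Poly_Mapping.lookup (\<Sum>b\<in>t. v b) s = (\<Sum>b\<in>t. Poly_Mapping.lookup (v b) s)" for v :: "('a \<Rightarrow> rat) \<Rightarrow> 'a \<Rightarrow>\<^sub>0 int" and s
      by (rule lookup_sum)
    \<comment> \<open>After clearing denominators a multiple of c is an integral combination of
      elements of G, where additivity of l applies.\<close>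
    have "emb (frag_cmul N c) = emb (\<Sum>b\<in>t. frag_cmul (n b) (u b))"
    proof
      fix s
      have "emb (frag_cmul N c) s = of_int N * emb c s" by (simp add: emb_def)
      also have "\<dots> = (\<Sum>b\<in>t. of_int N * r b * b s)" by (simp add: ec sum_apply sum_distrib_left mult.assoc)
      also have "\<dots> = (\<Sum>b\<in>t. of_int (n b) * emb (u b) s)"
        using n u(2) t(2) by (intro sum.cong refl) (auto simp: subset_iff)
      also have "\<dots> = emb (\<Sum>b\<in>t. frag_cmul (n b) (u b)) s"
        by (simp add: emb_def look)
      finally show "emb (frag_cmul N c) s = emb (\<Sum>b\<in>t. frag_cmul (n b) (u b)) s" .
    qed
    then have "frag_cmul N c = (\<Sum>b\<in>t. frag_cmul (n b) (u b))" by (rule emb_inj)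
    then have "of_int N * l c = l (\<Sum>b\<in>t. frag_cmul (n b) (u b))" using Gc[OF c, of N] by simp
    also have "\<dots> = (\<Sum>b\<in>t. of_int (n b) * l (u b))"
      using Gs[OF t(1), of "\<lambda>b. frag_cmul (n b) (u b)"] Gc u(1) t(2) by (auto simp: subset_iff)
    also have "\<dots> = (\<Sum>b\<in>t. of_int N * r b * h b)"
      using n h(2) t(2) by (intro sum.cong refl) (auto simp: subset_iff)
    also have "\<dots> = of_int N * (\<Sum>b\<in>t. r b * h b)" by (simp add: sum_distrib_left mult.assoc)
    also have "(\<Sum>b\<in>t. r b * h b) = h (emb c)" unfolding ec by (simp add: h.sum h.scale)
    finally show ?thesis using N(1) by simp
  qed
  define \<phi> :: "'a \<Rightarrow> rat" where "\<phi> f = h (emb (frag_of f))" for f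
  have cev_h: "cev \<phi> c = h (emb c)" for c :: "'a \<Rightarrow>\<^sub>0 int"
  proof -
    have "emb c = (\<Sum>f\<in>Poly_Mapping.keys c. (\<lambda>s. of_int (Poly_Mapping.lookup c f) * emb (frag_of f) s))"
    proof
      fix s
      have "(\<Sum>f\<in>A. (\<lambda>s. g f s)) s = (\<Sum>f\<in>A. g f s)" for A and g :: "'a \<Rightarrow> 'a \<Rightarrow> rat"
        by (induction A rule: infinite_finite_induct) auto
      then show "emb c s = (\<Sum>f\<in>Poly_Mapping.keys c. (\<lambda>s. of_int (Poly_Mapping.lookup c f) * emb (frag_of f) s)) s"
        by (simp add: emb_def if_distrib[of "\<lambda>x. _ * x"] if_distrib[of of_int] in_keys_iff sum.delta cong: if_cong)
    qed
    then have "h (emb c) = (\<Sum>f\<in>Poly_Mapping.keys c. of_int (Poly_Mapping.lookup c f) * h (emb (frag_of f)))"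
      by (simp add: h.sum h.scale)
    then show ?thesis by (simp add: cev_def \<phi>_def)
  qed
  show ?thesis by (intro exI[of _ \<phi>] ballI) (simp only: cev_h hG)
qed

subsection \<open>The trace on a quotient\<close>

lemma lin_comb_lin_comb:
  "lin_comb r a (\<lambda>i. lin_comb r' (b i) z) = lin_comb r' (\<lambda>j. \<Sum>i<r. a i * b i j) z"
  unfolding lin_comb_def sum_distrib_left sum_distrib_right
  by (rule ext, subst sum.swap) (simp add: mult.assoc)

text \<open>Since the trace is defined by \<open>THE\<close>, independence of the basis has to be
  shown: modulo B the base changes a and b are inverse to each other, and conjugate matrices have
  equal traces.\<close>

lemma quot_trace_eq:
  assumes B0: "(\<lambda>_. 0) \<in> B" and Badd: "\<And>f g. f \<in> B \<Longrightarrow> g \<in> B \<Longrightarrow> (\<lambda>s. f s + g s) \<in> B"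
    and Bmul: "\<And>q f. f \<in> B \<Longrightarrow> (\<lambda>s. q * f s) \<in> B"
    and Tlin: "\<And>r a z. T (lin_comb r a z) = lin_comb r a (\<lambda>i. T (z i))"
    and Tdiff: "\<And>f g. T (\<lambda>s. f s - g s) = (\<lambda>s. T f s - T g s)"
    and TB: "\<And>f. f \<in> B \<Longrightarrow> T f \<in> B"
    and zZ: "\<forall>i<r. z i \<in> Z" and ind: "\<forall>a. lin_comb r a z \<in> B \<longrightarrow> (\<forall>i<r. a i = 0)"
    and gen: "\<forall>y\<in>Z. \<exists>a. (\<lambda>s. y s - lin_comb r a z s) \<in> B"
    and c: "\<forall>j<r. (\<lambda>s. T (z j) s - lin_comb r (c j) z s) \<in> B"
  shows "quot_trace Z B T = (\<Sum>j<r. c j j)"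
  unfolding quot_trace_def
proof (rule the_equality)
  show "\<exists>r' z' c'. (\<forall>i<r'. z' i \<in> Z) \<and> (\<forall>a. lin_comb r' a z' \<in> B \<longrightarrow> (\<forall>i<r'. a i = 0)) \<and>
       (\<forall>y\<in>Z. \<exists>a. (\<lambda>s. y s - lin_comb r' a z' s) \<in> B) \<and>
       (\<forall>j<r'. (\<lambda>s. T (z' j) s - lin_comb r' (c' j) z' s) \<in> B) \<and> (\<Sum>j<r. c j j) = (\<Sum>j<r'. c' j j)"
    using zZ ind gen c by blast
next
  fix t
  assume "\<exists>r' z' c'. (\<forall>i<r'. z' i \<in> Z) \<and> (\<forall>a. lin_comb r' a z' \<in> B \<longrightarrow> (\<forall>i<r'. a i = 0)) \<and>
       (\<forall>y\<in>Z. \<exists>a. (\<lambda>s. y s - lin_comb r' a z' s) \<in> B) \<and>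
       (\<forall>j<r'. (\<lambda>s. T (z' j) s - lin_comb r' (c' j) z' s) \<in> B) \<and> t = (\<Sum>j<r'. c' j j)"
  then obtain r' z' c' where zZ': "\<forall>i<r'. z' i \<in> Z" and ind': "\<forall>a. lin_comb r' a z' \<in> B \<longrightarrow> (\<forall>i<r'. a i = 0)"
    and gen': "\<forall>y\<in>Z. \<exists>a. (\<lambda>s. y s - lin_comb r' a z' s) \<in> B"
    and c': "\<forall>j<r'. (\<lambda>s. T (z' j) s - lin_comb r' (c' j) z' s) \<in> B" and t: "t = (\<Sum>j<r'. c' j j)"
    by blast
  define E where "E f g \<longleftrightarrow> (\<lambda>s. f s - g s :: rat) \<in> B" for f g
  have Esym: "E g f" if "E f g" for f g
    using Bmul[OF that[unfolded E_def], of "-1"] by (simp add: E_def)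
  have Etrans: "E f k" if "E f g" "E g k" for f g k
    using Badd[OF that[unfolded E_def]] by (simp add: E_def)
  have Elc: "E (lin_comb m a f) (lin_comb m a g)" if "\<And>i. i < m \<Longrightarrow> E (f i) (g i)" for m a f g
    using that
  proof (induction m)
    case 0 show ?case using B0 by (simp add: E_def lin_comb_def)
  next
    case (Suc m)
    have "E (lin_comb m a f) (lin_comb m a g)" using Suc by simp
    moreover have "(\<lambda>s. a m * (f m s - g m s)) \<in> B" using Suc.prems[of m] by (intro Bmul) (simp add: E_def)
    ultimately show ?case using Badd unfolding E_def lin_comb_def
      by (fastforce simp: algebra_simps)
  qed
  have indE: "a i = b i" if "E (lin_comb m a f) (lin_comb m b f)" "i < m"
     "\<forall>a. lin_comb m a f \<in> B \<longrightarrow> (\<forall>i<m. a i = 0)" for m a b f i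
  proof -
    have "lin_comb m (\<lambda>i. a i - b i) f \<in> B"
      using that(1) by (simp add: E_def lin_comb_def left_diff_distrib sum_subtractf)
    then have "\<forall>i<m. a i - b i = 0" using that(3) by blast
    then show ?thesis using that(2) by simp
  qed
  have "\<forall>j. \<exists>aj. j < r' \<longrightarrow> E (z' j) (lin_comb r aj z)" using gen zZ' unfolding E_def by blast
  then obtain a where a: "\<And>j. j < r' \<Longrightarrow> E (z' j) (lin_comb r (a j) z)" by metis
  have "\<forall>j. \<exists>bj. j < r \<longrightarrow> E (z j) (lin_comb r' bj z')" using gen' zZ unfolding E_def by blast
  then obtain b where b: "\<And>j. j < r \<Longrightarrow> E (z j) (lin_comb r' (b j) z')" by metis
  have delta: "lin_comb m (\<lambda>k. if k = i then 1 else 0) f = f i" if "i < m" for m i f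
    using that by (simp add: lin_comb_def if_distrib[of "\<lambda>x. x * _"] sum.delta' cong: if_cong)
  have ba: "(\<Sum>j<r'. b i j * a j k) = (if k = i then 1 else 0)" if "i < r" "k < r" for i k
  proof -
    have "E (lin_comb r' (b i) z') (lin_comb r' (b i) (\<lambda>j. lin_comb r (a j) z))" by (rule Elc[OF a])
    from Etrans[OF b[OF that(1)] this] have "E (z i) (lin_comb r (\<lambda>k. \<Sum>j<r'. b i j * a j k) z)"
      by (simp only: lin_comb_lin_comb)
    from Esym[OF this] have "E (lin_comb r (\<lambda>k. \<Sum>j<r'. b i j * a j k) z) (lin_comb r (\<lambda>k. if k = i then 1 else 0) z)"
      by (simp only: delta[OF that(1), of z])
    then show ?thesis using indE[OF _ that(2) ind] by blast
  qed
  have ab: "(\<Sum>i<r. a j i * b i l) = (if l = j then 1 else 0)" if "j < r'" "l < r'" for j l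
  proof -
    have "E (lin_comb r (a j) z) (lin_comb r (a j) (\<lambda>i. lin_comb r' (b i) z'))" by (rule Elc[OF b])
    from Etrans[OF a[OF that(1)] this] have "E (z' j) (lin_comb r' (\<lambda>k. \<Sum>i<r. a j i * b i k) z')"
      by (simp only: lin_comb_lin_comb)
    from Esym[OF this] have "E (lin_comb r' (\<lambda>k. \<Sum>i<r. a j i * b i k) z') (lin_comb r' (\<lambda>k. if k = j then 1 else 0) z')"
      by (simp only: delta[OF that(1), of z'])
    then show ?thesis using indE[OF _ that(2) ind'] by blast
  qed
  have TE: "E (T f) (T g)" if "E f g" for f g
    using TB[OF that[unfolded E_def]] by (simp add: E_def Tdiff)
  have ca: "(\<Sum>l<r'. c' j l * a l k) = (\<Sum>i<r. a j i * c i k)" if "j < r'" "k < r" for j k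
  proof -
    have "E (T (z' j)) (lin_comb r' (c' j) z')" using c' that(1) unfolding E_def by blast
    from Etrans[OF this Elc[OF a]] have 1: "E (T (z' j)) (lin_comb r (\<lambda>k. \<Sum>l<r'. c' j l * a l k) z)"
      by (simp only: lin_comb_lin_comb)
    have "E (T (z' j)) (lin_comb r (a j) (\<lambda>i. T (z i)))" using TE[OF a[OF that(1)]] by (simp only: Tlin)
    moreover have "E (lin_comb r (a j) (\<lambda>i. T (z i))) (lin_comb r (a j) (\<lambda>i. lin_comb r (c i) z))"
      using c by (intro Elc) (simp add: E_def)
    ultimately have "E (T (z' j)) (lin_comb r (a j) (\<lambda>i. lin_comb r (c i) z))" by (rule Etrans)
    then have 2: "E (T (z' j)) (lin_comb r (\<lambda>k. \<Sum>i<r. a j i * c i k) z)"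
      by (simp only: lin_comb_lin_comb)
    have "E (lin_comb r (\<lambda>k. \<Sum>l<r'. c' j l * a l k) z) (lin_comb r (\<lambda>k. \<Sum>i<r. a j i * c i k) z)"
      using Etrans[OF Esym[OF 1] 2] .
    then show ?thesis using indE[OF _ that(2) ind] by blast
  qed
  have "c' j j = (\<Sum>k<r. (\<Sum>i<r. a j i * c i k) * b k j)" if "j < r'" for j
  proof -
    have "c' j j = (\<Sum>l<r'. c' j l * (if j = l then 1 else 0))"
      using that by (simp add: if_distrib[of "\<lambda>x. _ * x"] sum.delta cong: if_cong)
    also have "\<dots> = (\<Sum>l<r'. c' j l * (\<Sum>k<r. a l k * b k j))"
      using ab that by (intro sum.cong refl) auto
    also have "\<dots> = (\<Sum>k<r. (\<Sum>l<r'. c' j l * a l k) * b k j)"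
      unfolding sum_distrib_left sum_distrib_right by (subst sum.swap) (simp add: mult.assoc)
    also have "\<dots> = (\<Sum>k<r. (\<Sum>i<r. a j i * c i k) * b k j)" using ca that by (intro sum.cong refl) auto
    finally show ?thesis .
  qed
  then have "t = (\<Sum>j<r'. \<Sum>k<r. (\<Sum>i<r. a j i * c i k) * b k j)" unfolding t by (intro sum.cong refl) auto
  also have "\<dots> = (\<Sum>k<r. \<Sum>j<r'. \<Sum>i<r. c i k * (b k j * a j i))"
    unfolding sum_distrib_right by (subst sum.swap) (simp add: mult_ac)
  also have "\<dots> = (\<Sum>k<r. \<Sum>i<r. c i k * (\<Sum>j<r'. b k j * a j i))"
    unfolding sum_distrib_left by (intro sum.cong refl sum.swap)
  also have "\<dots> = (\<Sum>k<r. \<Sum>i<r. c i k * (if i = k then 1 else 0))"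
    using ba by (intro sum.cong refl) auto
  also have "\<dots> = (\<Sum>k<r. c k k)"
    by (simp add: if_distrib[of "\<lambda>x. _ * x"] sum.delta' cong: if_cong)
  finally show "t = (\<Sum>j<r. c j j)" .
qed

subsection \<open>Singular cochains\<close>

lemma std_simplex_eq: "std_simplex k = standard_simplex k"
proof -
  have "t i \<le> 1" if "\<forall>i. 0 \<le> t i" "\<forall>i>k. t i = 0" "(\<Sum>i\<le>k. t i) = (1::real)" for t and i :: nat
  proof (cases "i \<le> k")
    case True
    then have "t i \<le> (\<Sum>i\<le>k. t i)" using that(1) by (intro member_le_sum) auto
    then show ?thesis using that(3) by simp
  next
    case False then show ?thesis using that(2) by simp
  qed
  then show ?thesis unfolding std_simplex_def standard_simplex_def by blast
qed

lemma sing_simplex_eq: "sing_simplex X k f \<longleftrightarrow> singular_simplex k X f"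
  by (simp add: sing_simplex_def singular_simplex_def std_simplex_eq std_simplex_top_def)

lemma face_eq: "face k j f = singular_face k j f"
proof -
  have "face_incl j = (simplical_face j :: (nat \<Rightarrow> real) \<Rightarrow> _)" by (simp add: fun_eq_iff face_incl_def simplical_face_def)
  then show ?thesis by (simp add: face_def singular_face_def std_simplex_eq)
qed

lemma cev_frag_extend:
  "cev \<phi> (frag_extend g c) = (\<Sum>f\<in>Poly_Mapping.keys c. of_int (Poly_Mapping.lookup c f) * cev \<phi> (g f))"
  by (simp add: frag_extend_def cev_sum cev_cmul)

lemma singular_chain_keys: "singular_chain p X c \<Longrightarrow> f \<in> Poly_Mapping.keys c \<Longrightarrow> singular_simplex p X f"
  by (auto simp: singular_chain_def)

lemma cev_coboundary:
  assumes "singular_chain (Suc p) X c"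
  shows "cev (coboundary X p \<phi>) c = cev \<phi> (chain_boundary (Suc p) c)"
proof -
  have "coboundary X p \<phi> f = cev \<phi> (\<Sum>k\<le>Suc p. frag_cmul ((-1) ^ k) (frag_of (singular_face (Suc p) k f)))"
    if "f \<in> Poly_Mapping.keys c" for f
    using singular_chain_keys[OF assms that]
    by (simp add: coboundary_def sing_simplex_eq face_eq cev_sum cev_cmul cev_add)
  then show ?thesis by (simp add: chain_boundary_def cev_frag_extend cev_def[of "coboundary X p \<phi>"])
qed

lemma cev_pullback:
  assumes "singular_chain p X c"
  shows "cev (pullback X p g \<phi>) c = cev \<phi> (chain_map p g c)"
proof -
  have "pullback X p g \<phi> f = \<phi> (simplex_map p g f)" if "f \<in> Poly_Mapping.keys c" for f
    using singular_chain_keys[OF assms that]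
    by (simp add: pullback_def sing_simplex_eq simplex_map_def std_simplex_eq)
  then show ?thesis by (simp add: chain_map_def cev_frag_extend cev_def[of "pullback X p g \<phi>"])
qed

definition cut :: "'a topology \<Rightarrow> nat \<Rightarrow> (((nat \<Rightarrow> real) \<Rightarrow> 'a) \<Rightarrow> rat) \<Rightarrow> ((nat \<Rightarrow> real) \<Rightarrow> 'a) \<Rightarrow> rat" where
  "cut X p \<phi> f = (if singular_simplex p X f then \<phi> f else 0)"

lemma cut_cochain: "cut X p \<phi> \<in> cochains X p"
  by (simp add: cut_def cochains_def sing_simplex_eq)

lemma cev_cut: "singular_chain p X c \<Longrightarrow> cev (cut X p \<phi>) c = cev \<phi> c"
  by (rule cev_cong) (simp add: cut_def singular_chain_keys)

lemma cocycles_eq: "cocycles X p = {\<phi> \<in> cochains X p. \<forall>c. is_bdry p X c \<longrightarrow> cev \<phi> c = 0}"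
proof (rule Set.set_eqI)
  fix \<phi> :: "((nat \<Rightarrow> real) \<Rightarrow> 'a) \<Rightarrow> rat"
  have "coboundary X p \<phi> = (\<lambda>_. 0) \<longleftrightarrow> (\<forall>c. is_bdry p X c \<longrightarrow> cev \<phi> c = 0)"
  proof
    assume "coboundary X p \<phi> = (\<lambda>_. 0)"
    then have "cev \<phi> (chain_boundary (Suc p) d) = 0" if "singular_chain (Suc p) X d" for d
      using cev_coboundary[OF that, of \<phi>] by (simp add: cev_def)
    then show "\<forall>c. is_bdry p X c \<longrightarrow> cev \<phi> c = 0" by (auto simp: singular_boundary)
  next
    assume a: "\<forall>c. is_bdry p X c \<longrightarrow> cev \<phi> c = 0"
    show "coboundary X p \<phi> = (\<lambda>_. 0)"
    proof
      fix f show "coboundary X p \<phi> f = 0"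
      proof (cases "singular_simplex (Suc p) X f")
        case True
        then have c: "singular_chain (Suc p) X (frag_of f)" by (simp add: singular_chain_of)
        have "cev \<phi> (chain_boundary (Suc p) (frag_of f)) = 0" using a is_bdry_boundary[OF c] by blast
        then show ?thesis using cev_coboundary[OF c, of \<phi>] by simp
      qed (simp add: coboundary_def sing_simplex_eq)
    qed
  qed
  then show "\<phi> \<in> cocycles X p \<longleftrightarrow> \<phi> \<in> {\<phi> \<in> cochains X p. \<forall>c. is_bdry p X c \<longrightarrow> cev \<phi> c = 0}"
    unfolding cocycles_def mem_Collect_eq by (rule conj_cong[OF refl])
qed

text \<open>Universal coefficients over a divisible group: the value of a cochain that kills cycles
  depends only on the boundary of the chain, and this additive function on boundaries extends to a
  cochain one degree lower.\<close>

lemma coboundaries_eq: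
  "coboundaries X (Suc p) = {\<phi> \<in> cochains X (Suc p). \<forall>c. is_cycle (Suc p) X c \<longrightarrow> cev \<phi> c = 0}"
proof (intro equalityI subsetI)
  fix \<phi> assume "\<phi> \<in> coboundaries X (Suc p)"
  then obtain \<psi> where \<phi>: "\<phi> = coboundary X p \<psi>" by (auto simp: coboundaries_def)
  have "cev \<phi> c = 0" if c: "is_cycle (Suc p) X c" for c
  proof -
    have "singular_chain (Suc p) X c" "chain_boundary (Suc p) c = 0" using c by (simp_all add: singular_cycle)
    then show ?thesis unfolding \<phi> by (simp add: cev_coboundary)
  qed
  then show "\<phi> \<in> {\<phi> \<in> cochains X (Suc p). \<forall>c. is_cycle (Suc p) X c \<longrightarrow> cev \<phi> c = 0}"
    by (simp add: \<phi> cochains_def coboundary_def)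
next
  fix \<phi> assume "\<phi> \<in> {\<phi> \<in> cochains X (Suc p). \<forall>c. is_cycle (Suc p) X c \<longrightarrow> cev \<phi> c = 0}"
  then have \<phi>: "\<And>f. \<not> singular_simplex (Suc p) X f \<Longrightarrow> \<phi> f = 0"
    and cyc: "\<And>c. is_cycle (Suc p) X c \<Longrightarrow> cev \<phi> c = 0" by (auto simp: cochains_def sing_simplex_eq)
  define G where "G = chain_boundary (Suc p) ` {c. singular_chain (Suc p) X c}"
  define u where "u = inv_into {c. singular_chain (Suc p) X c} (chain_boundary (Suc p))"
  have u: "singular_chain (Suc p) X (u b)" "chain_boundary (Suc p) (u b) = b" if "b \<in> G" for b
    using inv_into_into[OF that[unfolded G_def]] f_inv_into_f[OF that[unfolded G_def]] by (simp_all add: u_def)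
  have uc: "cev \<phi> (u (chain_boundary (Suc p) c)) = cev \<phi> c" if c: "singular_chain (Suc p) X c" for c
  proof -
    have b: "chain_boundary (Suc p) c \<in> G" using c by (simp add: G_def)
    have "is_cycle (Suc p) X (u (chain_boundary (Suc p) c) - c)"
      unfolding singular_cycle using singular_chain_diff[OF u(1)[OF b] c] u(2)[OF b] by (simp add: chain_boundary_diff)
    from cyc[OF this] show ?thesis by (simp add: cev_diff)
  qed
  have "\<exists>\<psi>. \<forall>c\<in>G. cev \<psi> c = cev \<phi> (u c)"
  proof (rule additive_extension)
    have "chain_boundary (Suc p) (0 :: 'a chain) \<in> G" unfolding G_def by (intro imageI) simp
    then show "0 \<in> G" by simp
  next
    fix a b assume ab: "a \<in> G" "b \<in> G"
    have d: "singular_chain (Suc p) X (u a - u b)" by (intro singular_chain_diff u(1) ab)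
    have bd: "chain_boundary (Suc p) (u a - u b) = a - b" by (simp add: chain_boundary_diff u(2) ab)
    then show "a - b \<in> G" unfolding G_def using d by (metis imageI mem_Collect_eq)
    show "cev \<phi> (u (a - b)) = cev \<phi> (u a) - cev \<phi> (u b)"
      using uc[OF d] bd by (simp add: cev_diff)
  qed
  then obtain \<psi> where \<psi>: "\<And>b. b \<in> G \<Longrightarrow> cev \<psi> b = cev \<phi> (u b)" by blast
  have "\<phi> f = coboundary X p (cut X p \<psi>) f" for f
  proof (cases "singular_simplex (Suc p) X f")
    case True
    then have c: "singular_chain (Suc p) X (frag_of f)" by (simp add: singular_chain_of)
    have "coboundary X p (cut X p \<psi>) f = cev (cut X p \<psi>) (chain_boundary (Suc p) (frag_of f))"
      using cev_coboundary[OF c, of "cut X p \<psi>"] by simp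
    also have "\<dots> = cev \<psi> (chain_boundary (Suc p) (frag_of f))"
      using singular_chain_boundary_alt[OF c] by (simp add: cev_cut)
    also have "\<dots> = cev \<phi> (u (chain_boundary (Suc p) (frag_of f)))" by (rule \<psi>) (simp add: G_def c)
    also have "\<dots> = \<phi> f" using uc[OF c] by simp
    finally show ?thesis by simp
  qed (simp add: \<phi> coboundary_def sing_simplex_eq)
  then show "\<phi> \<in> coboundaries X (Suc p)"
    unfolding coboundaries_def using cut_cochain[of X p \<psi>] by (auto simp: fun_eq_iff intro!: image_eqI[where x = "cut X p \<psi>"])
qed

text \<open>The functionals m become a basis of cohomology dual to the cycles t. They are additive
  functions, so \<open>additive_extension\<close> turns them into cochains, on which g acts by the
  matrix c.\<close>

lemma cohom_trace_dual:
  fixes m :: "'b \<Rightarrow> 'a chain \<Rightarrow> int"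
  assumes k: "k \<noteq> 0" and B: "finite B" and g: "continuous_map X X g"
    and t: "\<And>a. a \<in> B \<Longrightarrow> is_cycle k X (t a)"
    and mdiff: "\<And>a v w. a \<in> B \<Longrightarrow> is_cycle k X v \<Longrightarrow> is_cycle k X w \<Longrightarrow> m a (v - w) = m a v - m a w"
    and mb: "\<And>a w. a \<in> B \<Longrightarrow> is_bdry k X w \<Longrightarrow> m a w = 0"
    and mt: "\<And>a b. a \<in> B \<Longrightarrow> b \<in> B \<Longrightarrow> m a (t b) = (if a = b then 1 else 0)"
    and span: "\<And>w. is_cycle k X w \<Longrightarrow> is_bdry k X (w - (\<Sum>a\<in>B. frag_cmul (m a w) (t a)))"
    and act: "\<And>a w. a \<in> B \<Longrightarrow> is_cycle k X w \<Longrightarrow> m a (chain_map k g w) = (\<Sum>b\<in>B. m b w * c a b)"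
  shows "cohom_trace X k g = of_int (\<Sum>a\<in>B. c a a)"
proof -
  obtain e where e: "bij_betw e {..<card B} B" using ex_bij_betw_nat_finite[OF B] by (auto simp: lessThan_atLeast0)
  have eB: "e i \<in> B" if "i < card B" for i using e that by (auto simp: bij_betw_def)
  have chain: "is_cycle k X w \<Longrightarrow> singular_chain k X w" for w by (simp add: singular_cycle)
  have "\<exists>\<phi>. \<forall>w\<in>{w. is_cycle k X w}. cev \<phi> w = of_int (m a w)" if "a \<in> B" for a
    by (rule additive_extension) (simp_all add: mdiff that singular_relcycle_diff singular_relcycle_0)
  then obtain \<mu>0 where \<mu>0: "\<And>a w. a \<in> B \<Longrightarrow> is_cycle k X w \<Longrightarrow> cev (\<mu>0 a) w = of_int (m a w)"
    unfolding mem_Collect_eq Ball_def by metis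
  define \<mu> where "\<mu> a = cut X k (\<mu>0 a)" for a
  have \<mu>: "cev (\<mu> a) w = of_int (m a w)" if "a \<in> B" "is_cycle k X w" for a w
    using \<mu>0[OF that] cev_cut[OF chain[OF that(2)]] by (simp add: \<mu>_def)
  have Beq: "coboundaries X k = {\<phi> \<in> cochains X k. \<forall>c. is_cycle k X c \<longrightarrow> cev \<phi> c = 0}"
    using coboundaries_eq[of X "k - 1"] k by simp
  have lc: "cev (lin_comb r q z) w = (\<Sum>i<r. q i * cev (z i) w)" for r q and z :: "nat \<Rightarrow> _" and w :: "'a chain"
    unfolding lin_comb_def by (rule cev_fun_sum)
  have lcc: "lin_comb r q z \<in> cochains X k" if "\<And>i. i < r \<Longrightarrow> z i \<in> cochains X k" for r q z
    using that by (auto simp: lin_comb_def cochains_def intro!: sum.neutral)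
  have pc: "pullback X k g \<phi> \<in> cochains X k" for \<phi> :: "_ \<Rightarrow> rat" by (simp add: pullback_def cochains_def)
  have "quot_trace (cocycles X k) (coboundaries X k) (pullback X k g) = (\<Sum>j<card B. of_int (c (e j) (e j)))"
  proof (rule quot_trace_eq[where z = "\<lambda>i. \<mu> (e i)" and c = "\<lambda>i j. of_int (c (e i) (e j))"])
    show "(\<lambda>_. 0) \<in> coboundaries X k" by (simp add: Beq cochains_def cev_def)
  next
    fix f h assume "f \<in> coboundaries X k" "h \<in> coboundaries X k"
    then show "(\<lambda>s. f s + h s) \<in> coboundaries X k"
      by (simp add: Beq cochains_def cev_def distrib_left sum.distrib)
  next
    fix q :: rat and f assume "f \<in> coboundaries X k"
    then show "(\<lambda>s. q * f s) \<in> coboundaries X k"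
      by (simp add: Beq cochains_def cev_def mult.left_commute[of _ q] flip: sum_distrib_left)
  next
    fix r q and z :: "nat \<Rightarrow> _ \<Rightarrow> rat"
    show "pullback X k g (lin_comb r q z) = lin_comb r q (\<lambda>i. pullback X k g (z i))"
      by (auto simp: pullback_def lin_comb_def fun_eq_iff)
  next
    fix f h :: "_ \<Rightarrow> rat"
    show "pullback X k g (\<lambda>s. f s - h s) = (\<lambda>s. pullback X k g f s - pullback X k g h s)"
      by (auto simp: pullback_def fun_eq_iff)
  next
    fix f assume f: "f \<in> coboundaries X k"
    have "cev (pullback X k g f) w = 0" if "is_cycle k X w" for w
      using f is_cycle_map[OF that g] cev_pullback[OF chain[OF that], of g f] by (simp add: Beq)
    then show "pullback X k g f \<in> coboundaries X k" using pc by (simp add: Beq)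
  next
    have "\<mu> a \<in> cocycles X k" if "a \<in> B" for a
      using \<mu>[OF that is_bdry_imp_cycle] mb[OF that] by (simp add: cocycles_eq \<mu>_def cut_cochain)
    then show "\<forall>i<card B. \<mu> (e i) \<in> cocycles X k" using eB by blast
  next
    show "\<forall>a. lin_comb (card B) a (\<lambda>i. \<mu> (e i)) \<in> coboundaries X k \<longrightarrow> (\<forall>i<card B. a i = 0)"
    proof (intro allI impI)
      fix a i assume a: "lin_comb (card B) a (\<lambda>i. \<mu> (e i)) \<in> coboundaries X k" and i: "i < card B"
      have "m (e j) (t (e i)) = (if j = i then 1 else 0)" if "j < card B" for j
        using mt[OF eB[OF that] eB[OF i]] e i that by (auto simp: bij_betw_def inj_on_def)
      then have "(\<Sum>j<card B. a j * of_int (m (e j) (t (e i)))) = (\<Sum>j<card B. if j = i then a j else 0)"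
        by (intro sum.cong refl) auto
      also have "\<dots> = a i" using i by simp
      finally have "(\<Sum>j<card B. a j * of_int (m (e j) (t (e i)))) = a i" .
      moreover have "(\<Sum>j<card B. a j * cev (\<mu> (e j)) (t (e i))) = 0"
        using a t[OF eB[OF i]] by (simp add: Beq lc)
      ultimately show "a i = 0" using \<mu>[OF eB t[OF eB[OF i]]] by simp
    qed
  next
    show "\<forall>y\<in>cocycles X k. \<exists>a. (\<lambda>s. y s - lin_comb (card B) a (\<lambda>i. \<mu> (e i)) s) \<in> coboundaries X k"
    proof (intro ballI exI)
      fix y assume y: "y \<in> cocycles X k"
      let ?a = "\<lambda>i. cev y (t (e i))"
      have "cev y w - (\<Sum>i<card B. ?a i * of_int (m (e i) w)) = 0" if w: "is_cycle k X w" for w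
      proof -
        have "cev y (w - (\<Sum>a\<in>B. frag_cmul (m a w) (t a))) = 0" using y span[OF w] by (simp add: cocycles_eq)
        then have "cev y w = (\<Sum>a\<in>B. cev y (t a) * of_int (m a w))"
          by (simp add: cev_diff cev_sum cev_cmul mult.commute)
        also have "\<dots> = (\<Sum>i<card B. ?a i * of_int (m (e i) w))"
          by (rule sum.reindex_bij_betw[OF e, symmetric])
        finally show ?thesis by simp
      qed
      moreover have "(\<lambda>s. y s - lin_comb (card B) ?a (\<lambda>i. \<mu> (e i)) s) \<in> cochains X k"
        using y lcc[of "card B" "\<lambda>i. \<mu> (e i)" ?a] by (simp add: cocycles_def cochains_def \<mu>_def cut_def sing_simplex_eq)
      ultimately show "(\<lambda>s. y s - lin_comb (card B) ?a (\<lambda>i. \<mu> (e i)) s) \<in> coboundaries X k"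
        using \<mu> eB by (simp add: Beq cev_fun_diff lc)
    qed
  next
    show "\<forall>j<card B. (\<lambda>s. pullback X k g (\<mu> (e j)) s - lin_comb (card B) (\<lambda>i. of_int (c (e j) (e i))) (\<lambda>i. \<mu> (e i)) s) \<in> coboundaries X k"
    proof (intro allI impI)
      fix j assume j: "j < card B"
      let ?a = "\<lambda>i. rat_of_int (c (e j) (e i))"
      have "cev (pullback X k g (\<mu> (e j))) w - (\<Sum>i<card B. ?a i * of_int (m (e i) w)) = 0" if w: "is_cycle k X w" for w
      proof -
        have "cev (pullback X k g (\<mu> (e j))) w = of_int (\<Sum>b\<in>B. m b w * c (e j) b)"
          using cev_pullback[OF chain[OF w], of g "\<mu> (e j)"] \<mu>[OF eB[OF j] is_cycle_map[OF w g]] act[OF eB[OF j] w] by simp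
        also have "(\<Sum>b\<in>B. m b w * c (e j) b) = (\<Sum>i<card B. m (e i) w * c (e j) (e i))"
          by (rule sum.reindex_bij_betw[OF e, symmetric])
        finally show ?thesis by (simp add: mult.commute)
      qed
      moreover have "(\<lambda>s. pullback X k g (\<mu> (e j)) s - lin_comb (card B) ?a (\<lambda>i. \<mu> (e i)) s) \<in> cochains X k"
        using pc[of "\<mu> (e j)"] lcc[of "card B" "\<lambda>i. \<mu> (e i)" ?a] by (simp add: cochains_def \<mu>_def cut_def sing_simplex_eq)
      ultimately show "(\<lambda>s. pullback X k g (\<mu> (e j)) s - lin_comb (card B) ?a (\<lambda>i. \<mu> (e i)) s) \<in> coboundaries X k"
        using \<mu> eB by (simp add: Beq cev_fun_diff lc)
    qed
  qed
  also have "\<dots> = of_int (\<Sum>a\<in>B. c a a)"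
    using sum.reindex_bij_betw[OF e, of "\<lambda>a. rat_of_int (c a a)"] by simp
  finally show ?thesis by (simp add: cohom_trace_def)
qed

subsection \<open>The basis of decreasing monomials\<close>

text \<open>The evaluation of monomials on the iterated planetary class of the decreasing list g.\<close>
primrec evP :: "int \<Rightarrow> int \<Rightarrow> edge list \<Rightarrow> edge list \<Rightarrow> int" where
  "evP dl eps [] = (\<lambda>F. if F = [] then 1 else 0)"
| "evP dl eps (e # g) = contr dl eps (fst e) (snd e) (evP dl eps g)"

text \<open>The standard monomial basis: every point has at most one edge to a smaller point, and
  the edges are sorted by their larger ends.\<close>

definition Bas :: "nat set \<Rightarrow> nat \<Rightarrow> edge list set" where
  "Bas S i = {g. length g = i \<and> sorted_wrt (\<lambda>e e'. fst e' < fst e) g \<and>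
     (\<forall>e\<in>set g. snd e < fst e \<and> fst e \<in> S \<and> snd e \<in> S)}"

lemma Bas_Cons: "(x, a) # g \<in> Bas S (Suc i) \<longleftrightarrow> a < x \<and> x \<in> S \<and> a \<in> S \<and> g \<in> Bas (S \<inter> {..<x}) i"
  by (fastforce simp: Bas_def)

lemma Bas_Nil: "[] \<in> Bas S i \<longleftrightarrow> i = 0"
  by (auto simp: Bas_def)

lemma Bas_mono: "g \<in> Bas T i \<Longrightarrow> T \<subseteq> S \<Longrightarrow> g \<in> Bas S i"
  by (auto simp: Bas_def)

lemma Bas_valid: "g \<in> Bas S i \<Longrightarrow> valid S g \<and> length g = i"
  by (auto simp: Bas_def valid_def)

lemma finite_Bas: assumes "finite S" shows "finite (Bas S i)"
proof (rule finite_subset)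
  show "Bas S i \<subseteq> {g. set g \<subseteq> S \<times> S \<and> length g = i}" by (force simp: Bas_def)
  show "finite {g. set g \<subseteq> S \<times> S \<and> length g = i}" using assms by (intro finite_lists_length_eq) simp
qed

lemma contr_verts:
  assumes "contr dl eps x a e F \<noteq> 0" "\<And>G. e G \<noteq> 0 \<Longrightarrow> verts G = V"
  shows "verts F = {x, a} \<union> V"
proof -
  obtain s where s: "s < length F" "wt dl x a (F ! s) * eps ^ s * e (rl (sbv x a) (take s F @ drop (Suc s) F)) \<noteq> 0"
    using assms(1) unfolding contr_sum by (metis (no_types, lifting) lessThan_iff sum.neutral)
  then have f: "F ! s = (x, a) \<or> F ! s = (a, x)" and e: "e (rl (sbv x a) (take s F @ drop (Suc s) F)) \<noteq> 0"
    by (auto simp: wt_def split: if_splits)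
  let ?R = "take s F @ drop (Suc s) F"
  have V: "sbv x a ` verts ?R = V" using assms(2)[OF e] by (simp only: verts_rl)
  have "F = take s F @ F ! s # drop (Suc s) F" using s(1) by (rule id_take_nth_drop)
  then have "verts F = verts (take s F @ F ! s # drop (Suc s) F)" by (rule arg_cong)
  also have "\<dots> = {x, a} \<union> verts ?R" using f by auto
  also have "\<dots> = {x, a} \<union> sbv x a ` verts ?R" unfolding sbv_def by force
  finally show ?thesis by (simp only: V)
qed

lemma evP_verts: "evP dl eps g F \<noteq> 0 \<Longrightarrow> verts F = verts g"
proof (induction g arbitrary: F)
  case (Cons e g)
  show ?case using contr_verts[OF Cons.prems[simplified] Cons.IH] by simp
qed (simp split: if_splits)

text \<open>If the leading points x and y differ, the larger one occurs on one side only and the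
  value is zero. If they agree, x occurs in h only at its head, so contraction compares the heads
  and passes to the tails.\<close>

lemma evP_Bas: "g \<in> Bas S i \<Longrightarrow> h \<in> Bas S i \<Longrightarrow> evP dl eps g h = (if g = h then 1 else 0)"
proof (induction g arbitrary: h S i)
  case Nil then show ?case by (auto simp: Bas_def)
next
  case (Cons e g)
  obtain x a where e: "e = (x, a)" by force
  obtain j where i: "i = Suc j" using Cons.prems(1) by (auto simp: Bas_def)
  obtain f h' where h0: "h = f # h'" using Cons.prems(2) i by (cases h) (auto simp: Bas_def)
  obtain y b where f: "f = (y, b)" by force
  note h = h0[unfolded f]
  have g: "a < x" "x \<in> S" "a \<in> S" "g \<in> Bas (S \<inter> {..<x}) j" using Cons.prems(1) unfolding e i Bas_Cons by auto
  have h': "b < y" "y \<in> S" "b \<in> S" "h' \<in> Bas (S \<inter> {..<y}) j" using Cons.prems(2) unfolding h i Bas_Cons by auto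
  have vg: "verts g \<subseteq> {..<x}" and vh: "verts h' \<subseteq> {..<y}"
    using valid_verts[OF conjunct1[OF Bas_valid[OF g(4)]]] valid_verts[OF conjunct1[OF Bas_valid[OF h'(4)]]] by auto
  consider "y < x" | "y = x" | "x < y" by linarith
  then show ?case
  proof cases
    case 1
    then have "x \<notin> verts h" using vh h'(1) by (auto simp: h)
    then show ?thesis using contr_no_vertex 1 by (auto simp: e h)
  next
    case 2
    have x: "x \<notin> verts h'" using vh 2 by auto
    have "del_op eps (wt dl x a) G h' = 0" for G
      using x by (intro del_op_zero_wt) (force simp: wt_def verts_def)
    moreover have "rl (sbv x a) h' = h'" using x by (intro rl_ident) (auto simp: sbv_def)
    moreover have "evP dl eps g h' = (if g = h' then 1 else 0)" using Cons.IH g(4) h'(4) 2 by blast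
    ultimately show ?thesis using 2 h'(1) by (simp add: e h contr_def wt_def)
  next
    case 3
    have "contr dl eps x a (evP dl eps g) h = 0"
    proof (rule contr_zeroI[of "{y}"])
      show "evP dl eps g G = 0" if "{y} \<subseteq> verts G" for G
        using evP_verts[of dl eps g G] that vg 3 by force
    qed (use 3 g(1) in \<open>auto simp: h\<close>)
    then show ?thesis using 3 by (auto simp: e h)
  qed
qed

context punctured
begin

text \<open>Adding points far away does not change a functional, as it already vanishes on every
  monomial that contains them.\<close>

lemma Efam_mono:
  assumes "finite S" "T \<subseteq> S" "e \<in> Efam T i"
  shows "e \<in> Efam S i"
proof -
  have "e \<in> Efam (T \<union> U) i" if "finite U" for U
    using that
  proof (induction U)
    case empty show ?case using assms(3) by simp
  next
    case (insert u U)
    show ?case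
    proof (cases "u \<in> T")
      case True then show ?thesis using insert by (simp add: insert_absorb)
    next
      case False
      then have u: "u \<notin> T \<union> U" using insert by simp
      have "finite (T \<union> U)" using finite_subset[OF assms(2,1)] insert by simp
      from fam.E_avoid[OF this u insert.IH] show ?thesis
        by (simp add: fam.avoid_ident[OF insert.IH u])
    qed
  qed
  from this[OF assms(1)] show ?thesis using assms(2) by (simp add: Un_absorb1)
qed

lemma evP_in_Efam: "finite S \<Longrightarrow> g \<in> Bas S i \<Longrightarrow> evP dl0 eps0 g \<in> Efam S i"
proof (induction g arbitrary: S i)
  case Nil
  then have "i = 0" by (simp add: Bas_Nil)
  then show ?case using Efam_mono[OF Nil(1) _ fam.E_unit] by simp
next
  case (Cons e g)
  obtain x a where e: "e = (x, a)" by force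
  obtain j where i: "i = Suc j" using Cons.prems(2) by (auto simp: Bas_def)
  have g: "a < x" "x \<in> S" "a \<in> S" "g \<in> Bas (S \<inter> {..<x}) j" using Cons.prems(2) unfolding e i Bas_Cons by auto
  have "contr dl0 eps0 x a (evP dl0 eps0 g) \<in> Efam (insert x (S \<inter> {..<x})) (Suc j)"
    using Cons.prems(1) g by (intro fam.E_contr Cons.IH) auto
  from Efam_mono[OF Cons.prems(1) _ this] show ?case using g(2) by (simp add: e i)
qed

text \<open>When the largest point m is removed, only residues along smaller b are tested, and a
  head (m, b) prolongs a basis monomial to a basis monomial.\<close>

lemma Bas_separation:
  "finite S \<Longrightarrow> is_cycle (i * D) (CSd S) w \<Longrightarrow> (\<And>g. g \<in> Bas S i \<Longrightarrow> mon g w = 0) \<Longrightarrow> is_bdry (i * D) (CSd S) w"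
proof (induction S arbitrary: i w rule: finite_linorder_max_induct)
  case empty
  show ?case
  proof (rule separation[OF _ empty(1)])
    fix F assume "valid {} F" "length F = i"
    then show "mon F w = 0" using empty(2)[of F] by (cases F) (auto simp: Bas_Nil)
  qed simp
next
  case (insert m S)
  have m: "m \<notin> S" using insert.hyps(2) by blast
  show ?case
  proof (rule add_point_inj'[OF insert.hyps(1) m insert.prems(1)])
    show "is_bdry (i * D) (CSd S) (chain_map (i * D) (\<lambda>y. restrict y S) w)"
    proof (rule insert.IH)
      show "is_cycle (i * D) (CSd S) (chain_map (i * D) (\<lambda>y. restrict y S) w)"
        by (intro is_cycle_map[OF insert.prems(1)] continuous_map_CS_restrict) auto
      fix g assume g: "g \<in> Bas S i"
      have "mon g w = 0" using insert.prems(2)[OF Bas_mono[OF g]] by blast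
      then show "mon g (chain_map (i * D) (\<lambda>y. restrict y S) w) = 0"
        using mon_restrict[of S g w] Bas_valid[OF g] by metis
    qed
  next
    fix j b assume j: "i = Suc j" and b: "b \<in> S"
    note w = insert.prems(1)[unfolded j]
    have R: "ResR (CSd S) (enumd :: 'd list) (Suc j * D) (chain_map (Suc j * D) (qd S m b) w)
       (resc (CSd S) (Suc j * D) (chain_map (Suc j * D) (qd S m b) w))"
      and c: "is_cycle (j * D) (CSd S) (resc (CSd S) (Suc j * D) (chain_map (Suc j * D) (qd S m b) w))"
      by (rule resc_qd[OF m b w])+
    have "is_bdry (j * D) (CSd S) (resc (CSd S) (Suc j * D) (chain_map (Suc j * D) (qd S m b) w))"
    proof (rule insert.IH[OF c])
      fix g assume g: "g \<in> Bas S j"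
      have v: "valid S g" and l: "length g = j" using Bas_valid[OF g] by auto
      have "S \<subseteq> insert m S \<inter> {..<m}" using insert.hyps(2) by auto
      then have "(m, b) # g \<in> Bas (insert m S) (Suc j)"
        unfolding Bas_Cons using b insert.hyps(2) Bas_mono[OF g] by blast
      then have "mon ((m, b) # g) w = 0" using insert.prems(2) j by blast
      moreover have "mon ((m, b) # g) w = mon g (resc (CSd S) (Suc j * D) (chain_map (Suc j * D) (qd S m b) w))"
        by (rule mon_Cons[OF v m b]) (simp_all only: l w R)
      ultimately show "mon g (resc (CSd S) (Suc j * D) (chain_map (Suc j * D) (qd S m b) w)) = 0" by simp
    qed
    then show "is_bdry (j * D) (CSd S) (resc (CSd S) (i * D) (chain_map (i * D) (qd S m b) w))" by (simp only: j)
  qed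
qed

text \<open>Cycles realizing the functionals \<open>evP dl0 eps0 h\<close> are dual to the basis
  monomials and expand the permuted monomial \<open>rl \<sigma> g\<close>; the trace collects the
  coefficients with h = g.\<close>

theorem conf_char_eq:
  assumes i: "0 < i" and \<sigma>: "\<sigma> permutes {..<n}"
  shows "conf_char TYPE(real^'d) n (i * D) \<sigma> = of_int (\<Sum>g\<in>Bas {..<n} i. evP dl0 eps0 g (rl \<sigma> g))"
proof -
  let ?X = "CSd {..<n}" and ?B = "Bas {..<n} i"
  have "\<exists>t. is_cycle (i * D) ?X t \<and> evl {..<n} i t = evP dl0 eps0 g" if "g \<in> ?B" for g
  proof -
    have "evP dl0 eps0 g \<in> Efam {..<n} i" by (rule evP_in_Efam[OF finite_lessThan that])
    then show ?thesis unfolding Efam_def mem_Collect_eq by metis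
  qed
  then obtain t where t: "\<And>g. g \<in> ?B \<Longrightarrow> is_cycle (i * D) ?X (t g)" "\<And>g. g \<in> ?B \<Longrightarrow> evl {..<n} i (t g) = evP dl0 eps0 g"
    by metis
  have mt: "mon F (t g) = evP dl0 eps0 g F" if "valid {..<n} F" "length F = i" "g \<in> ?B" for F g
    using fun_cong[OF t(2)[OF that(3)], of F] evl_apply[OF that(1,2)] by simp
  have sc: "is_cycle (i * D) ?X (\<Sum>g\<in>?B. frag_cmul (mon g w) (t g))" for w
    by (intro singular_relcycle_sum singular_relcycle_cmul t)
  have expand: "mon F (\<Sum>g\<in>?B. frag_cmul (mon g w) (t g)) = (\<Sum>g\<in>?B. mon g w * evP dl0 eps0 g F)"
    if F: "valid {..<n} F" "length F = i" for F w
  proof -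
    have "mon F (\<Sum>g\<in>?B. frag_cmul (mon g w) (t g)) = (\<Sum>g\<in>?B. mon F (frag_cmul (mon g w) (t g)))"
      by (rule mon_sum[OF F(1) finite_Bas[OF finite_lessThan]]) (simp only: F(2) singular_relcycle_cmul t(1))
    also have "\<dots> = (\<Sum>g\<in>?B. mon g w * evP dl0 eps0 g F)"
    proof (rule sum.cong[OF refl])
      fix g assume g: "g \<in> ?B"
      have "mon F (frag_cmul (mon g w) (t g)) = mon g w * mon F (t g)"
        by (rule mon_cmul[OF F(1)]) (simp only: F(2) t(1)[OF g])
      then show "mon F (frag_cmul (mon g w) (t g)) = mon g w * evP dl0 eps0 g F" by (simp only: mt[OF F g])
    qed
    finally show ?thesis .
  qed
  have span: "is_bdry (i * D) ?X (w - (\<Sum>g\<in>?B. frag_cmul (mon g w) (t g)))" if w: "is_cycle (i * D) ?X w" for w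
  proof (rule Bas_separation[OF finite_lessThan singular_relcycle_diff[OF w sc]])
    fix h assume h: "h \<in> ?B"
    have v: "valid {..<n} h" "length h = i" using Bas_valid[OF h] by auto
    have "mon h (w - (\<Sum>g\<in>?B. frag_cmul (mon g w) (t g))) = mon h w - (\<Sum>g\<in>?B. mon g w * evP dl0 eps0 g h)"
      unfolding expand[OF v, symmetric] by (rule mon_diff[OF v(1)]) (simp_all only: v(2) w sc)
    also have "(\<Sum>g\<in>?B. mon g w * evP dl0 eps0 g h) = (\<Sum>g\<in>?B. if g = h then mon g w else 0)"
      using evP_Bas[OF _ h] by (intro sum.cong refl) simp
    also have "\<dots> = mon h w" using h finite_Bas[OF finite_lessThan] by (simp add: sum.delta)
    finally show "mon h (w - (\<Sum>g\<in>?B. frag_cmul (mon g w) (t g))) = 0" by simp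
  qed
  have cont: "continuous_map ?X ?X (\<lambda>x. x \<circ> \<sigma>)"
    unfolding continuous_map_CS
  proof (intro conjI ballI image_subsetI)
    fix x :: "nat \<Rightarrow> real^'d" assume x: "x \<in> topspace ?X"
    show "x \<circ> \<sigma> \<in> extensional {..<n}"
      using x \<sigma> by (auto simp: topspace_CS extensional_def permutes_def)
    show "inj_on (x \<circ> \<sigma>) {..<n}"
      using x permutes_inj_on[OF \<sigma>] permutes_image[OF \<sigma>] by (intro comp_inj_on) (auto simp: topspace_CS)
  next
    fix a assume "a \<in> {..<n}"
    then have "\<sigma> a \<in> {..<n}" using permutes_in_image[OF \<sigma>] by blast
    then show "continuous_map ?X euclidean (\<lambda>x. (x \<circ> \<sigma>) a)" unfolding o_def by (rule continuous_map_CS_nth)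
  qed
  have "cohom_trace ?X (i * D) (\<lambda>x. x \<circ> \<sigma>) = of_int (\<Sum>g\<in>?B. evP dl0 eps0 g (rl \<sigma> g))"
  proof (rule cohom_trace_dual[where t = t and m = mon and c = "\<lambda>g h. evP dl0 eps0 h (rl \<sigma> g)"])
    show "i * D \<noteq> 0" using i D_pos by simp
  next
    fix g assume g: "g \<in> ?B"
    have v: "valid {..<n} g" "length g = i" using Bas_valid[OF g] by auto
    show "mon g (v - w) = mon g v - mon g w" if "is_cycle (i * D) ?X v" "is_cycle (i * D) ?X w" for v w
      by (rule mon_diff[OF v(1)]) (simp_all only: v(2) that)
    show "mon g w = 0" if "is_bdry (i * D) ?X w" for w
      by (rule mon_bdry[OF v(1)]) (simp_all only: v(2) that)
    show "mon g (t h) = (if g = h then 1 else 0)" if h: "h \<in> ?B" for h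
      using mt[OF v h] evP_Bas[OF h g] by auto
    fix w assume w: "is_cycle (i * D) ?X w"
    have v': "valid {..<n} (rl \<sigma> g)" "length (rl \<sigma> g) = i"
      using valid_rl[OF v(1) permutes_inj_on[OF \<sigma>]] permutes_image[OF \<sigma>] v(2) by auto
    have "mon g (chain_map (i * D) (\<lambda>x. x \<circ> \<sigma>) w) = mon (rl \<sigma> g) w"
      using mon_rl[OF \<sigma>, of g w] by (simp only: v(2))
    also have "\<dots> = mon (rl \<sigma> g) (\<Sum>h\<in>?B. frag_cmul (mon h w) (t h))"
    proof -
      have "mon (rl \<sigma> g) (w - (\<Sum>h\<in>?B. frag_cmul (mon h w) (t h))) = 0"
        by (rule mon_bdry[OF v'(1)]) (simp only: v'(2) span[OF w])
      moreover have "mon (rl \<sigma> g) (w - (\<Sum>h\<in>?B. frag_cmul (mon h w) (t h))) =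
          mon (rl \<sigma> g) w - mon (rl \<sigma> g) (\<Sum>h\<in>?B. frag_cmul (mon h w) (t h))"
        by (rule mon_diff[OF v'(1)]) (simp_all only: v'(2) w sc)
      ultimately show ?thesis by simp
    qed
    also have "\<dots> = (\<Sum>h\<in>?B. mon h w * evP dl0 eps0 h (rl \<sigma> g))" by (rule expand[OF v'])
    finally show "mon g (chain_map (i * D) (\<lambda>x. x \<circ> \<sigma>) w) = (\<Sum>h\<in>?B. mon h w * evP dl0 eps0 h (rl \<sigma> g))" .
  qed (use t(1) span finite_Bas[OF finite_lessThan] cont in \<open>blast+\<close>)
  then show ?thesis by (simp add: conf_char_def conf_top_def CS_def)
qed

end

subsection \<open>Tabloids and their stabilizers\<close>

definition Stab :: "nat set \<Rightarrow> (nat \<Rightarrow> nat) \<Rightarrow> (nat \<Rightarrow> nat) set" where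
  "Stab V t = {\<alpha>. \<alpha> permutes V \<and> (\<forall>x\<in>V. t (\<alpha> x) = t x)}"

text \<open>Integer valued, since the row lengths occurring in the Jacobi--Trudi formula may be
  negative.\<close>

definition fib :: "nat set \<Rightarrow> (nat \<Rightarrow> nat) \<Rightarrow> nat \<Rightarrow> int" where
  "fib V t j = int (card {x\<in>V. t x = j})"

definition Tabs :: "nat set \<Rightarrow> nat \<Rightarrow> (nat \<Rightarrow> int) \<Rightarrow> (nat \<Rightarrow> nat) set" where
  "Tabs V L \<mu> = {t \<in> V \<rightarrow>\<^sub>E {..<L}. \<forall>j<L. fib V t j = \<mu> j}"

lemma finite_Stab: "finite V \<Longrightarrow> finite (Stab V t)"
  by (rule finite_subset[OF _ finite_permutations[of V]]) (auto simp: Stab_def)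

lemma finite_Tabs: "finite V \<Longrightarrow> finite (Tabs V L \<mu>)"
  by (rule finite_subset[of _ "V \<rightarrow>\<^sub>E {..<L}"]) (auto simp: Tabs_def intro: finite_PiE)

lemma Stab_cong: assumes "\<And>x. x \<in> V \<Longrightarrow> t x = u x" shows "Stab V t = Stab V u"
  using assms permutes_in_image by (fastforce simp: Stab_def)

lemma fib_cong: "(\<And>x. x \<in> V \<Longrightarrow> t x = u x) \<Longrightarrow> fib V t j = fib V u j"
  unfolding fib_def by (intro arg_cong[where f = int] arg_cong[where f = card]) auto

lemma sum_fib:
  assumes "finite V" "t \<in> V \<rightarrow> {..<L}"
  shows "(\<Sum>j<L. fib V t j) = int (card V)"
proof -
  have "(\<Sum>j<L. \<Sum>x\<in>{x\<in>V. t x = j}. 1) = (\<Sum>x\<in>V. 1::int)"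
    using assms by (intro sum.group) auto
  then show ?thesis by (simp add: fib_def)
qed

lemma fib_Un: "finite V \<Longrightarrow> finite U \<Longrightarrow> V \<inter> U = {} \<Longrightarrow> fib (V \<union> U) t j = fib V t j + fib U t j"
proof -
  assume a: "finite V" "finite U" "V \<inter> U = {}"
  have "{x \<in> V \<union> U. t x = j} = {x \<in> V. t x = j} \<union> {x \<in> U. t x = j}" by auto
  then have "card {x \<in> V \<union> U. t x = j} = card {x \<in> V. t x = j} + card {x \<in> U. t x = j}"
    using a by (simp add: card_Un_disjoint disjoint_iff)
  then show ?thesis by (simp add: fib_def)
qed

lemma Tabs_nonempty:
  assumes "finite U" "\<forall>j<L. 0 \<le> \<rho> j" "(\<Sum>j<L. \<rho> j) = int (card U)"
  shows "\<exists>t. t \<in> Tabs U L \<rho>"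
  using assms
proof (induction U arbitrary: \<rho>)
  case empty
  then have "\<forall>j<L. \<rho> j = 0" using sum_nonneg_eq_0_iff[of "{..<L}" \<rho>] by auto
  then show ?case by (auto simp: Tabs_def fib_def)
next
  case (insert u U)
  have "\<exists>k<L. 0 < \<rho> k"
  proof (rule ccontr)
    assume "\<not> ?thesis"
    then have "(\<Sum>j<L. \<rho> j) \<le> 0" by (intro sum_nonpos) force
    then show False using insert by simp
  qed
  then obtain k where k: "k < L" "0 < \<rho> k" by blast
  let ?r = "\<rho>(k := \<rho> k - 1)"
  have "(\<Sum>j<L. \<rho> j) = \<rho> k + (\<Sum>j\<in>{..<L} - {k}. \<rho> j)" "(\<Sum>j<L. ?r j) = \<rho> k - 1 + (\<Sum>j\<in>{..<L} - {k}. \<rho> j)"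
    using k(1) by (simp_all add: sum.remove[of _ k])
  then have "(\<Sum>j<L. ?r j) = int (card U)" using insert by simp
  moreover have r0: "\<forall>j<L. 0 \<le> ?r j" using insert.prems(1) k(2) by simp
  ultimately obtain t where t: "t \<in> Tabs U L ?r" using insert.IH[of ?r] r0 by blast
  have "fib (insert u U) (t(u := k)) j = \<rho> j" if "j < L" for j
  proof -
    have "fib ({u} \<union> U) (t(u := k)) j = fib {u} (t(u := k)) j + fib U (t(u := k)) j"
      using insert by (intro fib_Un) auto
    also have "fib U (t(u := k)) j = fib U t j" using insert by (intro fib_cong) auto
    also have "fib U t j = ?r j" using t that by (simp add: Tabs_def)
    also have "fib {u} (t(u := k)) j = (if j = k then 1 else 0)"
    proof -
      have "{x \<in> {u}. (t(u := k)) x = j} = (if j = k then {u} else {})" by auto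
      then show ?thesis by (simp add: fib_def)
    qed
    also have "(if j = k then 1 else 0) + ?r j = \<rho> j" by simp
    finally show ?thesis by (simp only: insert_is_Un[symmetric])
  qed
  moreover have "t(u := k) \<in> insert u U \<rightarrow>\<^sub>E {..<L}" using t k by (auto simp: Tabs_def PiE_def extensional_def)
  ultimately show ?case unfolding Tabs_def by blast
qed

lemma Tabs_transitive:
  assumes "finite U" "t \<in> Tabs U L \<rho>" "u \<in> Tabs U L \<rho>"
  shows "\<exists>\<gamma>. \<gamma> permutes U \<and> (\<forall>x\<in>U. u x = t (\<gamma> x))"
proof -
  have "image_mset u (mset_set U) = image_mset t (mset_set U)"
  proof (rule multiset_eqI)
    fix j
    have c: "count (image_mset v (mset_set U)) j = card {x\<in>U. v x = j}" for v :: "nat \<Rightarrow> nat"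
      using assms(1) by (simp add: count_image_mset' vimage_def Int_def conj_commute eq_commute cong: conj_cong)
    have "card {x\<in>U. u x = j} = card {x\<in>U. t x = j}"
    proof (cases "j < L")
      case True
      then have "fib U u j = fib U t j" using assms(2,3) by (simp add: Tabs_def)
      then show ?thesis by (simp add: fib_def)
    next
      case False
      then have "{x\<in>U. u x = j} = {}" "{x\<in>U. t x = j} = {}" using assms(2,3) by (auto simp: Tabs_def PiE_def Pi_def)
      then show ?thesis by (simp only:)
    qed
    then show "count (image_mset u (mset_set U)) j = count (image_mset t (mset_set U)) j" by (simp only: c)
  qed
  from image_mset_eq_implies_permutes[OF assms(1) this] show ?thesis by metis
qed

text \<open>The permutations of U act transitively on the tabloids, and those that carry a fixed
  tabloid to t form a coset of the stabilizer of t.\<close>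

lemma sum_card_Stab:
  assumes U: "finite U" and "\<forall>j<L. 0 \<le> \<rho> j" "(\<Sum>j<L. \<rho> j) = int (card U)"
  shows "(\<Sum>t\<in>Tabs U L \<rho>. card (Stab U t)) = fact (card U)"
proof -
  obtain t0 where t0: "t0 \<in> Tabs U L \<rho>" using Tabs_nonempty[OF assms] by blast
  define act where "act \<beta> = restrict (t0 \<circ> \<beta>) U" for \<beta> :: "nat \<Rightarrow> nat"
  have act: "act \<beta> \<in> Tabs U L \<rho>" if b: "\<beta> permutes U" for \<beta>
  proof -
    have "fib U (act \<beta>) j = fib U t0 j" for j
    proof -
      have "bij_betw \<beta> {x\<in>U. t0 (\<beta> x) = j} {x\<in>U. t0 x = j}"
        unfolding bij_betw_def
      proof (intro conjI equalityI subsetI)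
        show "inj_on \<beta> {x\<in>U. t0 (\<beta> x) = j}" using permutes_inj_on[OF b] by (auto simp: inj_on_def)
        show "y \<in> {x\<in>U. t0 x = j}" if "y \<in> \<beta> ` {x\<in>U. t0 (\<beta> x) = j}" for y
          using that permutes_in_image[OF b] by auto
        show "y \<in> \<beta> ` {x\<in>U. t0 (\<beta> x) = j}" if y: "y \<in> {x\<in>U. t0 x = j}" for y
        proof -
          obtain x where "x \<in> U" "y = \<beta> x" using permutes_image[OF b] y by blast
          then show ?thesis using y by blast
        qed
      qed
      from bij_betw_same_card[OF this] have "fib U (t0 \<circ> \<beta>) j = fib U t0 j" by (simp add: fib_def)
      then show ?thesis using fib_cong[of U "act \<beta>" "t0 \<circ> \<beta>" j] by (simp add: act_def)
    qed
    then show ?thesis using t0 permutes_in_image[OF b] by (auto simp: Tabs_def act_def PiE_def Pi_def)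
  qed
  have fibre: "card {\<beta>. \<beta> permutes U \<and> act \<beta> = t} = card (Stab U t)" if t: "t \<in> Tabs U L \<rho>" for t
  proof -
    obtain \<gamma> where \<gamma>: "\<gamma> permutes U" "\<And>x. x \<in> U \<Longrightarrow> t x = t0 (\<gamma> x)" using Tabs_transitive[OF U t0 t] by blast
    have ac: "act \<beta> = t \<longleftrightarrow> (\<forall>x\<in>U. t0 (\<beta> x) = t x)" for \<beta>
    proof
      assume "act \<beta> = t"
      then show "\<forall>x\<in>U. t0 (\<beta> x) = t x" by (auto simp: act_def)
    next
      assume "\<forall>x\<in>U. t0 (\<beta> x) = t x"
      then show "act \<beta> = t" using t by (intro extensionalityI[of _ U]) (auto simp: act_def Tabs_def PiE_def)
    qed
    have "bij_betw (\<lambda>\<alpha>. \<gamma> \<circ> \<alpha>) (Stab U t) {\<beta>. \<beta> permutes U \<and> act \<beta> = t}"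
    proof (rule bij_betw_byWitness[where f' = "\<lambda>\<beta>. inv_into UNIV \<gamma> \<circ> \<beta>"])
      show "\<forall>a\<in>Stab U t. inv_into UNIV \<gamma> \<circ> (\<gamma> \<circ> a) = a"
        using permutes_inv_o(2)[OF \<gamma>(1)] by (simp flip: comp_assoc)
      show "\<forall>b\<in>{\<beta>. \<beta> permutes U \<and> act \<beta> = t}. \<gamma> \<circ> (inv_into UNIV \<gamma> \<circ> b) = b"
        using permutes_inv_o(1)[OF \<gamma>(1)] by (simp flip: comp_assoc)
      show "(\<lambda>\<alpha>. \<gamma> \<circ> \<alpha>) ` Stab U t \<subseteq> {\<beta>. \<beta> permutes U \<and> act \<beta> = t}"
      proof (intro image_subsetI CollectI conjI)
        fix a assume a: "a \<in> Stab U t"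
        then show "\<gamma> \<circ> a permutes U" using \<gamma>(1) by (simp add: Stab_def permutes_compose)
        have "t0 ((\<gamma> \<circ> a) x) = t x" if "x \<in> U" for x
          using a that \<gamma>(2)[of "a x"] permutes_in_image[of a U x] by (auto simp: Stab_def)
        then show "act (\<gamma> \<circ> a) = t" unfolding ac by blast
      qed
      show "(\<lambda>\<beta>. inv_into UNIV \<gamma> \<circ> \<beta>) ` {\<beta>. \<beta> permutes U \<and> act \<beta> = t} \<subseteq> Stab U t"
      proof (intro image_subsetI)
        fix b assume "b \<in> {\<beta>. \<beta> permutes U \<and> act \<beta> = t}"
        then have b: "b permutes U" "\<And>x. x \<in> U \<Longrightarrow> t0 (b x) = t x" unfolding ac by auto
        have "t ((inv_into UNIV \<gamma> \<circ> b) x) = t x" if x: "x \<in> U" for x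
        proof -
          have "inv_into UNIV \<gamma> (b x) \<in> U" using x permutes_in_image[OF b(1)] permutes_in_image[OF permutes_inv[OF \<gamma>(1)]] by simp
          then have "t (inv_into UNIV \<gamma> (b x)) = t0 (b x)" using \<gamma> permutes_inverses(1)[OF \<gamma>(1)] by simp
          then show ?thesis using b(2)[OF x] by simp
        qed
        then show "inv_into UNIV \<gamma> \<circ> b \<in> Stab U t"
          using permutes_compose[OF b(1) permutes_inv[OF \<gamma>(1)]] by (simp add: Stab_def)
      qed
    qed
    then show ?thesis by (rule bij_betw_same_card[symmetric])
  qed
  have "(\<Sum>t\<in>Tabs U L \<rho>. \<Sum>\<beta> | \<beta> \<in> {\<beta>. \<beta> permutes U} \<and> act \<beta> = t. 1) = (\<Sum>\<beta> | \<beta> permutes U. 1::nat)"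
    using act U by (intro sum.group) (auto simp: finite_permutations finite_Tabs)
  then have "(\<Sum>t\<in>Tabs U L \<rho>. card {\<beta>. \<beta> permutes U \<and> act \<beta> = t}) = card {\<beta>. \<beta> permutes U}" by simp
  also have "\<dots> = fact (card U)" using U by (simp add: card_permutations)
  finally show ?thesis using fibre by simp
qed

subsection \<open>Restricting the trace to the moved points\<close>

text \<open>Only permutations that preserve the vertices of g contribute to the trace at g, so that the
  permutations of the other points can be counted separately.\<close>
definition ssum :: "int \<Rightarrow> int \<Rightarrow> nat set \<Rightarrow> (nat \<Rightarrow> nat) \<Rightarrow> edge list \<Rightarrow> int" where
  "ssum dl eps V t g = (\<Sum>\<alpha>\<in>Stab V t. evP dl eps g (rl \<alpha> g))"

lemma ssum_cong: "(\<And>x. x \<in> V \<Longrightarrow> t x = u x) \<Longrightarrow> ssum dl eps V t g = ssum dl eps V u g"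
  unfolding ssum_def by (simp only: Stab_cong[of V t u])

text \<open>A permutation moving the vertex set V produces a monomial with other vertices, on which
  \<open>evP dl eps g\<close> is zero. The others are pairs of a permutation of V and one of the
  complement, and only the first affects the value.\<close>

lemma ssum_split:
  assumes W: "finite W" "V \<subseteq> W" and V: "verts g = V"
  shows "ssum dl eps W t g = ssum dl eps V t g * int (card (Stab (W - V) t))"
proof -
  let ?U = "W - V"
  define cutp where "cutp A \<sigma> x = (if x \<in> A then \<sigma> x else x)" for A :: "nat set" and \<sigma> :: "nat \<Rightarrow> nat" and x
  have fV: "finite V" using finite_subset[OF W(2,1)] .
  have cutp: "cutp A \<sigma> permutes A" if "\<sigma> ` A = A" "inj \<sigma>" for A \<sigma>
  proof (rule bij_imp_permutes)
    have "bij_betw \<sigma> A A" using that by (auto simp: bij_betw_def inj_on_def)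
    then show "bij_betw (cutp A \<sigma>) A A" by (rule iffD1[OF bij_betw_cong, rotated]) (simp add: cutp_def)
  qed (simp add: cutp_def)
  have "ssum dl eps W t g = (\<Sum>\<sigma>\<in>{\<sigma>\<in>Stab W t. \<sigma> ` V = V}. evP dl eps g (rl \<sigma> g))"
    unfolding ssum_def
  proof (rule sum.mono_neutral_right)
    show "\<forall>\<sigma>\<in>Stab W t - {\<sigma>\<in>Stab W t. \<sigma> ` V = V}. evP dl eps g (rl \<sigma> g) = 0"
      using evP_verts[of dl eps g] V by (metis (mono_tags, lifting) DiffE mem_Collect_eq verts_rl)
  qed (auto intro: finite_Stab W)
  also have "\<dots> = (\<Sum>(\<alpha>, \<beta>)\<in>Stab V t \<times> Stab ?U t. evP dl eps g (rl \<alpha> g))"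
  proof (rule sum.reindex_bij_witness[where j = "\<lambda>\<sigma>. (cutp V \<sigma>, cutp ?U \<sigma>)" and i = "\<lambda>(\<alpha>, \<beta>). \<alpha> \<circ> \<beta>"])
    fix \<sigma> assume "\<sigma> \<in> {\<sigma>\<in>Stab W t. \<sigma> ` V = V}"
    then have s: "\<sigma> permutes W" "\<And>x. x \<in> W \<Longrightarrow> t (\<sigma> x) = t x" "\<sigma> ` V = V" by (auto simp: Stab_def)
    have inj: "inj \<sigma>" using s(1) by (rule permutes_inj)
    have sU: "\<sigma> ` ?U = ?U" using image_set_diff[OF inj, of W V] permutes_image[OF s(1)] s(3) by simp
    show "(\<lambda>(\<alpha>, \<beta>). \<alpha> \<circ> \<beta>) (cutp V \<sigma>, cutp ?U \<sigma>) = \<sigma>"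
    proof
      fix x
      consider "x \<in> V" | "x \<in> ?U" | "x \<notin> W" using W(2) by blast
      then show "(\<lambda>(\<alpha>, \<beta>). \<alpha> \<circ> \<beta>) (cutp V \<sigma>, cutp ?U \<sigma>) x = \<sigma> x"
      proof cases
        case 1 then show ?thesis by (simp add: cutp_def)
      next
        case 2
        then have "\<sigma> x \<in> ?U" using sU by blast
        then show ?thesis using 2 by (simp add: cutp_def)
      next
        case 3
        then have "x \<notin> V" "\<sigma> x = x" using W(2) permutes_not_in[OF s(1)] by auto
        then show ?thesis using 3 by (simp add: cutp_def)
      qed
    qed
    show "(cutp V \<sigma>, cutp ?U \<sigma>) \<in> Stab V t \<times> Stab ?U t"
      using cutp[OF s(3) inj] cutp[OF sU inj] s(2) W(2) by (auto simp: Stab_def cutp_def)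
    have "rl (cutp V \<sigma>) g = rl \<sigma> g" by (rule rl_cong) (simp add: cutp_def V)
    then show "(\<lambda>(\<alpha>, \<beta>). evP dl eps g (rl \<alpha> g)) (cutp V \<sigma>, cutp ?U \<sigma>) = evP dl eps g (rl \<sigma> g)" by (simp only: prod.case)
  next
    fix p assume "p \<in> Stab V t \<times> Stab ?U t"
    then obtain a b where p: "p = (a, b)" "a permutes V" "b permutes ?U"
      "\<And>x. x \<in> V \<Longrightarrow> t (a x) = t x" "\<And>x. x \<in> ?U \<Longrightarrow> t (b x) = t x" by (auto simp: Stab_def)
    have ab: "a (b x) = (if x \<in> V then a x else b x)" for x
    proof (cases "x \<in> V")
      case True then show ?thesis using permutes_not_in[OF p(3)] by simp
    next
      case False
      then have "b x \<notin> V" using permutes_in_image[OF p(3), of x] permutes_not_in[OF p(3), of x] by fastforce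
      then show ?thesis using False permutes_not_in[OF p(2)] by simp
    qed
    have "cutp V (a \<circ> b) = a" "cutp ?U (a \<circ> b) = b"
      using permutes_not_in[OF p(2)] permutes_not_in[OF p(3)] by (auto simp: cutp_def fun_eq_iff ab)
    then show "(\<lambda>\<sigma>. (cutp V \<sigma>, cutp ?U \<sigma>)) ((\<lambda>(\<alpha>, \<beta>). \<alpha> \<circ> \<beta>) p) = p" by (simp add: p(1))
    have "a \<circ> b permutes W"
      by (rule permutes_compose[OF permutes_subset[OF p(3) Diff_subset] permutes_subset[OF p(2) W(2)]])
    moreover have "t ((a \<circ> b) x) = t x" if "x \<in> W" for x using that p(4,5) by (simp add: ab)
    moreover have "(a \<circ> b) ` V = V" using permutes_image[OF p(2)] by (simp add: ab)
    ultimately show "(\<lambda>(\<alpha>, \<beta>). \<alpha> \<circ> \<beta>) p \<in> {\<sigma>\<in>Stab W t. \<sigma> ` V = V}" by (simp add: p(1) Stab_def)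
  qed
  also have "\<dots> = ssum dl eps V t g * int (card (Stab ?U t))"
    by (simp add: ssum_def mult.commute flip: sum.cartesian_product sum_distrib_left)
  finally show ?thesis .
qed

definition BV :: "nat set \<Rightarrow> nat \<Rightarrow> edge list set" where
  "BV V i = {g \<in> Bas V i. verts g = V}"

text \<open>What remains of the monomials with vertex set V after the other points have been summed
  out: these leave a factorial, kept outside, and the condition that the fibres on V fit into
  \<mu>.\<close>

definition Xi :: "int \<Rightarrow> int \<Rightarrow> nat \<Rightarrow> nat \<Rightarrow> nat set \<Rightarrow> (nat \<Rightarrow> int) \<Rightarrow> int" where
  "Xi dl eps L i V \<mu> = (\<Sum>g\<in>BV V i. \<Sum>t\<in>V \<rightarrow>\<^sub>E {..<L}.
     ssum dl eps V t g * (if \<forall>j<L. fib V t j \<le> \<mu> j then 1 else 0))"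

text \<open>A tabloid on W is a map on V together with a filling of the remaining row lengths by the
  complement. By \<open>sum_card_Stab\<close> these fillings have the same total weight for every
  shape that fits.\<close>

lemma sum_ssum:
  assumes W: "finite W" "V \<subseteq> W" and V: "verts g = V" and \<mu>: "(\<Sum>j<L. \<mu> j) = int (card W)"
  shows "(\<Sum>t\<in>Tabs W L \<mu>. ssum dl eps W t g) =
    fact (card W - card V) * (\<Sum>t\<in>V \<rightarrow>\<^sub>E {..<L}. ssum dl eps V t g * (if \<forall>j<L. fib V t j \<le> \<mu> j then 1 else 0))"
proof -
  let ?U = "W - V"
  have f: "finite V" "finite ?U" using finite_subset[OF W(2,1)] W(1) by auto
  have WU: "W = V \<union> ?U" using W(2) by blast
  have cU: "card ?U = card W - card V" using f(1) W(2) by (simp add: card_Diff_subset)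
  have fW: "fib W t j = fib V t j + fib ?U t j" for t j
    using fib_Un[OF f, of t j] WU by auto
  have factor: "a = (if C then f else 0) \<Longrightarrow> s * a = f * (s * (if C then 1 else 0))" for a f s :: int and C
    by (cases C) auto
  have "(\<Sum>t\<in>Tabs W L \<mu>. ssum dl eps W t g) = (\<Sum>t\<in>Tabs W L \<mu>. ssum dl eps V t g * int (card (Stab ?U t)))"
    by (intro sum.cong refl ssum_split[OF W V])
  also have "\<dots> = (\<Sum>(t, u)\<in>(SIGMA t:V \<rightarrow>\<^sub>E {..<L}. Tabs ?U L (\<lambda>j. \<mu> j - fib V t j)). ssum dl eps V t g * int (card (Stab ?U u)))"
  proof (rule sum.reindex_bij_witness[where j = "\<lambda>t. (restrict t V, restrict t ?U)" and i = "\<lambda>(t, u) x. if x \<in> V then t x else u x"])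
    fix t assume t: "t \<in> Tabs W L \<mu>"
    have te: "t x = undefined" if "x \<notin> W" for x using t that by (auto simp: Tabs_def PiE_def extensional_def)
    show "(\<lambda>(t, u) x. if x \<in> V then t x else u x) (restrict t V, restrict t ?U) = t"
      using te by (auto simp: fun_eq_iff)
    have "fib V (restrict t V) j = fib V t j" "fib ?U (restrict t ?U) j = fib ?U t j" for j
      by (rule fib_cong, simp)+
    then show "(restrict t V, restrict t ?U) \<in> (SIGMA t:V \<rightarrow>\<^sub>E {..<L}. Tabs ?U L (\<lambda>j. \<mu> j - fib V t j))"
      using t W(2) by (auto simp: Tabs_def fW)
    have "ssum dl eps V (restrict t V) g = ssum dl eps V t g" "Stab ?U (restrict t ?U) = Stab ?U t"
      by (rule ssum_cong Stab_cong, simp)+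
    then show "(\<lambda>(t, u). ssum dl eps V t g * int (card (Stab ?U u))) (restrict t V, restrict t ?U) = ssum dl eps V t g * int (card (Stab ?U t))"
      by simp
  next
    fix p assume "p \<in> (SIGMA t:V \<rightarrow>\<^sub>E {..<L}. Tabs ?U L (\<lambda>j. \<mu> j - fib V t j))"
    then obtain t u where p: "p = (t, u)" "t \<in> V \<rightarrow>\<^sub>E {..<L}" "u \<in> ?U \<rightarrow>\<^sub>E {..<L}" "\<And>j. j < L \<Longrightarrow> fib ?U u j = \<mu> j - fib V t j"
      by (auto simp: Tabs_def)
    let ?m = "\<lambda>x. if x \<in> V then t x else u x"
    show "(\<lambda>t. (restrict t V, restrict t ?U)) ((\<lambda>(t, u) x. if x \<in> V then t x else u x) p) = p"
      using p(2,3) by (auto simp: p(1) fun_eq_iff PiE_def extensional_def)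
    have "fib V ?m j = fib V t j" "fib ?U ?m j = fib ?U u j" for j by (rule fib_cong, simp)+
    then show "(\<lambda>(t, u) x. if x \<in> V then t x else u x) p \<in> Tabs W L \<mu>"
      using p(2-4) W(2) by (auto simp: p(1) Tabs_def fW PiE_def Pi_def extensional_def)
  qed
  also have "\<dots> = (\<Sum>t\<in>V \<rightarrow>\<^sub>E {..<L}. \<Sum>u\<in>Tabs ?U L (\<lambda>j. \<mu> j - fib V t j). ssum dl eps V t g * int (card (Stab ?U u)))"
    using f by (intro sum.Sigma[symmetric]) (auto intro: finite_PiE finite_Tabs)
  also have "\<dots> = (\<Sum>t\<in>V \<rightarrow>\<^sub>E {..<L}. ssum dl eps V t g * int (\<Sum>u\<in>Tabs ?U L (\<lambda>j. \<mu> j - fib V t j). card (Stab ?U u)))"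
    by (simp add: sum_distrib_left)
  also have "\<dots> = (\<Sum>t\<in>V \<rightarrow>\<^sub>E {..<L}. fact (card ?U) * (ssum dl eps V t g * (if \<forall>j<L. fib V t j \<le> \<mu> j then 1 else 0)))"
  proof (intro sum.cong refl)
    fix t assume t: "t \<in> V \<rightarrow>\<^sub>E {..<L}"
    let ?\<rho> = "\<lambda>j. \<mu> j - fib V t j"
    have "int (\<Sum>u\<in>Tabs ?U L ?\<rho>. card (Stab ?U u)) = (if \<forall>j<L. fib V t j \<le> \<mu> j then fact (card ?U) else 0)"
    proof (cases "\<forall>j<L. fib V t j \<le> \<mu> j")
      case True
      have "(\<Sum>j<L. ?\<rho> j) = int (card W) - int (card V)"
        using sum_fib[OF f(1), of t L] t \<mu> by (auto simp: sum_subtractf)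
      also have "\<dots> = int (card ?U)" using cU card_mono[OF W] by simp
      finally have "(\<Sum>u\<in>Tabs ?U L ?\<rho>. card (Stab ?U u)) = fact (card ?U)"
        using sum_card_Stab[OF f(2), of L ?\<rho>] True by simp
      then show ?thesis using True by simp
    next
      case False
      then obtain j where "j < L" "\<mu> j < fib V t j" by force
      then have "fib ?U u j \<noteq> ?\<rho> j" for u by (simp add: fib_def)
      then have "Tabs ?U L ?\<rho> = {}" using \<open>j < L\<close> by (auto simp: Tabs_def)
      then show ?thesis using False by simp
    qed
    then show "ssum dl eps V t g * int (\<Sum>u\<in>Tabs ?U L ?\<rho>. card (Stab ?U u)) =
       fact (card ?U) * (ssum dl eps V t g * (if \<forall>j<L. fib V t j \<le> \<mu> j then 1 else 0))"
      by (rule factor)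
  qed
  finally show ?thesis by (simp add: cU flip: sum_distrib_left)
qed

text \<open>After interchanging the sums each monomial meets the stabilizer of each tabloid;
  grouping by vertex sets then allows \<open>sum_ssum\<close>.\<close>

lemma tabloid_trace:
  assumes \<mu>: "(\<Sum>j<L. \<mu> j) = int n"
  shows "(\<Sum>\<sigma> | \<sigma> permutes {..<n}. int (card {t\<in>Tabs {..<n} L \<mu>. \<sigma> \<in> Stab {..<n} t}) * (\<Sum>g\<in>Bas {..<n} i. evP dl eps g (rl \<sigma> g))) =
    (\<Sum>V\<in>Pow {..<n}. fact (n - card V) * Xi dl eps L i V \<mu>)"
proof -
  let ?W = "{..<n}" and ?T = "Tabs {..<n} L \<mu>" and ?S = "{\<sigma>. \<sigma> permutes {..<n}}" and ?B = "Bas {..<n} i"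
  have fin: "finite ?T" "finite ?S" "finite ?B" by (auto intro: finite_Tabs finite_permutations finite_Bas)
  have card: "int (card {t\<in>?T. \<sigma> \<in> Stab ?W t}) = (\<Sum>t\<in>?T. if \<sigma> \<in> Stab ?W t then 1 else 0)" for \<sigma>
    using fin(1) by (simp add: sum.If_cases Int_def)
  have "(\<Sum>\<sigma>\<in>?S. int (card {t\<in>?T. \<sigma> \<in> Stab ?W t}) * (\<Sum>g\<in>?B. evP dl eps g (rl \<sigma> g))) =
      (\<Sum>\<sigma>\<in>?S. \<Sum>g\<in>?B. \<Sum>t\<in>?T. if \<sigma> \<in> Stab ?W t then evP dl eps g (rl \<sigma> g) else 0)"
    unfolding card sum_distrib_right sum_distrib_left
    by (intro sum.cong refl) simp
  also have "\<dots> = (\<Sum>g\<in>?B. \<Sum>t\<in>?T. \<Sum>\<sigma>\<in>?S. if \<sigma> \<in> Stab ?W t then evP dl eps g (rl \<sigma> g) else 0)"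
    by (subst sum.swap) (intro sum.cong refl sum.swap)
  also have "\<dots> = (\<Sum>g\<in>?B. \<Sum>t\<in>?T. ssum dl eps ?W t g)"
  proof (intro sum.cong refl)
    fix g t
    have "{\<sigma>. \<sigma> permutes ?W} \<inter> {\<sigma>. \<sigma> \<in> Stab ?W t} = Stab ?W t" by (auto simp: Stab_def)
    then show "(\<Sum>\<sigma>\<in>?S. if \<sigma> \<in> Stab ?W t then evP dl eps g (rl \<sigma> g) else 0) = ssum dl eps ?W t g"
      using fin(2) by (simp add: ssum_def sum.If_cases)
  qed
  also have "\<dots> = (\<Sum>V\<in>Pow ?W. \<Sum>g\<in>{g\<in>?B. verts g = V}. \<Sum>t\<in>?T. ssum dl eps ?W t g)"
    using valid_verts Bas_valid fin(3) by (intro sum.group[symmetric]) fastforce+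
  also have "\<dots> = (\<Sum>V\<in>Pow ?W. fact (n - card V) * Xi dl eps L i V \<mu>)"
  proof (intro sum.cong refl)
    fix V assume V: "V \<in> Pow ?W"
    have eq: "{g\<in>?B. verts g = V} = BV V i" using V by (force simp: BV_def Bas_def verts_def)
    have "(\<Sum>g\<in>BV V i. \<Sum>t\<in>?T. ssum dl eps ?W t g) = (\<Sum>g\<in>BV V i. fact (n - card V) *
        (\<Sum>t\<in>V \<rightarrow>\<^sub>E {..<L}. ssum dl eps V t g * (if \<forall>j<L. fib V t j \<le> \<mu> j then 1 else 0)))"
      using V \<mu> by (intro sum.cong refl) (subst sum_ssum[of ?W V], auto simp: BV_def)
    then show "(\<Sum>g\<in>{g\<in>?B. verts g = V}. \<Sum>t\<in>?T. ssum dl eps ?W t g) = fact (n - card V) * Xi dl eps L i V \<mu>"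
      by (simp add: eq Xi_def sum_distrib_left)
  qed
  finally show ?thesis .
qed

subsection \<open>Relabelling\<close>

lemma evP_rl: "inj f \<Longrightarrow> evP dl eps (rl f g) (rl f F) = evP dl eps g F"
proof (induction g arbitrary: F)
  case (Cons e g)
  show ?case using contr_rl[OF Cons.prems, of dl eps "fst e" "snd e" "evP dl eps (rl f g)" F] Cons
    by simp
qed simp

lemma rl_inv: "inj f \<Longrightarrow> rl (inv_into UNIV f) (rl f g) = g"
  unfolding rl_rl by (rule rl_ident) simp

lemma BV_rl:
  assumes "inj f" "strict_mono_on A f" "g \<in> BV A i"
  shows "rl f g \<in> BV (f ` A) i"
proof -
  have sm: "a \<in> A \<Longrightarrow> b \<in> A \<Longrightarrow> a < b \<Longrightarrow> f a < f b" for a b using assms(2) by (rule strict_mono_onD)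
  have g: "length g = i" "sorted_wrt (\<lambda>e e'. fst e' < fst e) g" "verts g = A" "\<And>e. e \<in> set g \<Longrightarrow> snd e < fst e \<and> fst e \<in> A \<and> snd e \<in> A"
    using assms(3) by (auto simp: BV_def Bas_def)
  have "sorted_wrt (\<lambda>e e'. f (fst e') < f (fst e)) g"
    by (rule sorted_wrt_mono_rel[OF _ g(2)]) (use g(4) sm in blast)
  then show ?thesis using g sm unfolding BV_def Bas_def by (auto simp: sorted_wrt_map)
qed

lemma bij_betw_rl:
  assumes f: "inj f" "strict_mono_on A f"
  shows "bij_betw (rl f) (BV A i) (BV (f ` A) i)"
  unfolding bij_betw_def
proof (intro conjI equalityI image_subsetI subsetI)
  show "inj_on (rl f) (BV A i)" by (rule inj_on_inverseI[where g = "rl (inv_into UNIV f)"]) (rule rl_inv[OF f(1)])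
  show "rl f g \<in> BV (f ` A) i" if "g \<in> BV A i" for g by (rule BV_rl[OF f that])
  fix h assume h: "h \<in> BV (f ` A) i"
  let ?g = "rl (inv_into UNIV f) h"
  have fi: "f (inv_into UNIV f y) = y" "inv_into UNIV f y \<in> A" if "y \<in> f ` A" for y using that f(1) by auto
  have l: "length h = i" "sorted_wrt (\<lambda>e e'. fst e' < fst e) h" "verts h = f ` A"
     "\<And>e. e \<in> set h \<Longrightarrow> snd e < fst e \<and> fst e \<in> f ` A \<and> snd e \<in> f ` A"
    using h by (auto simp: BV_def Bas_def)
  have less: "inv_into UNIV f a < inv_into UNIV f b" if "a \<in> f ` A" "b \<in> f ` A" "a < b" for a b
    using that fi strict_mono_on_less[OF f(2), of "inv_into UNIV f a" "inv_into UNIV f b"] by simp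
  have "sorted_wrt (\<lambda>e e'. inv_into UNIV f (fst e') < inv_into UNIV f (fst e)) h"
    by (rule sorted_wrt_mono_rel[OF _ l(2)]) (use l(4) less in blast)
  moreover have "inv_into UNIV f ` verts h = A" using f(1) by (simp add: l(3))
  ultimately have "?g \<in> BV A i" using l(1,4) less fi unfolding BV_def Bas_def by (auto simp: sorted_wrt_map)
  moreover have "h = rl f ?g" unfolding rl_rl using fi l(3) by (intro rl_ident[symmetric]) simp
  ultimately show "h \<in> rl f ` BV A i" by blast
qed

lemma Xi_rl:
  assumes f: "inj f" "strict_mono_on A f" and A: "finite A"
  shows "Xi dl eps L i (f ` A) \<mu> = Xi dl eps L i A \<mu>"
proof -
  have finv: "inv_into UNIV f (f x) = x" for x using f(1) by simp
  define tr where "tr t = (\<lambda>x\<in>f ` A. t (inv_into UNIV f x))" for t :: "nat \<Rightarrow> nat"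
  have tr: "tr t (f x) = t x" if "x \<in> A" for t x using that finv by (simp add: tr_def)
  have bt: "bij_betw tr (A \<rightarrow>\<^sub>E {..<L}) (f ` A \<rightarrow>\<^sub>E {..<L})"
  proof (rule bij_betw_byWitness[where f' = "\<lambda>t. \<lambda>x\<in>A. t (f x)"])
    show "\<forall>t\<in>A \<rightarrow>\<^sub>E {..<L}. (\<lambda>x\<in>A. tr t (f x)) = t"
      by (auto simp: tr fun_eq_iff PiE_def extensional_def)
    show "\<forall>t\<in>f ` A \<rightarrow>\<^sub>E {..<L}. tr (\<lambda>x\<in>A. t (f x)) = t"
      by (auto simp: tr_def finv fun_eq_iff PiE_def extensional_def)
    show "tr ` (A \<rightarrow>\<^sub>E {..<L}) \<subseteq> f ` A \<rightarrow>\<^sub>E {..<L}" by (auto simp: tr_def finv)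
    show "(\<lambda>t. \<lambda>x\<in>A. t (f x)) ` (f ` A \<rightarrow>\<^sub>E {..<L}) \<subseteq> A \<rightarrow>\<^sub>E {..<L}" by auto
  qed
  have fibf: "fib (f ` A) (tr t) j = fib A t j" for t j
  proof -
    have "bij_betw f {x\<in>A. t x = j} {x\<in>f ` A. tr t x = j}"
      unfolding bij_betw_def using f(1) tr by (auto intro: inj_on_subset)
    from bij_betw_same_card[OF this] show ?thesis by (simp add: fib_def)
  qed
  have ss: "ssum dl eps (f ` A) (tr t) (rl f g) = ssum dl eps A t g" if g: "g \<in> BV A i" for t g
  proof -
    define c where "c p x = (if x \<in> f ` A then f (p (inv_into A f x)) else x)" for p :: "nat \<Rightarrow> nat" and x
    have bf: "bij_betw f A (f ` A)" using f(1) by (auto simp: bij_betw_def intro: inj_on_subset)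
    have c: "bij_betw c {p. p permutes A} {p. p permutes f ` A}"
      using bij_betw_permutations[OF bf] by (simp add: c_def[abs_def])
    have cf: "c p (f x) = f (p x)" if "x \<in> A" for p x
      using that f(1) by (simp add: c_def inv_into_f_f inj_on_subset)
    have "bij_betw c (Stab A t) (Stab (f ` A) (tr t))"
      unfolding bij_betw_def
    proof (intro conjI equalityI image_subsetI subsetI)
      show "inj_on c (Stab A t)" by (rule inj_on_subset[OF bij_betw_imp_inj_on[OF c]]) (auto simp: Stab_def)
      show "c p \<in> Stab (f ` A) (tr t)" if "p \<in> Stab A t" for p
        using that bij_betwE[OF c] permutes_in_image[of p A] by (auto simp: Stab_def cf tr)
      fix q assume q: "q \<in> Stab (f ` A) (tr t)"
      then obtain p where p: "p permutes A" "q = c p"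
        using bij_betw_imp_surj_on[OF c] by (auto simp: Stab_def)
      have "t (p x) = t x" if x: "x \<in> A" for x
      proof -
        have "tr t (c p (f x)) = tr t (f x)" using q x unfolding p(2) Stab_def by blast
        then show ?thesis using x permutes_in_image[OF p(1)] by (simp add: cf tr)
      qed
      then show "q \<in> c ` Stab A t" using p by (auto simp: Stab_def)
    qed
    then have "ssum dl eps (f ` A) (tr t) (rl f g) = (\<Sum>p\<in>Stab A t. evP dl eps (rl f g) (rl (c p) (rl f g)))"
      unfolding ssum_def by (rule sum.reindex_bij_betw[symmetric])
    also have "\<dots> = (\<Sum>p\<in>Stab A t. evP dl eps g (rl p g))"
    proof (intro sum.cong refl)
      fix p
      have "rl (c p) (rl f g) = rl f (rl p g)"
        unfolding rl_rl by (rule rl_cong) (use g cf in \<open>auto simp: BV_def\<close>)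
      then show "evP dl eps (rl f g) (rl (c p) (rl f g)) = evP dl eps g (rl p g)" by (simp only: evP_rl[OF f(1)])
    qed
    finally show ?thesis by (simp add: ssum_def)
  qed
  have "Xi dl eps L i (f ` A) \<mu> = (\<Sum>g\<in>BV A i. \<Sum>t\<in>f ` A \<rightarrow>\<^sub>E {..<L}.
     ssum dl eps (f ` A) t (rl f g) * (if \<forall>j<L. fib (f ` A) t j \<le> \<mu> j then 1 else 0))"
    unfolding Xi_def by (rule sum.reindex_bij_betw[OF bij_betw_rl[OF f], symmetric])
  also have "\<dots> = (\<Sum>g\<in>BV A i. \<Sum>t\<in>A \<rightarrow>\<^sub>E {..<L}.
     ssum dl eps (f ` A) (tr t) (rl f g) * (if \<forall>j<L. fib (f ` A) (tr t) j \<le> \<mu> j then 1 else 0))"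
    by (intro sum.cong refl sum.reindex_bij_betw[OF bt, symmetric])
  also have "\<dots> = Xi dl eps L i A \<mu>"
    unfolding Xi_def fibf by (intro sum.cong refl) (simp add: ss)
  finally show ?thesis .
qed

text \<open>Decreasing monomials depend on the order of the points, so V is enumerated
  increasingly.\<close>

lemma Xi_card:
  assumes V: "finite V"
  shows "Xi dl eps L i V \<mu> = Xi dl eps L i {..<card V} \<mu>"
proof -
  let ?xs = "sorted_list_of_set V" and ?s = "card V"
  \<comment> \<open>Values above the maximum of V are taken beyond \<open>card V\<close>, which
    makes f injective everywhere, as \<open>Xi_rl\<close> requires.\<close>
  define f where "f x = (if x < ?s then ?xs ! x else Suc (Max (insert 0 V)) + x)" for x
  have len: "length ?xs = ?s" by simp
  have fV: "f ` {..<?s} = V"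
  proof -
    have "f ` {..<?s} = (!) ?xs ` {..<?s}" by (auto simp: f_def)
    also have "\<dots> = set ?xs" by (auto simp: set_conv_nth len)
    finally show ?thesis using V by simp
  qed
  have sm: "strict_mono_on {..<?s} f"
    using sorted_wrt_nth_less[OF strict_sorted_list_of_set[of V]]
    by (auto simp: strict_mono_on_def f_def)
  have ge: "f x < f y" if "x < ?s" "\<not> y < ?s" for x y
  proof -
    have "f x \<in> V" using fV that(1) by blast
    then have "f x \<le> Max (insert 0 V)" using V by simp
    then show ?thesis using that(2) by (simp add: f_def)
  qed
  have "f x < f y" if "x < y" for x y
  proof (cases "y < ?s")
    case True then show ?thesis using sm that by (auto intro: strict_mono_onD)
  next
    case False
    then show ?thesis using ge[of x y] that by (cases "x < ?s") (auto simp: f_def)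
  qed
  then have "inj f" by (intro strict_mono_imp_inj_on strict_monoI)
  from Xi_rl[OF this sm] show ?thesis by (simp add: fV)
qed

lemma card_verts: "card (verts g) \<le> 2 * length g"
proof (induction g)
  case (Cons e g)
  have "card ({fst e, snd e} \<union> verts g) \<le> card {fst e, snd e} + card (verts g)" by (rule card_Un_le)
  also have "card {fst e, snd e} \<le> 2" by (simp add: card_insert_if)
  finally show ?case using Cons by simp
qed simp

lemma BV_empty: "2 * i < s \<Longrightarrow> BV {..<s} i = {}"
proof -
  assume s: "2 * i < s"
  have False if "g \<in> BV {..<s} i" for g
    using card_verts[of g] that s by (simp add: BV_def Bas_def)
  then show ?thesis by blast
qed

text \<open>There are n choose s sets of size s, and (n choose s) (n - s)! / n! = 1 / s!, so n
  survives only in \<mu>. Sets with more than 2 i points carry no monomial, and more than n points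
  do not fit into \<mu>.\<close>

lemma tabloid_trace_stable:
  assumes \<mu>: "(\<Sum>j<L. \<mu> j) = int n"
  shows "rat_of_int (\<Sum>V\<in>Pow {..<n}. fact (n - card V) * Xi dl eps L i V \<mu>) / fact n =
    (\<Sum>s\<le>2 * i. of_int (Xi dl eps L i {..<s} \<mu>) / fact s)"
proof -
  let ?X = "\<lambda>s. rat_of_int (Xi dl eps L i {..<s} \<mu>)"
  have big: "Xi dl eps L i {..<s} \<mu> = 0" if "n < s" for s
    unfolding Xi_def
  proof (intro sum.neutral ballI)
    fix g t assume t: "t \<in> {..<s} \<rightarrow>\<^sub>E {..<L}"
    have "\<not> (\<forall>j<L. fib {..<s} t j \<le> \<mu> j)"
    proof
      assume "\<forall>j<L. fib {..<s} t j \<le> \<mu> j"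
      then have "(\<Sum>j<L. fib {..<s} t j) \<le> (\<Sum>j<L. \<mu> j)" by (intro sum_mono) auto
      moreover have "(\<Sum>j<L. fib {..<s} t j) = int s" using sum_fib[of "{..<s}" t L] t by auto
      ultimately show False using \<mu> that by simp
    qed
    then show "ssum dl eps {..<s} t g * (if \<forall>j<L. fib {..<s} t j \<le> \<mu> j then 1 else 0) = 0" by (simp only: if_False mult_zero_right)
  qed
  have small: "Xi dl eps L i {..<s} \<mu> = 0" if "2 * i < s" for s by (simp add: Xi_def BV_empty[OF that])
  have supp: "s \<le> n \<and> s \<le> 2 * i" if "Xi dl eps L i {..<s} \<mu> \<noteq> 0" for s
    using that big[of s] small[of s] by linarith
  have "rat_of_int (\<Sum>V\<in>Pow {..<n}. fact (n - card V) * Xi dl eps L i V \<mu>) = (\<Sum>V\<in>Pow {..<n}. fact (n - card V) * ?X (card V))"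
    unfolding of_int_sum
  proof (intro sum.cong refl)
    fix V assume "V \<in> Pow {..<n}"
    then have "finite V" by (simp add: finite_subset)
    from Xi_card[OF this] have "Xi dl eps L i V \<mu> = Xi dl eps L i {..<card V} \<mu>" .
    then show "rat_of_int (fact (n - card V) * Xi dl eps L i V \<mu>) = fact (n - card V) * ?X (card V)"
      by (simp only: of_int_mult of_int_fact)
  qed
  also have "\<dots> = (\<Sum>s\<le>n. \<Sum>V\<in>{V\<in>Pow {..<n}. card V = s}. fact (n - card V) * ?X (card V))"
    using card_mono[of "{..<n}"] by (intro sum.group[symmetric]) auto
  also have "\<dots> = (\<Sum>s\<le>n. fact n * (?X s / fact s))"
  proof (intro sum.cong refl)
    fix s assume s: "s \<in> {..n}"
    have "(\<Sum>V\<in>{V\<in>Pow {..<n}. card V = s}. fact (n - card V) * ?X (card V)) = of_nat (n choose s) * (fact (n - s) * ?X s)"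
      using n_subsets[of "{..<n}" s] by (simp add: Pow_def)
    also have "\<dots> = fact n * (?X s / fact s)"
      using s by (simp add: binomial_fact)
    finally show "(\<Sum>V\<in>{V\<in>Pow {..<n}. card V = s}. fact (n - card V) * ?X (card V)) = fact n * (?X s / fact s)" .
  qed
  finally have sum_n: "rat_of_int (\<Sum>V\<in>Pow {..<n}. fact (n - card V) * Xi dl eps L i V \<mu>) = fact n * (\<Sum>s\<le>n. ?X s / fact s)"
    by (simp only: sum_distrib_left)
  have "rat_of_int (\<Sum>V\<in>Pow {..<n}. fact (n - card V) * Xi dl eps L i V \<mu>) / fact n = (\<Sum>s\<le>n. ?X s / fact s)"
    unfolding sum_n by simp
  also have "\<dots> = (\<Sum>s\<in>{..n} \<inter> {..2 * i}. ?X s / fact s)"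
    by (rule sum.mono_neutral_right) (auto dest: supp)
  also have "\<dots> = (\<Sum>s\<le>2 * i. ?X s / fact s)"
    by (rule sum.mono_neutral_left) (auto dest: supp)
  finally show ?thesis .
qed

subsection \<open>A determinant of zeros and ones\<close>

text \<open>The determinant of the matrix whose entry at (j, k) is 1 if \<open>p j\<close> \<le> k
  and 0 otherwise, for j, k < L.\<close>

definition stair :: "nat \<Rightarrow> (nat \<Rightarrow> int) \<Rightarrow> int" where
  "stair L p = (\<Sum>w | w permutes {..<L}. sign w * (if \<forall>j<L. p j \<le> int (w j) then 1 else 0))"

text \<open>Every threshold at most 0 gives a row of ones.\<close>

lemma stair_cong:
  assumes "\<And>j. j < L \<Longrightarrow> p j = q j \<or> p j \<le> 0 \<and> q j \<le> 0"
  shows "stair L p = stair L q"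
proof -
  have "(p j \<le> int (w j)) = (q j \<le> int (w j))" if "j < L" for w j
    using assms[OF that] by auto
  then have "(\<forall>j<L. p j \<le> int (w j)) = (\<forall>j<L. q j \<le> int (w j))" for w by blast
  then show ?thesis unfolding stair_def by simp
qed

text \<open>Equal truncated thresholds give equal rows, and a threshold of at least L gives a zero
  row.\<close>

lemma stair_nonzero:
  assumes "stair L p \<noteq> 0"
  shows "inj_on (\<lambda>j. nat (p j)) {..<L}" "\<forall>j<L. nat (p j) < L"
proof -
  let ?q = "\<lambda>j. nat (p j)"
  define c where "c w = (if \<forall>j<L. ?q j \<le> w j then 1 else 0 :: int)" for w :: "nat \<Rightarrow> nat"
  have D: "stair L p = (\<Sum>w | w permutes {..<L}. sign w * c w)"
    unfolding stair_def c_def by (simp add: nat_le_iff)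
  show "inj_on ?q {..<L}"
  proof (rule inj_onI, rule ccontr)
    fix a b assume ab: "a \<in> {..<L}" "b \<in> {..<L}" "?q a = ?q b" "a \<noteq> b"
    let ?t = "Transposition.transpose a b"
    have t: "?t permutes {..<L}" by (rule permutes_swap_id[OF ab(1,2)])
    have qt: "?q (?t j) = ?q j" for j using ab(3) by (auto simp: Transposition.transpose_def)
    have ct: "c (w \<circ> ?t) = c w" for w
    proof -
      have "(\<forall>j<L. ?q j \<le> w (?t j)) = (\<forall>j<L. ?q j \<le> w j)"
      proof (intro iffI allI impI)
        fix j assume a: "\<forall>j<L. ?q j \<le> w (?t j)" and j: "j < L"
        have "?t j < L" using j permutes_in_image[OF t] by auto
        then have "?q (?t j) \<le> w (?t (?t j))" using a by blast
        then show "?q j \<le> w j" unfolding qt by simp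
      next
        fix j assume a: "\<forall>j<L. ?q j \<le> w j" and j: "j < L"
        have "?t j < L" using j permutes_in_image[OF t] by auto
        then have "?q (?t j) \<le> w (?t j)" using a by blast
        then show "?q j \<le> w (?t j)" unfolding qt .
      qed
      then show ?thesis by (simp add: c_def)
    qed
    have "stair L p = (\<Sum>w | w permutes {..<L}. sign (w \<circ> ?t) * c (w \<circ> ?t))"
      unfolding D by (rule sum_permutations_compose_right[OF t])
    also have "\<dots> = (\<Sum>w | w permutes {..<L}. - (sign w * c w))"
    proof (intro sum.cong refl)
      fix w assume "w \<in> {w. w permutes {..<L}}"
      then have "permutation w" "permutation ?t" using t by (auto simp: permutation_permutes)
      then have "sign (w \<circ> ?t) = - sign w" using ab(4) by (simp add: sign_compose sign_swap_id)
      then show "sign (w \<circ> ?t) * c (w \<circ> ?t) = - (sign w * c w)" by (simp only: ct)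
    qed
    also have "\<dots> = - stair L p" by (simp add: D sum_negf)
    finally show False using assms by simp
  qed
  show "\<forall>j<L. ?q j < L"
  proof (rule ccontr)
    assume "\<not> ?thesis"
    then obtain j where j: "j < L" "L \<le> ?q j" by auto
    have "c w = 0" if "w permutes {..<L}" for w
    proof -
      have "w j < L" using permutes_in_image[OF that, of j] j by simp
      then have "\<not> ?q j \<le> w j" using j(2) by simp
      then show ?thesis using j(1) unfolding c_def by auto
    qed
    then have "stair L p = 0" by (simp add: D)
    then show False using assms by simp
  qed
qed

text \<open>For a nonzero determinant the truncated thresholds are a permutation of 0, ..., L - 1, so all but one
  of them are attained without truncation.\<close>
lemma stair_bound:
  assumes nz: "stair L (\<lambda>j. \<kappa> j - lam j + int j) \<noteq> 0" and L: "0 < L"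
    and \<kappa>: "\<And>j. j < L \<Longrightarrow> 0 \<le> \<kappa> j" and lam: "\<And>j. j < L \<Longrightarrow> lam j \<le> lam 0"
  shows "(\<Sum>j<L. lam j) - lam 0 \<le> (\<Sum>j<L. \<kappa> j)"
proof -
  let ?p = "\<lambda>j. \<kappa> j - lam j + int j"
  let ?q = "\<lambda>j. nat (?p j)"
  have inj: "inj_on ?q {..<L}" and lt: "\<forall>j<L. ?q j < L" using stair_nonzero[OF nz] by auto
  have im: "?q ` {..<L} = {..<L}" using lt by (intro endo_inj_surj[OF _ _ inj]) auto
  then obtain r where r: "r < L" "?q r = 0" using L by (metis (no_types, lifting) imageE lessThan_iff)
  have "(\<Sum>j<L. int (?q j)) = (\<Sum>j<L. int j)"
    using sum.reindex[OF inj, of int] im by (simp only: o_def)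
  \<comment> \<open>Outside row r the truncation is inactive. In row r only the nonnegativity of
    \<kappa> r is used, at the cost of \<open>lam r - int r\<close>.\<close>
  moreover have "int (?q j) + lam j - int j \<le> \<kappa> j + (if j = r then lam r - int r else 0)" if "j \<in> {..<L}" for j
  proof (cases "j = r")
    case True then show ?thesis using r(2) \<kappa>[OF r(1)] by simp
  next
    case False
    then have "?q j \<noteq> 0" using inj r that by (metis (no_types, lifting) inj_onD lessThan_iff)
    then have "int (?q j) = ?p j" by simp
    then show ?thesis using False by simp
  qed
  then have "(\<Sum>j<L. int (?q j) + lam j - int j) \<le> (\<Sum>j<L. \<kappa> j + (if j = r then lam r - int r else 0))"
    by (rule sum_mono)
  ultimately have "(\<Sum>j<L. lam j) \<le> (\<Sum>j<L. \<kappa> j) + (lam r - int r)"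
    using r(1) by (simp add: sum.distrib sum_subtractf sum.delta)
  then show ?thesis using lam[OF r(1)] by simp
qed

section \<open>The multiplicity formula and its consequences\<close>

context punctured
begin

text \<open>Permutations of the fibre K over row 0 preserve t and hence translate its stabilizer. A
  nonzero multiple of the sum is therefore a sum of orbit sums over K, which vanish for large
  K.\<close>

lemma ssum_zero:
  assumes V: "finite V" "g \<in> BV V i"
    and b: "odd CARD('d) \<and> int i < fib V t 0 \<or> even CARD('d) \<and> int (Suc i) < fib V t 0"
  shows "ssum dl0 eps0 V t g = 0"
proof -
  define K where "K = {x\<in>V. t x = 0}"
  let ?e = "evP dl0 eps0 g"
  have K: "K \<subseteq> V" "finite K" using V(1) by (auto simp: K_def)
  have e: "?e \<in> Efam V i" using V by (intro evP_in_Efam) (auto simp: BV_def)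
  have orb0: "fam.orb K ?e (rl a g) = 0" if a: "a \<in> Stab V t" for a
  proof -
    have "verts (rl a g) = V" using a V(2) permutes_image[of a V] by (simp add: Stab_def BV_def)
    then have KF: "K \<subseteq> verts (rl a g)" using K(1) by simp
    show ?thesis
    proof (cases "odd CARD('d)")
      case True
      then have "dl0 = -1" by (simp add: dl0_def)
      moreover have "i < card K" using b True by (simp add: fib_def K_def)
      ultimately show ?thesis by (intro fam.orb_zero_odd[OF _ V(1) K(1) e KF])
    next
      case False
      then have "dl0 = 1" by (simp add: dl0_def)
      moreover have "Suc i < card K" using b False by (simp add: fib_def K_def)
      ultimately show ?thesis by (intro fam.orb_zero_even[OF _ V(1) K(1) e KF])
    qed
  qed
  have tr: "ssum dl0 eps0 V t g = (\<Sum>a\<in>Stab V t. ?e (rl b (rl a g)))" if bp: "b permutes K" for b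
  proof -
    have tb: "t (b x) = t x" for x
      using permutes_in_image[OF bp, of x] permutes_not_in[OF bp, of x] by (cases "x \<in> K") (auto simp: K_def)
    have tb': "t (inv_into UNIV b x) = t x" for x
      using tb[of "inv_into UNIV b x"] permutes_inverses(1)[OF bp] by simp
    have bV: "b permutes V" by (rule permutes_subset[OF bp K(1)])
    have "bij_betw (\<lambda>a. b \<circ> a) (Stab V t) (Stab V t)"
    proof (rule bij_betw_byWitness[where f' = "\<lambda>a. inv_into UNIV b \<circ> a"])
      show "\<forall>a\<in>Stab V t. inv_into UNIV b \<circ> (b \<circ> a) = a"
        using permutes_inv_o(2)[OF bp] by (simp flip: comp_assoc)
      show "\<forall>a\<in>Stab V t. b \<circ> (inv_into UNIV b \<circ> a) = a"
        using permutes_inv_o(1)[OF bp] by (simp flip: comp_assoc)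
      show "(\<lambda>a. b \<circ> a) ` Stab V t \<subseteq> Stab V t"
        using permutes_compose[OF _ bV] tb by (auto simp: Stab_def)
      show "(\<lambda>a. inv_into UNIV b \<circ> a) ` Stab V t \<subseteq> Stab V t"
        using permutes_compose[OF _ permutes_inv[OF bV]] tb' by (auto simp: Stab_def)
    qed
    then show ?thesis unfolding ssum_def rl_rl by (rule sum.reindex_bij_betw[symmetric])
  qed
  have "int (card {b. b permutes K}) * ssum dl0 eps0 V t g = (\<Sum>b | b permutes K. ssum dl0 eps0 V t g)" by simp
  also have "\<dots> = (\<Sum>b | b permutes K. \<Sum>a\<in>Stab V t. ?e (rl b (rl a g)))"
    using tr by (intro sum.cong refl) blast
  also have "\<dots> = (\<Sum>a\<in>Stab V t. fam.orb K ?e (rl a g))"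
    unfolding fam.orb_def by (rule sum.swap)
  also have "\<dots> = 0" using orb0 by (intro sum.neutral ballI)
  finally show ?thesis using K(2) by (simp add: card_permutations)
qed

text \<open>What Jacobi--Trudi leaves for a fixed t: the signed sum over those w for which every
  fibre fits into its row of length \<open>lam ! j - j + w j\<close>.\<close>

definition stairs :: "nat list \<Rightarrow> nat \<Rightarrow> (nat \<Rightarrow> nat) \<Rightarrow> int" where
  "stairs lam s t = stair (length lam) (\<lambda>j. fib {..<s} t j - int (lam ! j) + int j)"

lemma sum_lam:
  assumes "w permutes {..<length lam}" "sum_list lam = n"
  shows "(\<Sum>j<length lam. int (lam ! j) - int j + int (w j)) = int n"
proof -
  have "(\<Sum>j<length lam. int (w j)) = (\<Sum>j<length lam. int j)"
    using sum.permute[OF assms(1), of int] by (simp add: o_def)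
  moreover have "(\<Sum>j<length lam. int (lam ! j)) = int n"
    using assms(2) by (simp add: sum_list_sum_nth lessThan_atLeast0 flip: of_nat_sum)
  ultimately show ?thesis by (simp add: sum.distrib sum_subtractf)
qed

lemma tabloid_fix_eq:
  assumes "\<sigma> permutes {..<n}"
  shows "tabloid_fix n \<mu> \<sigma> = card {t\<in>Tabs {..<n} (length \<mu>) ((!) \<mu>). \<sigma> \<in> Stab {..<n} t}"
proof (cases "\<exists>j<length \<mu>. \<mu> ! j < 0")
  case True
  then obtain j where "j < length \<mu>" "\<mu> ! j < 0" by blast
  then have "Tabs {..<n} (length \<mu>) ((!) \<mu>) = {}" by (force simp: Tabs_def fib_def)
  then show ?thesis using True by (simp add: tabloid_fix_def)
next
  case False
  then have "(card {x\<in>{..<n}. t x = j} = nat (\<mu> ! j)) = (fib {..<n} t j = \<mu> ! j)" if "j < length \<mu>" for t j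
    using that by (auto simp: fib_def)
  then have "{t \<in> {..<n} \<rightarrow>\<^sub>E {..<length \<mu>}.
        (\<forall>j<length \<mu>. card {x\<in>{..<n}. t x = j} = nat (\<mu> ! j)) \<and> (\<forall>x<n. t (\<sigma> x) = t x)} =
     {t\<in>Tabs {..<n} (length \<mu>) ((!) \<mu>). \<sigma> \<in> Stab {..<n} t}"
    using assms unfolding Tabs_def Stab_def by auto
  then show ?thesis unfolding tabloid_fix_def if_not_P[OF False] by (rule arg_cong)
qed

text \<open>The dependence on n is confined to the first entry of the partition inside
  \<open>stairs\<close>, which is the point of this form.\<close>

lemma f_mult_formula:
  assumes i: "0 < i" and n: "sum_list \<nu> \<le> n"
  shows "f_mult TYPE('d) i \<nu> n = (\<Sum>s\<le>2 * i. of_int (\<Sum>g\<in>BV {..<s} i. \<Sum>t\<in>{..<s} \<rightarrow>\<^sub>E {..<Suc (length \<nu>)}.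
      ssum dl0 eps0 {..<s} t g * stairs ((n - sum_list \<nu>) # \<nu>) s t) / fact s)"
proof -
  define lam where "lam = (n - sum_list \<nu>) # \<nu>"
  define L where "L = length lam"
  define \<mu> where "\<mu> w j = int (lam ! j) - int j + int (w j)" for w :: "nat \<Rightarrow> nat" and j
  let ?S = "{\<sigma>. \<sigma> permutes {..<n}}" and ?W = "{w. w permutes {..<L}}"
  let ?ch = "\<lambda>\<sigma>. \<Sum>g\<in>Bas {..<n} i. evP dl0 eps0 g (rl \<sigma> g)"
  let ?T = "\<lambda>w \<sigma>. card {t\<in>Tabs {..<n} L (\<mu> w). \<sigma> \<in> Stab {..<n} t}"
  have irr: "irr_char lam n \<sigma> = (\<Sum>w\<in>?W. sign w * int (?T w \<sigma>))" if "\<sigma> \<in> ?S" for \<sigma>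
  proof -
    have "Tabs {..<n} L ((!) (map (\<mu> w) [0..<L])) = Tabs {..<n} L (\<mu> w)" for w by (simp add: Tabs_def)
    then show ?thesis using that
      by (simp add: irr_char_def tabloid_fix_eq L_def[symmetric] \<mu>_def[abs_def])
  qed
  have "f_mult TYPE('d) i \<nu> n = (\<Sum>\<sigma>\<in>?S. of_int (irr_char lam n \<sigma>) * conf_char TYPE(real^'d) n (i * D) \<sigma>) / fact n"
    by (simp add: f_mult_def mult_pair_def lam_def D_eq)
  also have "(\<Sum>\<sigma>\<in>?S. of_int (irr_char lam n \<sigma>) * conf_char TYPE(real^'d) n (i * D) \<sigma>) =
      (\<Sum>\<sigma>\<in>?S. of_int ((\<Sum>w\<in>?W. sign w * int (?T w \<sigma>)) * ?ch \<sigma>))"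
  proof (intro sum.cong refl)
    fix \<sigma> assume s: "\<sigma> \<in> ?S"
    have "conf_char TYPE(real^'d) n (i * D) \<sigma> = of_int (?ch \<sigma>)"
      by (rule conf_char_eq[OF i]) (use s in blast)
    then show "of_int (irr_char lam n \<sigma>) * conf_char TYPE(real^'d) n (i * D) \<sigma> =
      rat_of_int ((\<Sum>w\<in>?W. sign w * int (?T w \<sigma>)) * ?ch \<sigma>)"
      by (simp only: irr[OF s] of_int_mult)
  qed
  also have "\<dots> = of_int (\<Sum>\<sigma>\<in>?S. \<Sum>w\<in>?W. sign w * (int (?T w \<sigma>) * ?ch \<sigma>))"
    by (simp only: of_int_sum sum_distrib_right mult.assoc)
  also have "(\<Sum>\<sigma>\<in>?S. \<Sum>w\<in>?W. sign w * (int (?T w \<sigma>) * ?ch \<sigma>)) =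
     (\<Sum>w\<in>?W. sign w * (\<Sum>\<sigma>\<in>?S. int (?T w \<sigma>) * ?ch \<sigma>))"
    unfolding sum_distrib_left by (rule sum.swap)
  also have "\<dots> = (\<Sum>w\<in>?W. sign w * (\<Sum>V\<in>Pow {..<n}. fact (n - card V) * Xi dl0 eps0 L i V (\<mu> w)))"
  proof (intro sum.cong refl)
    fix w assume "w \<in> ?W"
    then have "(\<Sum>j<L. \<mu> w j) = int n"
      unfolding L_def \<mu>_def using n by (intro sum_lam) (auto simp: lam_def)
    from tabloid_trace[OF this, where i = i and dl = dl0 and eps = eps0]
    show "sign w * (\<Sum>\<sigma>\<in>?S. int (?T w \<sigma>) * ?ch \<sigma>) = sign w * (\<Sum>V\<in>Pow {..<n}. fact (n - card V) * Xi dl0 eps0 L i V (\<mu> w))"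
      by (rule arg_cong)
  qed
  finally have "f_mult TYPE('d) i \<nu> n =
     (\<Sum>w\<in>?W. of_int (sign w) * (of_int (\<Sum>V\<in>Pow {..<n}. fact (n - card V) * Xi dl0 eps0 L i V (\<mu> w)) / fact n))"
    by (simp only: of_int_sum[of _ ?W] of_int_mult[of "sign _"] sum_divide_distrib[of _ ?W] times_divide_eq_right)
  also have "\<dots> = (\<Sum>w\<in>?W. of_int (sign w) * (\<Sum>s\<le>2 * i. of_int (Xi dl0 eps0 L i {..<s} (\<mu> w)) / fact s))"
  proof (intro sum.cong refl)
    fix w assume "w \<in> ?W"
    then have "(\<Sum>j<L. \<mu> w j) = int n"
      unfolding L_def \<mu>_def using n by (intro sum_lam) (auto simp: lam_def)
    from tabloid_trace_stable[OF this, where i = i and dl = dl0 and eps = eps0]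
    show "of_int (sign w) * (of_int (\<Sum>V\<in>Pow {..<n}. fact (n - card V) * Xi dl0 eps0 L i V (\<mu> w)) / fact n) =
       of_int (sign w) * (\<Sum>s\<le>2 * i. of_int (Xi dl0 eps0 L i {..<s} (\<mu> w)) / (fact s :: rat))"
      by (rule arg_cong)
  qed
  also have "\<dots> = (\<Sum>s\<le>2 * i. of_int (\<Sum>w\<in>?W. sign w * Xi dl0 eps0 L i {..<s} (\<mu> w)) / fact s)"
    unfolding sum_distrib_left of_int_sum of_int_mult sum_divide_distrib times_divide_eq_right by (rule sum.swap)
  also have "\<dots> = (\<Sum>s\<le>2 * i. of_int (\<Sum>g\<in>BV {..<s} i. \<Sum>t\<in>{..<s} \<rightarrow>\<^sub>E {..<L}.
      ssum dl0 eps0 {..<s} t g * stairs lam s t) / fact s)"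
  proof (intro sum.cong refl arg_cong2[where f = "(/)"] arg_cong[where f = rat_of_int])
    fix s
    have "(\<Sum>w\<in>?W. sign w * Xi dl0 eps0 L i {..<s} (\<mu> w)) =
       (\<Sum>w\<in>?W. \<Sum>g\<in>BV {..<s} i. \<Sum>t\<in>{..<s} \<rightarrow>\<^sub>E {..<L}. ssum dl0 eps0 {..<s} t g *
           (sign w * (if \<forall>j<L. fib {..<s} t j \<le> \<mu> w j then 1 else 0)))"
      unfolding Xi_def sum_distrib_left by (intro sum.cong refl mult.left_commute)
    also have "\<dots> = (\<Sum>g\<in>BV {..<s} i. \<Sum>t\<in>{..<s} \<rightarrow>\<^sub>E {..<L}. \<Sum>w\<in>?W. ssum dl0 eps0 {..<s} t g *
           (sign w * (if \<forall>j<L. fib {..<s} t j \<le> \<mu> w j then 1 else 0)))"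
      by (subst sum.swap) (intro sum.cong refl sum.swap)
    also have "\<dots> = (\<Sum>g\<in>BV {..<s} i. \<Sum>t\<in>{..<s} \<rightarrow>\<^sub>E {..<L}. ssum dl0 eps0 {..<s} t g * stairs lam s t)"
    proof (intro sum.cong refl)
      fix g t
      have "(fib {..<s} t j \<le> \<mu> w j) = (fib {..<s} t j - int (lam ! j) + int j \<le> int (w j))" for w j
        unfolding \<mu>_def by linarith
      then show "(\<Sum>w\<in>?W. ssum dl0 eps0 {..<s} t g * (sign w * (if \<forall>j<L. fib {..<s} t j \<le> \<mu> w j then 1 else 0))) =
         ssum dl0 eps0 {..<s} t g * stairs lam s t"
        unfolding stairs_def stair_def L_def[symmetric] by (simp only: sum_distrib_left)
    qed
    finally show "(\<Sum>w\<in>?W. sign w * Xi dl0 eps0 L i {..<s} (\<mu> w)) =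
      (\<Sum>g\<in>BV {..<s} i. \<Sum>t\<in>{..<s} \<rightarrow>\<^sub>E {..<L}. ssum dl0 eps0 {..<s} t g * stairs lam s t)" .
  qed
  finally show ?thesis by (simp only: L_def lam_def list.size(4) add_0_right add_Suc_right One_nat_def)
qed

text \<open>A nonzero determinant would give \<open>sum_list \<nu>\<close> \<le> s \<le> 2 i by
  \<open>stair_bound\<close>; the bound on n makes the first row the longest, as required
  there.\<close>

lemma f_mult_zero:
  assumes i: "0 < i" and \<nu>: "is_partition \<nu>" "2 * i < sum_list \<nu>" and n: "sum_list \<nu> + first_part \<nu> \<le> n"
  shows "f_mult TYPE('d) i \<nu> n = 0"
proof -
  let ?lam = "(n - sum_list \<nu>) # \<nu>"
  have le: "\<nu> ! j \<le> first_part \<nu>" if "j < length \<nu>" for j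
    using that \<nu>(1) by (cases \<nu>; cases j) (auto simp: is_partition_def first_part_def)
  have st: "stairs ?lam s t = 0" if s: "s \<le> 2 * i" and t: "t \<in> {..<s} \<rightarrow>\<^sub>E {..<Suc (length \<nu>)}" for s t
  proof (rule ccontr)
    assume "stairs ?lam s t \<noteq> 0"
    then have "(\<Sum>j<length ?lam. int (?lam ! j)) - int (?lam ! 0) \<le> (\<Sum>j<length ?lam. fib {..<s} t j)"
      unfolding stairs_def
    proof (rule stair_bound)
      fix j assume "j < length ?lam"
      then show "int (?lam ! j) \<le> int (?lam ! 0)"
        using le[of "j - 1"] n by (cases j) auto
    qed (auto simp: fib_def)
    also have "(\<Sum>j<length ?lam. fib {..<s} t j) = int s"
      using sum_fib[of "{..<s}" t "length ?lam"] t by auto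
    also have "(\<Sum>j<length ?lam. int (?lam ! j)) = int (sum_list ?lam)"
      by (simp only: sum_list_sum_nth lessThan_atLeast0 of_nat_sum)
    finally show False using s \<nu>(2) by simp
  qed
  have "f_mult TYPE('d) i \<nu> n = (\<Sum>s\<le>2 * i. of_int (\<Sum>g\<in>BV {..<s} i. \<Sum>t\<in>{..<s} \<rightarrow>\<^sub>E {..<Suc (length \<nu>)}.
      ssum dl0 eps0 {..<s} t g * stairs ?lam s t) / fact s)"
    using n by (intro f_mult_formula[OF i]) simp
  also have "\<dots> = 0" using st by simp
  finally show ?thesis .
qed

text \<open>Only row 0 depends on n. If its fibre has more than b points the coefficient vanishes;
  otherwise its threshold is at most 0 for both n and m, and \<open>stair_cong\<close>
  applies.\<close>

lemma f_mult_const: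
  assumes i: "0 < i" and b: "odd CARD('d) \<and> b = i \<or> even CARD('d) \<and> b = Suc i"
    and nm: "sum_list \<nu> + b \<le> n" "sum_list \<nu> + b \<le> m"
  shows "f_mult TYPE('d) i \<nu> n = f_mult TYPE('d) i \<nu> m"
proof -
  let ?n = "(n - sum_list \<nu>) # \<nu>" and ?m = "(m - sum_list \<nu>) # \<nu>"
  have eq: "ssum dl0 eps0 {..<s} t g * stairs ?n s t = ssum dl0 eps0 {..<s} t g * stairs ?m s t"
    if g: "g \<in> BV {..<s} i" for s t g
  proof (cases "int b < fib {..<s} t 0")
    case True
    then have "ssum dl0 eps0 {..<s} t g = 0" using b by (intro ssum_zero[OF _ g]) auto
    then show ?thesis by simp
  next
    case False
    have "stair (Suc (length \<nu>)) (\<lambda>j. fib {..<s} t j - int (?n ! j) + int j) =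
          stair (Suc (length \<nu>)) (\<lambda>j. fib {..<s} t j - int (?m ! j) + int j)"
    proof (rule stair_cong)
      fix j
      show "fib {..<s} t j - int (?n ! j) + int j = fib {..<s} t j - int (?m ! j) + int j \<or>
        fib {..<s} t j - int (?n ! j) + int j \<le> 0 \<and> fib {..<s} t j - int (?m ! j) + int j \<le> 0"
        using False nm by (cases j) auto
    qed
    then show ?thesis by (simp add: stairs_def)
  qed
  have "(\<Sum>g\<in>BV {..<s} i. \<Sum>t\<in>{..<s} \<rightarrow>\<^sub>E {..<Suc (length \<nu>)}. ssum dl0 eps0 {..<s} t g * stairs ?n s t) =
     (\<Sum>g\<in>BV {..<s} i. \<Sum>t\<in>{..<s} \<rightarrow>\<^sub>E {..<Suc (length \<nu>)}. ssum dl0 eps0 {..<s} t g * stairs ?m s t)" for s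
    by (intro sum.cong refl eq)
  then show ?thesis using f_mult_formula[OF i, of \<nu> n] f_mult_formula[OF i, of \<nu> m] nm by simp
qed

end

theorem mainTheorem15:
  fixes i :: nat and \<nu> :: "nat list"
  assumes "CARD('d::finite) \<ge> 2" and "i \<ge> 1" and "is_partition \<nu>"
  shows "(2 * i < sum_list \<nu> \<longrightarrow>
            (\<forall>n \<ge> sum_list \<nu> + first_part \<nu>. f_mult TYPE('d) i \<nu> n = 0))
       \<and> (odd CARD('d) \<longrightarrow>
            (\<forall>n m. n \<ge> sum_list \<nu> + first_part \<nu> \<and> n \<ge> sum_list \<nu> + i
                 \<and> m \<ge> sum_list \<nu> + first_part \<nu> \<and> m \<ge> sum_list \<nu> + i
                 \<longrightarrow> f_mult TYPE('d) i \<nu> n = f_mult TYPE('d) i \<nu> m))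
       \<and> (even CARD('d) \<longrightarrow>
            (\<forall>n m. n \<ge> sum_list \<nu> + first_part \<nu> \<and> n \<ge> sum_list \<nu> + i + 1
                 \<and> m \<ge> sum_list \<nu> + first_part \<nu> \<and> m \<ge> sum_list \<nu> + i + 1
                 \<longrightarrow> f_mult TYPE('d) i \<nu> n = f_mult TYPE('d) i \<nu> m))"
proof -
  interpret punctured "TYPE('d)" "CARD('d) - 1" by standard (use assms(1) in auto)
  have i: "0 < i" using assms(2) by simp
  show ?thesis
  proof (intro conjI impI allI; (elim conjE)?)
    fix n assume "2 * i < sum_list \<nu>" "sum_list \<nu> + first_part \<nu> \<le> n"
    then show "f_mult TYPE('d) i \<nu> n = 0" by (rule f_mult_zero[OF i assms(3)])
  next
    fix n m assume "odd CARD('d)" "sum_list \<nu> + i \<le> n" "sum_list \<nu> + i \<le> m"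
    then show "f_mult TYPE('d) i \<nu> n = f_mult TYPE('d) i \<nu> m" by (intro f_mult_const[OF i, of i]) simp_all
  next
    fix n m assume "even CARD('d)" "sum_list \<nu> + i + 1 \<le> n" "sum_list \<nu> + i + 1 \<le> m"
    then show "f_mult TYPE('d) i \<nu> n = f_mult TYPE('d) i \<nu> m" by (intro f_mult_const[OF i, of "Suc i"]) simp_all
  qed
qed

end
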